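(* Let $N$ be the functor $N(W)=\mathbb Z_p\cdot 1_W$ for $W\in\Upsilon_H$ (the trivial functor) and let $x_U=1_U\in N(U)$. If for each $v\in I$ and $1\le i\le r_v$ the degree of $\mathfrak h_{v,i,*}$ lies in $d_{v,i}\cdot\mathbb Z_p$, then there exist classes $y_\nu\in M(K[\nu])$ for each $\nu\in\mathcal N$ such that $y_\varnothing=\iota_*(x_U)\in M(K)$ and $$\mathfrak H_{\mu\setminus\nu,*}(y_\nu)=\mathrm{pr}_{\mu,\nu,*}(y_\mu)$$ for all $\nu\subset\mu$ in $\mathcal N$.
   Context: **RIC functors.** Let $G$ be a locally profinite group and $\Upsilon$ a non-empty collection of compact open subgroups such that (T1) $\Upsilon$ is stable under $G$-conjugation; (T2) for $K,L\in\Upsilon$ there is $K'\in\Upsilon$ with $K'\triangleleft K$, $K'\subset L$; (T3) $\Upsilon$ is closed under pairwise intersection. $\mathcal P(G,\Upsilon)$ is the category with objects $\Upsilon$, $\mathrm{Hom}(L,K)=\{g\in G: g^{-1}Lg\subset K\}$ and composition $(L\xrightarrow{g}K)\circ(L'\xrightarrow{h}L)=(L'\xrightarrow{hg}K)$. An $R$-module valued RIC functor $M$ on $(G,\Upsilon)$ is a pair of functors $M^*:\mathcal P(G,\Upsilon)^{op}\to R\text{-Mod}$, $M_*:\mathcal P(G,\Upsilon)\to R\text{-Mod}$ agreeing on objects (common value $M(K)$); write $[g]^*_{L,K}:M(K)\to M(L)$, $[g]_{L,K,*}:M(L)\to M(K)$ for the induced maps and $\mathrm{pr}_{L,K}$ for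 $g=e$; it is required that $[g]^*_{L,K}=[g^{-1}]_{K,L,*}$ if $g^{-1}Lg=K$ and that $[\gamma]_{K,K,*}=\mathrm{id}$ for $\gamma\in K$. $M$ is *cohomological* if $\mathrm{pr}_{L,K,*}\circ\mathrm{pr}_{L,K}^*=[K:L]$ for $L\subset K$; *Mackey* if for $L,L'\subset K$ one has $\mathrm{pr}_{L,K}^*\circ\mathrm{pr}_{L',K,*}=\sum_{\gamma\in L\backslash K/L'}\mathrm{pr}_{L_\gamma,L,*}\circ[\gamma]^*_{L_\gamma,L'}$ with $L_\gamma=L\cap\gamma L'\gamma^{-1}$; *CoMack* if both. **Pushforwards.** For a closed subgroup $H\subset G$ and $\Upsilon_H\supset\{K\cap H:K\in\Upsilon_G\}$, a pushforward $\iota_*:N\to M$ from a RIC functor $N$ on $(H,\Upsilon_H)$ to $M$ on $(G,\Upsilon_G)$ is a family $\iota_{V,K',*}:N(V)\to M(K')$ for $V\in\Upsilon_H$, $K'\in\Upsilon_G$, $V\subset K'$, commuting with $[h]_*$ on both sides for $h\in H$ (whenever $h^{-1}V'h\subset V$, $h^{-1}L'h\subset K'$, $V'\subset L'$). It is *Mackey* if for $V,L\subset K'$: $\mathrm{pr}^*_{L,K'}\circ\iota_{V,K',*}=\sum_{\gamma\in V\backslash K'/L}[\gamma]_{\gamma L\gamma^{-1},L,*}\circ\iota_{V_\gamma,\gamma L\gamma^{-1},*}\circ\mathrm{pr}^*_{V_\gamma,V}$ with $V_\gamma=V\cap\gamma L\gamma^{-1}$. **Hecke correspondences.** $[K'\sigma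 K]:M(K)\to M(K')$ is $\mathrm{pr}_{K'\cap\sigma K\sigma^{-1},K',*}\circ[\sigma]^*\circ \mathrm{pr}^*_{K\cap\sigma^{-1}K'\sigma,K}$, and $[K'\sigma K]_*:=[K\sigma^{-1}K']$. **Setting.** $I$ is an index set; for $v\in I$, $H_v\subset G_v$ is a closed subgroup, both unimodular locally profinite; $K_v\subset G_v$ compact open, $U_v=H_v\cap K_v$, $L_v\triangleleft K_v$ compact open normal. $G=\prod'_vG_v$, $H=\prod'_vH_v$ are restricted products with respect to $K_v$, $U_v$; $K=\prod K_v$, $U=\prod U_v$. $\mathcal N$ is the set of finite subsets of $I$; for $\nu\in\mathcal N$, subscript $\nu$ denotes the product over $v\in\nu$ and superscript $\nu$ the part away from $\nu$; $K[\nu]=K^\nu L_\nu$. $\Upsilon_G$ satisfies (T1)-(T3) and contains $K$ and all $K[\nu]$; $\Upsilon_H$ satisfies (T1)-(T3) and contains $\{K'\cap H:K'\in\Upsilon_G\}$. $M$ on $(G,\Upsilon_G)$ is a $\mathbb Z_p$-module valued CoMack functor and $\iota_*:N\to M$ is a Mackey pushforward. For $\nu\subset\mu$, $\mathrm{pr}_{\mu,\nu,*}=\mathrm{pr}_{K[\mu],K[\nu],*}:M(K[\mu])\to M(K[\nu])$; $\iota_*(x_U)=\iota_{U,K,*}(x_U)$. The trivial functor $N(W)=\mathbb Z_p\cdot1_W$ is free of rank one with $[h]^*_{V,W}(1_W)=1_V$ and $[h]_{V,W,*}(1_V)=[W:h^{-1}Vh]\,1_W$. For each $v$, $\mathfrak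 H_v$ is a finite $\mathbb Z_p$-linear combination of characteristic functions of double cosets in $K_v\backslash G_v/K_v$. For disjoint $\mu,\nu\in\mathcal N$, $\mathfrak H_{\mu,*}:M(K[\nu])\to M(K[\nu])$ is the composition over $v\in\mu$ of the (commuting) operators $\sum_\sigma c_\sigma[K[\nu]\sigma K[\nu]]_*$ where $\mathfrak H_v=\sum_\sigma c_\sigma\mathrm{ch}(K_v\sigma K_v)$. Elements $g_{v,1},\dots,g_{v,r_v}\in G_v$ form a fixed set of representatives of $H_v\backslash H_v\cdot\mathrm{supp}(\mathfrak H_v)/K_v$; $H_{v,i}=H_v\cap g_{v,i}K_vg_{v,i}^{-1}$, $V_{v,i}=H_v\cap g_{v,i}L_vg_{v,i}^{-1}$ and $d_{v,i}=[H_{v,i}:V_{v,i}]$. The function $\mathfrak h_{v,i}:H_v\to\mathbb Z_p$, $h\mapsto\mathfrak H_v(hg_{v,i})$ is a finite combination $\sum_jc_j\,\mathrm{ch}(U_vh_jH_{v,i})$ over distinct double cosets, and the degree of $\mathfrak h_{v,i,*}$ is $\sum_jc_j\,|U_v\backslash U_vh_jH_{v,i}|$. *)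

theory Defs
  imports "HOL-Analysis.Analysis" "HOL-Algebra.Module" "HOL-Algebra.Product_Groups"
begin

section \<open>The ring of p-adic integers\<close>

text \<open>The inverse limit of the rings of integers modulo \<open>p ^ n\<close>: an element is the compatible
  sequence of its canonical residues.\<close>

definition padic_integers :: "nat \<Rightarrow> (nat \<Rightarrow> int) ring" where
  "padic_integers p =
    \<lparr>carrier = {x. \<forall>n. 0 \<le> x n \<and> x n < int p ^ n \<and> x (Suc n) mod int p ^ n = x n},
     mult = (\<lambda>x y n. (x n * y n) mod int p ^ n),
     one = (\<lambda>n. 1 mod int p ^ n),
     zero = (\<lambda>n. 0),
     add = (\<lambda>x y n. (x n + y n) mod int p ^ n)\<rparr>"

lemma cring_padic_integers:
  assumes "p > 0"
  shows "cring (padic_integers p)"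
proof -
  have pos: "int p ^ n > 0" for n using assms by simp
  have red: "(a mod int p ^ Suc n) mod int p ^ n = a mod int p ^ n" for a n
    by (rule mod_mod_cancel) simp
  have coh: "(f (x (Suc n)) (y (Suc n)) mod int p ^ Suc n) mod int p ^ n = f (x n) (y n) mod int p ^ n"
    if "x (Suc n) mod int p ^ n = x n" "y (Suc n) mod int p ^ n = y n" "f = (+) \<or> f = (*)"
    for x y :: "nat \<Rightarrow> int" and n and f :: "int \<Rightarrow> int \<Rightarrow> int"
    using that(3) unfolding red by (metis that(1,2) mod_add_eq mod_mult_eq)
  show ?thesis
  proof (rule cringI)
    show "abelian_group (padic_integers p)"
    proof (rule abelian_groupI)
      fix x assume x: "x \<in> carrier (padic_integers p)"
      define y where "y = (\<lambda>n. (- x n) mod int p ^ n)"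
      have "y \<in> carrier (padic_integers p)"
        using x pos red by (auto simp: padic_integers_def y_def) (metis mod_minus_eq)
      moreover have "y \<oplus>\<^bsub>padic_integers p\<^esub> x = \<zero>\<^bsub>padic_integers p\<^esub>"
        by (auto simp: padic_integers_def y_def mod_add_left_eq)
      ultimately show "\<exists>y\<in>carrier (padic_integers p). y \<oplus>\<^bsub>padic_integers p\<^esub> x = \<zero>\<^bsub>padic_integers p\<^esub>"
        by blast
    qed (use pos coh[where f = "(+)"] in
        \<open>auto simp: padic_integers_def fun_eq_iff mod_add_left_eq mod_add_right_eq ac_simps\<close>)
    show "Group.comm_monoid (padic_integers p)"
      by (rule comm_monoidI)
        (use pos red coh[where f = "(*)"] in
        \<open>auto simp: padic_integers_def fun_eq_iff mod_mult_left_eq mod_mult_right_eq ac_simps\<close>)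
  qed (auto simp: padic_integers_def fun_eq_iff mod_mult_left_eq mod_mult_right_eq mod_add_eq distrib_right)
qed

section \<open>Locally profinite groups\<close>

definition topological_group :: "('g, 'x) monoid_scheme \<Rightarrow> 'g topology \<Rightarrow> bool" where
  "topological_group G T \<longleftrightarrow>
    group G \<and> topspace T = carrier G \<and>
    continuous_map (prod_topology T T) T (\<lambda>(x, y). x \<otimes>\<^bsub>G\<^esub> y) \<and>
    continuous_map T T (\<lambda>x. inv\<^bsub>G\<^esub> x)"

definition compact_open_subgroup ::
  "('g, 'x) monoid_scheme \<Rightarrow> 'g topology \<Rightarrow> 'g set \<Rightarrow> bool" where
  "compact_open_subgroup G T K \<longleftrightarrow> subgroup K G \<and> compactin T K \<and> openin T K"

definition locally_profinite :: "('g, 'x) monoid_scheme \<Rightarrow> 'g topology \<Rightarrow> bool" where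
  "locally_profinite G T \<longleftrightarrow>
    topological_group G T \<and> Hausdorff_space T \<and>
    (\<forall>W. openin T W \<and> \<one>\<^bsub>G\<^esub> \<in> W \<longrightarrow> (\<exists>K. compact_open_subgroup G T K \<and> K \<subseteq> W))"

text \<open>A left Haar measure is a nonzero left-invariant Radon measure: finite on compact sets, outer
  regular on Borel sets and inner regular on open sets.\<close>

definition left_haar_measure ::
  "('g, 'x) monoid_scheme \<Rightarrow> 'g topology \<Rightarrow> 'g measure \<Rightarrow> bool" where
  "left_haar_measure G T m \<longleftrightarrow>
    space m = carrier G \<and> sets m = sigma_sets (carrier G) {W. openin T W} \<and>
    emeasure m (carrier G) \<noteq> 0 \<and>
    (\<forall>C. compactin T C \<longrightarrow> emeasure m C < \<infinity>) \<and>
    (\<forall>A\<in>sets m. emeasure m A = (INF W\<in>{W. openin T W \<and> A \<subseteq> W}. emeasure m W)) \<and>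
    (\<forall>W. openin T W \<longrightarrow> emeasure m W = (SUP C\<in>{C. compactin T C \<and> C \<subseteq> W}. emeasure m C)) \<and>
    (\<forall>g\<in>carrier G. \<forall>A\<in>sets m. emeasure m (g <#\<^bsub>G\<^esub> A) = emeasure m A)"

definition unimodular :: "('g, 'x) monoid_scheme \<Rightarrow> 'g topology \<Rightarrow> bool" where
  "unimodular G T \<longleftrightarrow>
    (\<exists>m. left_haar_measure G T m \<and>
      (\<forall>g\<in>carrier G. \<forall>A\<in>sets m. emeasure m (A #>\<^bsub>G\<^esub> g) = emeasure m A))"

section \<open>Conjugates, indices and double cosets\<close>

definition conjugate :: "('g, 'x) monoid_scheme \<Rightarrow> 'g \<Rightarrow> 'g set \<Rightarrow> 'g set" where
  "conjugate G g A = (\<lambda>a. g \<otimes>\<^bsub>G\<^esub> a \<otimes>\<^bsub>G\<^esub> inv\<^bsub>G\<^esub> g) ` A"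

definition index :: "('g, 'x) monoid_scheme \<Rightarrow> 'g set \<Rightarrow> 'g set \<Rightarrow> nat" where
  "index G A B = card (rcosets\<^bsub>G\<lparr>carrier := A\<rparr>\<^esub> B)"

definition double_coset :: "('g, 'x) monoid_scheme \<Rightarrow> 'g set \<Rightarrow> 'g \<Rightarrow> 'g set \<Rightarrow> 'g set" where
  "double_coset G A x B = (A #>\<^bsub>G\<^esub> x) <#>\<^bsub>G\<^esub> B"

text \<open>\<open>\<Gamma>\<close> is a set of representatives of \<open>A\<close>--\<open>B\<close> double cosets contained in \<open>X\<close>, where \<open>X\<close> is
  assumed to be a union of such double cosets.\<close>

definition double_coset_reps ::
  "('g, 'x) monoid_scheme \<Rightarrow> 'g set \<Rightarrow> 'g set \<Rightarrow> 'g set \<Rightarrow> 'g set \<Rightarrow> bool" where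
  "double_coset_reps G A X B \<Gamma> \<longleftrightarrow>
    \<Gamma> \<subseteq> X \<and> (\<forall>x\<in>X. \<exists>!\<gamma>. \<gamma> \<in> \<Gamma> \<and> x \<in> double_coset G A \<gamma> B)"

section \<open>RIC functors\<close>

locale level_family =
  fixes G :: "('g, 'x) monoid_scheme" and T :: "'g topology" and \<Upsilon> :: "'g set set"
  assumes nonempty: "\<Upsilon> \<noteq> {}"
    and compact_open: "K \<in> \<Upsilon> \<Longrightarrow> compact_open_subgroup G T K"
    and T1: "\<lbrakk>K \<in> \<Upsilon>; g \<in> carrier G\<rbrakk> \<Longrightarrow> conjugate G g K \<in> \<Upsilon>"
    and T2: "\<lbrakk>K \<in> \<Upsilon>; L \<in> \<Upsilon>\<rbrakk> \<Longrightarrow> \<exists>K'\<in>\<Upsilon>. K' \<lhd> (G\<lparr>carrier := K\<rparr>) \<and> K' \<subseteq> L"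
    and T3: "\<lbrakk>K \<in> \<Upsilon>; L \<in> \<Upsilon>\<rbrakk> \<Longrightarrow> K \<inter> L \<in> \<Upsilon>"

definition level_hom :: "('g, 'x) monoid_scheme \<Rightarrow> 'g set \<Rightarrow> 'g set \<Rightarrow> 'g set" where
  "level_hom G L K = {g \<in> carrier G. conjugate G (inv\<^bsub>G\<^esub> g) L \<subseteq> K}"

definition linear_maps ::
  "('r, 'x) ring_scheme \<Rightarrow> ('r, 'm, 'y) module_scheme \<Rightarrow> ('r, 'n, 'z) module_scheme
    \<Rightarrow> ('m \<Rightarrow> 'n) set" where
  "linear_maps R M N =
    {f \<in> carrier M \<rightarrow> carrier N.
      (\<forall>x\<in>carrier M. \<forall>y\<in>carrier M. f (x \<oplus>\<^bsub>M\<^esub> y) = f x \<oplus>\<^bsub>N\<^esub> f y) \<and>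
      (\<forall>a\<in>carrier R. \<forall>x\<in>carrier M. f (a \<odot>\<^bsub>M\<^esub> x) = a \<odot>\<^bsub>N\<^esub> f x)}"

text \<open>For a morphism \<open>g\<close> from \<open>L\<close> to \<open>K\<close>, the maps \<open>pull M L K g\<close> from \<open>M(K)\<close> to \<open>M(L)\<close> and
  \<open>push M L K g\<close> from \<open>M(L)\<close> to \<open>M(K)\<close> are the values at \<open>g\<close> of the contravariant and the covariant
  functor. Maps between modules only matter on the carriers.\<close>

record ('g, 'r, 'm) ric =
  val :: "'g set \<Rightarrow> ('r, 'm) module"
  pull :: "'g set \<Rightarrow> 'g set \<Rightarrow> 'g \<Rightarrow> 'm \<Rightarrow> 'm"
  push :: "'g set \<Rightarrow> 'g set \<Rightarrow> 'g \<Rightarrow> 'm \<Rightarrow> 'm"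

locale ric_functor =
  fixes R :: "('r, 'x) ring_scheme" and G :: "('g, 'y) monoid_scheme"
    and \<Upsilon> :: "'g set set" and M :: "('g, 'r, 'm) ric"
  assumes val_module: "K \<in> \<Upsilon> \<Longrightarrow> module R (val M K)"
    and pull_linear: "\<lbrakk>L \<in> \<Upsilon>; K \<in> \<Upsilon>; g \<in> level_hom G L K\<rbrakk>
      \<Longrightarrow> pull M L K g \<in> linear_maps R (val M K) (val M L)"
    and push_linear: "\<lbrakk>L \<in> \<Upsilon>; K \<in> \<Upsilon>; g \<in> level_hom G L K\<rbrakk>
      \<Longrightarrow> push M L K g \<in> linear_maps R (val M L) (val M K)"
    and pull_id: "\<lbrakk>K \<in> \<Upsilon>; x \<in> carrier (val M K)\<rbrakk> \<Longrightarrow> pull M K K \<one>\<^bsub>G\<^esub> x = x"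
    and push_id: "\<lbrakk>K \<in> \<Upsilon>; x \<in> carrier (val M K)\<rbrakk> \<Longrightarrow> push M K K \<one>\<^bsub>G\<^esub> x = x"
    and pull_comp: "\<lbrakk>L' \<in> \<Upsilon>; L \<in> \<Upsilon>; K \<in> \<Upsilon>; g \<in> level_hom G L K; h \<in> level_hom G L' L;
        x \<in> carrier (val M K)\<rbrakk>
      \<Longrightarrow> pull M L' K (h \<otimes>\<^bsub>G\<^esub> g) x = pull M L' L h (pull M L K g x)"
    and push_comp: "\<lbrakk>L' \<in> \<Upsilon>; L \<in> \<Upsilon>; K \<in> \<Upsilon>; g \<in> level_hom G L K; h \<in> level_hom G L' L;
        x \<in> carrier (val M L')\<rbrakk>
      \<Longrightarrow> push M L' K (h \<otimes>\<^bsub>G\<^esub> g) x = push M L K g (push M L' L h x)"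
    and pull_eq_push: "\<lbrakk>L \<in> \<Upsilon>; K \<in> \<Upsilon>; g \<in> carrier G; conjugate G (inv\<^bsub>G\<^esub> g) L = K;
        x \<in> carrier (val M K)\<rbrakk>
      \<Longrightarrow> pull M L K g x = push M K L (inv\<^bsub>G\<^esub> g) x"
    and push_inner: "\<lbrakk>K \<in> \<Upsilon>; \<gamma> \<in> K; x \<in> carrier (val M K)\<rbrakk> \<Longrightarrow> push M K K \<gamma> x = x"

locale cohomological_functor = ric_functor +
  assumes cohomological: "\<lbrakk>L \<in> \<Upsilon>; K \<in> \<Upsilon>; L \<subseteq> K; x \<in> carrier (val M K)\<rbrakk>
    \<Longrightarrow> push M L K \<one>\<^bsub>G\<^esub> (pull M L K \<one>\<^bsub>G\<^esub> x) = [index G K L] \<cdot>\<^bsub>val M K\<^esub> x"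

locale mackey_functor = ric_functor +
  assumes mackey: "\<lbrakk>L \<in> \<Upsilon>; L' \<in> \<Upsilon>; K \<in> \<Upsilon>; L \<subseteq> K; L' \<subseteq> K; double_coset_reps G L K L' \<Gamma>;
      x \<in> carrier (val M L')\<rbrakk>
    \<Longrightarrow> pull M L K \<one>\<^bsub>G\<^esub> (push M L' K \<one>\<^bsub>G\<^esub> x) =
      (\<Oplus>\<^bsub>val M L\<^esub>\<gamma>\<in>\<Gamma>. push M (L \<inter> conjugate G \<gamma> L') L \<one>\<^bsub>G\<^esub>
        (pull M (L \<inter> conjugate G \<gamma> L') L' \<gamma> x))"

locale comack_functor = cohomological_functor + mackey_functor

text \<open>The functor with value \<open>R\<close>, the free module on one generator \<open>1\<^sub>W\<close>, at every \<open>W\<close>; the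
  generator is the unit of \<open>R\<close>.\<close>

definition regular_module :: "'r ring \<Rightarrow> ('r, 'r) module" where
  "regular_module R =
    \<lparr>carrier = carrier R, mult = mult R, one = one R, zero = zero R, add = add R, smult = mult R\<rparr>"

definition trivial_functor :: "'r ring \<Rightarrow> ('g, 'x) monoid_scheme \<Rightarrow> ('g, 'r, 'r) ric" where
  "trivial_functor R H =
    \<lparr>val = (\<lambda>W. regular_module R),
     pull = (\<lambda>V W h x. x),
     push = (\<lambda>V W h x. [index H W (conjugate H (inv\<^bsub>H\<^esub> h) V)] \<cdot>\<^bsub>R\<^esub> x)\<rparr>"

section \<open>Pushforwards\<close>

text \<open>\<open>H\<close> is a subgroup of \<open>G\<close>, with the same multiplication.\<close>

locale pushforward =
  N: ric_functor R H \<Upsilon>\<^sub>H N + M: ric_functor R G \<Upsilon>\<^sub>G M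
  for R :: "('r, 'x) ring_scheme"
    and H :: "('g, 'y) monoid_scheme" and \<Upsilon>\<^sub>H and N :: "('g, 'r, 'n) ric"
    and G :: "('g, 'z) monoid_scheme" and \<Upsilon>\<^sub>G and M :: "('g, 'r, 'm) ric" +
  fixes \<iota> :: "'g set \<Rightarrow> 'g set \<Rightarrow> 'n \<Rightarrow> 'm"
  assumes linear: "\<lbrakk>V \<in> \<Upsilon>\<^sub>H; K' \<in> \<Upsilon>\<^sub>G; V \<subseteq> K'\<rbrakk> \<Longrightarrow> \<iota> V K' \<in> linear_maps R (val N V) (val M K')"
    and commutes: "\<lbrakk>V \<in> \<Upsilon>\<^sub>H; V' \<in> \<Upsilon>\<^sub>H; K' \<in> \<Upsilon>\<^sub>G; L' \<in> \<Upsilon>\<^sub>G; V \<subseteq> K'; V' \<subseteq> L'; h \<in> carrier H;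
        h \<in> level_hom H V' V; h \<in> level_hom G L' K'; x \<in> carrier (val N V')\<rbrakk>
      \<Longrightarrow> \<iota> V K' (push N V' V h x) = push M L' K' h (\<iota> V' L' x)"

locale mackey_pushforward = pushforward +
  assumes mackey: "\<lbrakk>V \<in> \<Upsilon>\<^sub>H; L \<in> \<Upsilon>\<^sub>G; K' \<in> \<Upsilon>\<^sub>G; V \<subseteq> K'; L \<subseteq> K'; double_coset_reps G V K' L \<Gamma>;
      x \<in> carrier (val N V)\<rbrakk>
    \<Longrightarrow> pull M L K' \<one>\<^bsub>G\<^esub> (\<iota> V K' x) =
      (\<Oplus>\<^bsub>val M L\<^esub>\<gamma>\<in>\<Gamma>. push M (conjugate G \<gamma> L) L \<gamma>
        (\<iota> (V \<inter> conjugate G \<gamma> L) (conjugate G \<gamma> L) (pull N (V \<inter> conjugate G \<gamma> L) V \<one>\<^bsub>H\<^esub> x)))"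

section \<open>Hecke correspondences\<close>

text \<open>\<open>hecke M G K' \<sigma> K\<close> is the correspondence \<open>[K' \<sigma> K]\<close> from \<open>M(K)\<close> to \<open>M(K')\<close>, and
  \<open>hecke_push M G K' \<sigma> K\<close> is \<open>[K' \<sigma> K]\<^sub>*\<close> from \<open>M(K')\<close> to \<open>M(K)\<close>.\<close>

definition hecke ::
  "('g, 'r, 'm) ric \<Rightarrow> ('g, 'x) monoid_scheme \<Rightarrow> 'g set \<Rightarrow> 'g \<Rightarrow> 'g set \<Rightarrow> 'm \<Rightarrow> 'm" where
  "hecke M G K' \<sigma> K x =
    push M (K' \<inter> conjugate G \<sigma> K) K' \<one>\<^bsub>G\<^esub>
      (pull M (K' \<inter> conjugate G \<sigma> K) (K \<inter> conjugate G (inv\<^bsub>G\<^esub> \<sigma>) K') \<sigma>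
        (pull M (K \<inter> conjugate G (inv\<^bsub>G\<^esub> \<sigma>) K') K \<one>\<^bsub>G\<^esub> x))"

definition hecke_push ::
  "('g, 'r, 'm) ric \<Rightarrow> ('g, 'x) monoid_scheme \<Rightarrow> 'g set \<Rightarrow> 'g \<Rightarrow> 'g set \<Rightarrow> 'm \<Rightarrow> 'm" where
  "hecke_push M G K' \<sigma> K = hecke M G K (inv\<^bsub>G\<^esub> \<sigma>) K'"

text \<open>The linear combination of characteristic functions of the double cosets \<open>K \<sigma> K\<close>, for \<open>\<sigma>\<close>
  in \<open>S\<close>, with coefficients \<open>c \<sigma>\<close>.\<close>

definition hecke_function ::
  "'r ring \<Rightarrow> ('g, 'x) monoid_scheme \<Rightarrow> 'g set \<Rightarrow> 'g set \<Rightarrow> ('g \<Rightarrow> 'r) \<Rightarrow> 'g \<Rightarrow> 'r" where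
  "hecke_function R G K S c x =
    (\<Oplus>\<^bsub>R\<^esub>\<sigma>\<in>S. c \<sigma> \<otimes>\<^bsub>R\<^esub> (if x \<in> double_coset G K \<sigma> K then \<one>\<^bsub>R\<^esub> else \<zero>\<^bsub>R\<^esub>))"

definition hecke_support ::
  "'r ring \<Rightarrow> ('g, 'x) monoid_scheme \<Rightarrow> 'g set \<Rightarrow> 'g set \<Rightarrow> ('g \<Rightarrow> 'r) \<Rightarrow> 'g set" where
  "hecke_support R G K S c = {x \<in> carrier G. hecke_function R G K S c x \<noteq> \<zero>\<^bsub>R\<^esub>}"

text \<open>The degree of a function \<open>f\<close> on \<open>H\<close> that is left \<open>U\<close>- and right \<open>V\<close>-invariant, with support
  a finite union of double cosets: the sum over the double cosets \<open>D\<close> in its support of the value of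
  \<open>f\<close> on \<open>D\<close> times the number of right cosets of \<open>U\<close> in \<open>D\<close>.\<close>

definition hecke_degree ::
  "'r ring \<Rightarrow> ('g, 'x) monoid_scheme \<Rightarrow> 'g set \<Rightarrow> 'g set \<Rightarrow> ('g \<Rightarrow> 'r) \<Rightarrow> 'r" where
  "hecke_degree R H U V f =
    (\<Oplus>\<^bsub>R\<^esub>D\<in>{double_coset H U h V | h. h \<in> carrier H \<and> f h \<noteq> \<zero>\<^bsub>R\<^esub>}.
      [card ((\<lambda>x. U #>\<^bsub>H\<^esub> x) ` D)] \<cdot>\<^bsub>R\<^esub> f (SOME h. h \<in> D))"

section \<open>Restricted products\<close>

definition restricted_product ::
  "'i set \<Rightarrow> ('i \<Rightarrow> ('g, 'x) monoid_scheme) \<Rightarrow> ('i \<Rightarrow> 'g set) \<Rightarrow> ('i \<Rightarrow> 'g) monoid" where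
  "restricted_product I G K =
    (product_group I G)
      \<lparr>carrier := {x \<in> carrier (product_group I G). finite {v \<in> I. x v \<notin> K v}}\<rparr>"

definition restricted_topology ::
  "'i set \<Rightarrow> ('i \<Rightarrow> 'g topology) \<Rightarrow> ('i \<Rightarrow> 'g set) \<Rightarrow> ('i \<Rightarrow> 'g) topology" where
  "restricted_topology I T K =
    topology_generated_by
      {Pi\<^sub>E I W | W. (\<forall>v\<in>I. openin (T v) (W v)) \<and> finite {v \<in> I. W v \<noteq> K v}}"

definition product_level ::
  "'i set \<Rightarrow> ('i \<Rightarrow> 'g set) \<Rightarrow> ('i \<Rightarrow> 'g set) \<Rightarrow> 'i set \<Rightarrow> ('i \<Rightarrow> 'g) set" where
  "product_level I K L \<nu> = (\<Pi>\<^sub>E v\<in>I. if v \<in> \<nu> then L v else K v)"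

definition place_embedding ::
  "'i set \<Rightarrow> ('i \<Rightarrow> ('g, 'x) monoid_scheme) \<Rightarrow> 'i \<Rightarrow> 'g \<Rightarrow> 'i \<Rightarrow> 'g" where
  "place_embedding I G v \<sigma> = (\<lambda>w\<in>I. if w = v then \<sigma> else \<one>\<^bsub>G w\<^esub>)"

text \<open>The operator on \<open>M(J)\<close> attached to the Hecke function at the place \<open>v\<close> with representatives
  \<open>S v\<close> and coefficients \<open>c v\<close>, and the composite of these operators over a list of places.\<close>

definition place_operator ::
  "'i set \<Rightarrow> ('i \<Rightarrow> ('g, 'x) monoid_scheme) \<Rightarrow> ('i \<Rightarrow> 'g set) \<Rightarrow> ('i \<Rightarrow> 'g, 'r, 'm) ric
    \<Rightarrow> ('i \<Rightarrow> 'g set) \<Rightarrow> ('i \<Rightarrow> 'g \<Rightarrow> 'r) \<Rightarrow> ('i \<Rightarrow> 'g) set \<Rightarrow> 'i \<Rightarrow> 'm \<Rightarrow> 'm" where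
  "place_operator I G K M S c J v y =
    (\<Oplus>\<^bsub>val M J\<^esub>\<sigma>\<in>S v. c v \<sigma> \<odot>\<^bsub>val M J\<^esub>
      hecke_push M (restricted_product I G K) J (place_embedding I G v \<sigma>) J y)"

definition places_operator ::
  "'i set \<Rightarrow> ('i \<Rightarrow> ('g, 'x) monoid_scheme) \<Rightarrow> ('i \<Rightarrow> 'g set) \<Rightarrow> ('i \<Rightarrow> 'g, 'r, 'm) ric
    \<Rightarrow> ('i \<Rightarrow> 'g set) \<Rightarrow> ('i \<Rightarrow> 'g \<Rightarrow> 'r) \<Rightarrow> ('i \<Rightarrow> 'g) set \<Rightarrow> 'i list \<Rightarrow> 'm \<Rightarrow> 'm" where
  "places_operator I G K M S c J vs = foldr (place_operator I G K M S c J) vs"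

end

theory Submission
  imports Defs
begin

text \<open>
  For \<open>a \<in> G\<close> and a level \<open>J\<close> let \<open>\<zeta>\<^sub>J(a) \<in> M(J)\<close> be the image under \<open>[a]\<^sub>*\<close> of the pushforward of \<open>1\<close> from
  \<open>H \<inter> aJa\<^sup>-\<^sup>1\<close> to \<open>aJa\<^sup>-\<^sup>1\<close>; it depends only on the double coset \<open>HaJ\<close>. The trace from \<open>J'\<close> to \<open>J\<close> sends
  \<open>\<zeta>\<^bsub>J'\<^esub>(a)\<close> to \<open>[H \<inter> aJa\<^sup>-\<^sup>1 : H \<inter> aJ'a\<^sup>-\<^sup>1] \<zeta>\<^sub>J(a)\<close>, and the Mackey axiom of the pushforward expands
  \<open>[J\<sigma>J]\<^sub>* \<zeta>\<^sub>J(a)\<close> over \<open>(H \<inter> aJa\<^sup>-\<^sup>1)\<close>--\<open>J\<close> double cosets in \<open>aJ\<sigma>J\<close>. At a place \<open>v\<close> where \<open>a\<^sub>v = 1\<close> and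
  \<open>J\<^sub>v = K\<^sub>v\<close>, grouping these by the classes \<open>H\<^sub>v g\<^sub>i K\<^sub>v\<close> turns the coefficients into the degrees of the
  functions \<open>h\<^bsub>v,i\<^esub>\<close>, so that \<open>\<H>\<^sub>v \<zeta>\<^sub>J(a) = \<Sum>\<^sub>i deg(h\<^bsub>v,i\<^esub>) \<zeta>\<^sub>J(g\<^sub>i a)\<close>. Writing \<open>deg(h\<^bsub>v,i\<^esub>) = d\<^bsub>v,i\<^esub> z\<^bsub>v,i\<^esub>\<close>, the
  classes \<open>y\<^sub>\<nu> = \<Sum>\<^sub>\<alpha> (\<Prod>\<^sub>v z\<^bsub>v,\<alpha>(v)\<^esub>) \<zeta>\<^bsub>K[\<nu>]\<^esub>(g\<^sub>\<alpha>)\<close>, with \<open>\<alpha>\<close> running over the choices of one index for each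
  place of \<open>\<nu>\<close>, satisfy the required relations: the factors \<open>d\<^bsub>v,i\<^esub>\<close> missing in \<open>y\<^sub>\<mu>\<close> are the indices
  produced by the trace.
\<close>

section \<open>Linear maps, conjugates and indices\<close>

text \<open>The modules M(K[\<nu>]) may have torsion, so nothing can be divided there. Divisibility
  of the degrees is therefore used only in Z_p: quotients z are fixed once for all v and i, and
  y_\<nu> is built from them. The two sides of a norm relation are then computed separately and turn
  out to be the same combination of zeta classes at level K[\<nu>], with a factor z at the places of
  \<nu> and a full degree at the other places of \<mu>. The Hecke operators contribute these degrees
  directly; the trace contributes the factor d that completes z. The degree appears through a count.
  The Mackey formula yields the index of H \<inter> K \<inter> xKx^-1 in H \<inter> xKx^-1. This is
  the number of right cosets of U = H \<inter> K in the slice of all h in H with h g_i in UxK, and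
  that slice is a single double coset of U and H_i = H \<inter> g_i K g_i^-1. The local formula at v
  asks only that a be trivial at v and that the level be K_v there, so places can be treated one at
  a time, in any order.\<close>

lemma (in comm_monoid) finprod_swap:
  assumes "finite X" "finite Y" "\<And>i j. \<lbrakk>i \<in> X; j \<in> Y\<rbrakk> \<Longrightarrow> f i j \<in> carrier G"
  shows "finprod G (\<lambda>i. finprod G (f i) Y) X = finprod G (\<lambda>j. finprod G (\<lambda>i. f i j) X) Y"
  using assms(1,3)
proof (induction X)
  case (insert x X)
  then have "finprod G (\<lambda>i. finprod G (f i) Y) (insert x X) =
      finprod G (f x) Y \<otimes> finprod G (\<lambda>j. finprod G (\<lambda>i. f i j) X) Y"
    by (subst finprod_insert) (auto intro!: finprod_closed)
  also have "\<dots> = finprod G (\<lambda>j. f x j \<otimes> finprod G (\<lambda>i. f i j) X) Y"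
    using insert.prems by (intro finprod_multf[symmetric]) (auto intro!: finprod_closed)
  also have "\<dots> = finprod G (\<lambda>j. finprod G (\<lambda>i. f i j) (insert x X)) Y"
    using insert by (intro finprod_cong') (auto intro!: finprod_insert[symmetric] finprod_closed)
  finally show ?case .
qed simp

lemmas (in abelian_monoid) finsum_swap = add.finprod_swap
lemmas (in abelian_monoid) finsum_UN_disjoint = add.finprod_UN_disjoint
lemmas (in abelian_monoid) finsum_mono_neutral_cong_right = add.finprod_mono_neutral_cong_right
lemmas (in abelian_monoid) finsum_eq = add.finprod_cong'

lemma (in module) finsum_smult_rdistr:
  assumes "f \<in> X \<rightarrow> carrier R" "x \<in> carrier M"
  shows "finsum R f X \<odot>\<^bsub>M\<^esub> x = (\<Oplus>\<^bsub>M\<^esub>i\<in>X. f i \<odot>\<^bsub>M\<^esub> x)"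
  using assms(1)
proof (induction X rule: infinite_finite_induct)
  case (insert i X)
  then show ?case using assms(2) by (simp add: Pi_def smult_l_distr)
qed (use assms(2) in auto)

lemma linear_maps_zero:
  assumes "module R M" "module R N" "f \<in> linear_maps R M N"
  shows "f \<zero>\<^bsub>M\<^esub> = \<zero>\<^bsub>N\<^esub>"
proof -
  interpret M: module R M by fact
  interpret N: module R N by fact
  have "\<forall>a\<in>carrier R. \<forall>x\<in>carrier M. f (a \<odot>\<^bsub>M\<^esub> x) = a \<odot>\<^bsub>N\<^esub> f x" and cl: "f \<zero>\<^bsub>M\<^esub> \<in> carrier N"
    using assms(3) by (auto simp: linear_maps_def)
  then have "f (\<zero>\<^bsub>R\<^esub> \<odot>\<^bsub>M\<^esub> \<zero>\<^bsub>M\<^esub>) = \<zero>\<^bsub>R\<^esub> \<odot>\<^bsub>N\<^esub> f \<zero>\<^bsub>M\<^esub>"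
    by blast
  with cl show ?thesis by simp
qed

lemma linear_maps_finsum:
  assumes "module R M" "module R N" "f \<in> linear_maps R M N" "x \<in> X \<rightarrow> carrier M"
  shows "f (finsum M x X) = (\<Oplus>\<^bsub>N\<^esub>i\<in>X. f (x i))"
proof -
  interpret M: module R M by fact
  interpret N: module R N by fact
  have cl: "f y \<in> carrier N" if "y \<in> carrier M" for y
    using assms(3) that by (auto simp: linear_maps_def)
  show ?thesis using assms(4)
  proof (induction X rule: infinite_finite_induct)
    case (insert i X)
    have x: "x i \<in> carrier M" "x \<in> X \<rightarrow> carrier M" using insert.prems by auto
    then have "f (x i \<oplus>\<^bsub>M\<^esub> finsum M x X) = f (x i) \<oplus>\<^bsub>N\<^esub> f (finsum M x X)"
      using assms(3) by (simp add: linear_maps_def)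
    with insert x cl show ?case by (simp add: Pi_def)
  qed (use linear_maps_zero[OF assms(1-3)] in auto)
qed

lemma linear_maps_smult:
  "\<lbrakk>f \<in> linear_maps R M N; a \<in> carrier R; x \<in> carrier M\<rbrakk> \<Longrightarrow> f (a \<odot>\<^bsub>M\<^esub> x) = a \<odot>\<^bsub>N\<^esub> f x"
  by (simp add: linear_maps_def)

lemma linear_maps_closed: "\<lbrakk>f \<in> linear_maps R M N; x \<in> carrier M\<rbrakk> \<Longrightarrow> f x \<in> carrier N"
  by (auto simp: linear_maps_def)

context group
begin

section \<open>Conjugates of subsets and of subgroups\<close>

lemma inv_mult_cancel:
  "\<lbrakk>a \<in> carrier G; b \<in> carrier G\<rbrakk> \<Longrightarrow> inv a \<otimes> (a \<otimes> b) = b"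
  "\<lbrakk>a \<in> carrier G; b \<in> carrier G\<rbrakk> \<Longrightarrow> a \<otimes> (inv a \<otimes> b) = b"
  by (simp_all add: m_assoc[symmetric])

lemma conjugate_conjugate:
  assumes "a \<in> carrier G" "b \<in> carrier G" "A \<subseteq> carrier G"
  shows "conjugate G a (conjugate G b A) = conjugate G (a \<otimes> b) A"
  unfolding conjugate_def image_image
  by (intro image_cong refl) (use assms in \<open>auto simp: m_assoc inv_mult_group subset_iff\<close>)

lemma conjugate_closed: "\<lbrakk>a \<in> carrier G; A \<subseteq> carrier G\<rbrakk> \<Longrightarrow> conjugate G a A \<subseteq> carrier G"
  by (auto simp: conjugate_def)

lemma conjugate_one: "A \<subseteq> carrier G \<Longrightarrow> conjugate G \<one> A = A"
  by (force simp: conjugate_def)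

lemma conjugate_inv_cancel:
  "\<lbrakk>a \<in> carrier G; A \<subseteq> carrier G\<rbrakk> \<Longrightarrow> conjugate G (inv a) (conjugate G a A) = A"
  by (simp add: conjugate_conjugate conjugate_one)

lemma conjugate_cancel_inv:
  "\<lbrakk>a \<in> carrier G; A \<subseteq> carrier G\<rbrakk> \<Longrightarrow> conjugate G a (conjugate G (inv a) A) = A"
  by (simp add: conjugate_conjugate conjugate_one)

lemma mem_conjugate_iff:
  assumes "a \<in> carrier G" "A \<subseteq> carrier G" "x \<in> carrier G"
  shows "x \<in> conjugate G a A \<longleftrightarrow> inv a \<otimes> x \<otimes> a \<in> A"
proof
  assume "x \<in> conjugate G a A"
  then obtain y where "y \<in> A" "x = a \<otimes> y \<otimes> inv a" by (auto simp: conjugate_def)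
  then show "inv a \<otimes> x \<otimes> a \<in> A" using assms by (simp add: m_assoc subset_iff inv_mult_cancel)
next
  assume "inv a \<otimes> x \<otimes> a \<in> A"
  moreover have "x = a \<otimes> (inv a \<otimes> x \<otimes> a) \<otimes> inv a"
    using assms by (simp add: m_assoc) (simp add: m_assoc[symmetric])
  ultimately show "x \<in> conjugate G a A" unfolding conjugate_def by blast
qed

lemma conjugate_Int:
  assumes "a \<in> carrier G" "A \<subseteq> carrier G" "B \<subseteq> carrier G"
  shows "conjugate G a (A \<inter> B) = conjugate G a A \<inter> conjugate G a B"
  unfolding conjugate_def
  by (rule inj_on_image_Int[of _ "carrier G"]) (use assms in \<open>auto simp: inj_on_def\<close>)

lemma conjugate_mono: "A \<subseteq> B \<Longrightarrow> conjugate G a A \<subseteq> conjugate G a B"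
  by (auto simp: conjugate_def)

lemma subgroup_conjugate:
  assumes "a \<in> carrier G" "subgroup A G"
  shows "subgroup (conjugate G a A) G"
proof -
  note A = subgroup.subset[OF assms(2)]
  have "inv (a \<otimes> x \<otimes> inv a) = a \<otimes> inv x \<otimes> inv a" "x \<in> A \<Longrightarrow> y \<in> A \<Longrightarrow> 
    (a \<otimes> x \<otimes> inv a) \<otimes> (a \<otimes> y \<otimes> inv a) = a \<otimes> (x \<otimes> y) \<otimes> inv a" if "x \<in> A" for x y
    using that A assms(1) by (auto simp: m_assoc inv_mult_group subset_iff inv_mult_cancel)
  then show ?thesis
    using assms A subgroup.m_closed[OF assms(2)] subgroup.m_inv_closed[OF assms(2)] subgroup.one_closed[OF assms(2)]
    by (intro subgroupI) (auto simp: conjugate_def)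
qed

lemma conjugate_self:
  assumes "subgroup A G" "a \<in> A"
  shows "conjugate G a A = A"
proof -
  have a: "a \<in> carrier G" "A \<subseteq> carrier G" using assms subgroup.subset by auto
  have "x \<in> conjugate G a A \<longleftrightarrow> x \<in> A" if "x \<in> carrier G" for x
    unfolding mem_conjugate_iff[OF a that]
  proof
    assume "inv a \<otimes> x \<otimes> a \<in> A"
    then have "a \<otimes> (inv a \<otimes> x \<otimes> a) \<otimes> inv a \<in> A"
      using assms by (blast intro: subgroup.m_closed subgroup.m_inv_closed)
    then show "x \<in> A" using a that by (simp add: m_assoc) (simp add: m_assoc[symmetric])
  qed (use assms in \<open>blast intro: subgroup.m_closed subgroup.m_inv_closed\<close>)
  then show ?thesis using a conjugate_closed[OF a] by blast
qed

lemma m_inv_restrict_subgroup: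
  assumes "subgroup B G" "x \<in> B"
  shows "inv\<^bsub>G\<lparr>carrier := B\<rparr>\<^esub> x = inv x"
  using m_inv_consistent[OF assms] by simp

lemma conjugate_restrict:
  assumes "subgroup B G" "b \<in> B"
  shows "conjugate (G\<lparr>carrier := B\<rparr>) b A = conjugate G b A"
  using m_inv_restrict_subgroup[OF assms] by (simp add: conjugate_def)

lemma mem_double_coset:
  "x \<in> double_coset G A g B \<longleftrightarrow> (\<exists>a\<in>A. \<exists>b\<in>B. x = a \<otimes> g \<otimes> b)"
  by (auto simp: double_coset_def r_coset_def set_mult_def)

end

text \<open>Two maps with the same fibres on X have images in bijection: a value of \<open>f\<close>
  is sent to \<open>g\<close> at a chosen preimage. It serves to compare numbers of cosets with
  respect to different subgroups.\<close>

lemma card_image_eq_card_image: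
  assumes "\<And>a b. \<lbrakk>a \<in> X; b \<in> X\<rbrakk> \<Longrightarrow> f a = f b \<longleftrightarrow> g a = g b"
  shows "card (f ` X) = card (g ` X)"
proof (rule bij_betw_same_card)
  have sel: "(SOME a. a \<in> X \<and> f a = f b) \<in> X \<and> f (SOME a. a \<in> X \<and> f a = f b) = f b" if "b \<in> X" for b
    by (rule someI[of "\<lambda>a. a \<in> X \<and> f a = f b"]) (use that in auto)
  show "bij_betw (\<lambda>y. g (SOME a. a \<in> X \<and> f a = y)) (f ` X) (g ` X)"
  proof (rule bij_betw_imageI)
    have *: "g (SOME a. a \<in> X \<and> f a = f b) = g b" if "b \<in> X" for b
      using sel[OF that] assms that by blast
    show "inj_on (\<lambda>y. g (SOME a. a \<in> X \<and> f a = y)) (f ` X)"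
      using assms by (auto simp: inj_on_def *)
    show "(\<lambda>y. g (SOME a. a \<in> X \<and> f a = y)) ` f ` X = g ` X"
      by (force simp: * image_image)
  qed
qed

lemma index_self:
  assumes "subgroup A G" "group G"
  shows "index G A A = 1"
proof -
  interpret group "G\<lparr>carrier := A\<rparr>" using subgroup.subgroup_is_group[OF assms] .
  have "rcosets\<^bsub>G\<lparr>carrier := A\<rparr>\<^esub> A = {A}"
    using coset_join2[OF _ subgroup_self] one_closed by (auto simp: RCOSETS_def simp del: one_closed)
  then show ?thesis by (simp add: index_def)
qed

lemma index_altdef: "index G A B = card ((\<lambda>a. B #>\<^bsub>G\<^esub> a) ` A)"
proof -
  have "rcosets\<^bsub>G\<lparr>carrier := A\<rparr>\<^esub> B = (\<lambda>a. B #>\<^bsub>G\<^esub> a) ` A"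
    by (auto simp: RCOSETS_def r_coset_def)
  then show ?thesis by (simp add: index_def)
qed

section \<open>Zeta classes of a Mackey pushforward from the trivial functor\<close>

text \<open>The setting for zeta classes without any product structure. The subgroup is given as
  \<open>A\<close> with its carrier cut down to \<open>B\<close>, so both groups share
  multiplication and unit, and a morphism \<open>b\<close> in \<open>B\<close> makes sense on both
  sides of \<iota>.\<close>

locale trivial_pushforward =
  A: group A + G: level_family A T \<Upsilon> + H: level_family "A\<lparr>carrier := B\<rparr>" T' \<Upsilon>' +
  mackey_pushforward R "A\<lparr>carrier := B\<rparr>" \<Upsilon>' "trivial_functor R (A\<lparr>carrier := B\<rparr>)" A \<Upsilon> M \<iota>
  for R :: "'r ring" and A :: "('g, 'x) monoid_scheme" and T \<Upsilon> B T' \<Upsilon>'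
    and M :: "('g, 'r, 'm) ric" and \<iota> +
  assumes subgroup_B: "subgroup B A"
    and restrict_level: "J \<in> \<Upsilon> \<Longrightarrow> J \<inter> B \<in> \<Upsilon>'"
begin

lemma B_subset: "B \<subseteq> carrier A"
  using subgroup_B by (rule subgroup.subset)

lemma level_subgroup: "J \<in> \<Upsilon> \<Longrightarrow> subgroup J A"
  using G.compact_open by (auto simp: compact_open_subgroup_def)

lemma level_subset: "J \<in> \<Upsilon> \<Longrightarrow> J \<subseteq> carrier A"
  using level_subgroup subgroup.subset by blast

lemma level'_subset: "V \<in> \<Upsilon>' \<Longrightarrow> V \<subseteq> B"
  using H.compact_open subgroup.subset by (fastforce simp: compact_open_subgroup_def)

lemma cring_R: "cring R"
  using G.nonempty M.val_module module.axioms(1) by blast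

lemma level_hom_one: "\<lbrakk>L \<in> \<Upsilon>; L \<subseteq> J\<rbrakk> \<Longrightarrow> \<one>\<^bsub>A\<^esub> \<in> level_hom A L J"
  using A.conjugate_one level_subset by (simp add: level_hom_def)

lemma level_hom_one': "\<lbrakk>V \<in> \<Upsilon>'; V \<subseteq> W\<rbrakk> \<Longrightarrow> \<one>\<^bsub>A\<^esub> \<in> level_hom (A\<lparr>carrier := B\<rparr>) V W"
  using group.conjugate_one[OF A.subgroup_imp_group[OF subgroup_B]] level'_subset subgroup.one_closed[OF subgroup_B]
    A.m_inv_restrict_subgroup[OF subgroup_B]
  by (auto simp: level_hom_def)

text \<open>Zeta classes live on conjugates aJa^-1, so membership in \<open>level_hom\<close> is put
  in the form in which it arises: a level contained in such a conjugate.\<close>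

lemma level_hom_conjugate:
  "\<lbrakk>L \<in> \<Upsilon>; a \<in> carrier A; L \<subseteq> conjugate A a J; J \<subseteq> carrier A\<rbrakk> \<Longrightarrow> a \<in> level_hom A L J"
  using A.conjugate_mono[of L "conjugate A a J" "inv\<^bsub>A\<^esub> a"] A.conjugate_inv_cancel[of a J]
  by (simp add: level_hom_def)

definition zeta :: "'g set \<Rightarrow> 'g \<Rightarrow> 'm" where
  "zeta J a = push M (conjugate A a J) J a (\<iota> (conjugate A a J \<inter> B) (conjugate A a J) \<one>\<^bsub>R\<^esub>)"

lemma one_in_val: "\<one>\<^bsub>R\<^esub> \<in> carrier (val (trivial_functor R (A\<lparr>carrier := B\<rparr>)) V)"
  using cring.cring_simprules(6)[OF cring_R] by (simp add: trivial_functor_def regular_module_def)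

lemma iota_one_closed:
  "\<lbrakk>V \<in> \<Upsilon>'; P \<in> \<Upsilon>; V \<subseteq> P\<rbrakk> \<Longrightarrow> \<iota> V P \<one>\<^bsub>R\<^esub> \<in> carrier (val M P)"
  using linear_maps_closed[OF linear one_in_val] by blast

lemma zeta_closed:
  assumes "J \<in> \<Upsilon>" "a \<in> carrier A"
  shows "zeta J a \<in> carrier (val M J)"
  unfolding zeta_def
  using assms G.T1 restrict_level level_subset
  by (intro linear_maps_closed[OF M.push_linear] iota_one_closed level_hom_conjugate) auto

text \<open>A trace in the trivial functor multiplies the generator by an integer, and R-linearity
  of \<iota> carries that integer to the other side. Integers enter as multiples of the unit of
  \<open>R\<close>, so that they can be combined with other coefficients by multiplication in
  \<open>R\<close>.\<close>

lemma iota_nat: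
  fixes n :: nat
  assumes "V \<in> \<Upsilon>'" "P \<in> \<Upsilon>" "V \<subseteq> P"
  shows "\<iota> V P ([n] \<cdot>\<^bsub>R\<^esub> \<one>\<^bsub>R\<^esub>) = ([n] \<cdot>\<^bsub>R\<^esub> \<one>\<^bsub>R\<^esub>) \<odot>\<^bsub>val M P\<^esub> \<iota> V P \<one>\<^bsub>R\<^esub>"
proof -
  interpret R: cring R by (rule cring_R)
  have "\<iota> V P (([n] \<cdot>\<^bsub>R\<^esub> \<one>\<^bsub>R\<^esub>) \<odot>\<^bsub>regular_module R\<^esub> \<one>\<^bsub>R\<^esub>) = ([n] \<cdot>\<^bsub>R\<^esub> \<one>\<^bsub>R\<^esub>) \<odot>\<^bsub>val M P\<^esub> \<iota> V P \<one>\<^bsub>R\<^esub>"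
    using linear_maps_smult[OF linear[OF assms], of "[n] \<cdot>\<^bsub>R\<^esub> \<one>\<^bsub>R\<^esub>" "\<one>\<^bsub>R\<^esub>"]
    by (simp add: trivial_functor_def regular_module_def del: R.r_one)
  then show ?thesis by (simp add: regular_module_def)
qed

text \<open>Compatibility of \<iota> with the morphism 1 moves the trace into the trivial functor,
  where it is multiplication by an index. The indices in the trace formula and in the Hecke
  expansion both come from here.\<close>

lemma push_iota:
  assumes "V \<in> \<Upsilon>'" "P \<in> \<Upsilon>" "V \<subseteq> P" "Q \<in> \<Upsilon>" "P \<subseteq> Q"
  shows "push M P Q \<one>\<^bsub>A\<^esub> (\<iota> V P \<one>\<^bsub>R\<^esub>) = ([index A (Q \<inter> B) V] \<cdot>\<^bsub>R\<^esub> \<one>\<^bsub>R\<^esub>) \<odot>\<^bsub>val M Q\<^esub> \<iota> (Q \<inter> B) Q \<one>\<^bsub>R\<^esub>"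
proof -
  have Q: "Q \<inter> B \<in> \<Upsilon>'" "V \<subseteq> Q \<inter> B" using restrict_level assms level'_subset by auto
  have one: "\<one>\<^bsub>A\<^esub> \<in> B" using subgroup.one_closed[OF subgroup_B] .
  have "push M P Q \<one>\<^bsub>A\<^esub> (\<iota> V P \<one>\<^bsub>R\<^esub>) =
      \<iota> (Q \<inter> B) Q (push (trivial_functor R (A\<lparr>carrier := B\<rparr>)) V (Q \<inter> B) \<one>\<^bsub>A\<^esub> \<one>\<^bsub>R\<^esub>)"
    by (rule commutes[symmetric]) (use assms Q one one_in_val level_hom_one level_hom_one' in auto)
  also have "push (trivial_functor R (A\<lparr>carrier := B\<rparr>)) V (Q \<inter> B) \<one>\<^bsub>A\<^esub> \<one>\<^bsub>R\<^esub> = [index A (Q \<inter> B) V] \<cdot>\<^bsub>R\<^esub> \<one>\<^bsub>R\<^esub>"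
    using Q(2) B_subset one
    by (auto simp: trivial_functor_def A.m_inv_restrict_subgroup[OF subgroup_B]
        A.conjugate_restrict[OF subgroup_B] A.conjugate_one index_def)
  finally show ?thesis using iota_nat[OF Q(1) assms(4)] by simp
qed

text \<open>Since k normalises J, a and ak give the same conjugate of J. The two classes then differ
  by the push along k on M(J), which is the identity for k in J.\<close>

lemma zeta_right_invariant:
  assumes "J \<in> \<Upsilon>" "a \<in> carrier A" "k \<in> J"
  shows "zeta J (a \<otimes>\<^bsub>A\<^esub> k) = zeta J a"
proof -
  have k: "k \<in> carrier A" using assms level_subset by blast
  have c: "conjugate A (a \<otimes>\<^bsub>A\<^esub> k) J = conjugate A a J"
    using A.conjugate_conjugate[OF assms(2) k level_subset[OF assms(1)]]
      A.conjugate_self[OF level_subgroup[OF assms(1)] assms(3)] by simp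
  have P: "conjugate A a J \<in> \<Upsilon>" "conjugate A a J \<inter> B \<in> \<Upsilon>'" using G.T1 restrict_level assms by auto
  have h: "k \<in> level_hom A J J" "a \<in> level_hom A (conjugate A a J) J"
    using level_hom_conjugate[OF assms(1) k] level_hom_conjugate[OF P(1) assms(2)]
      A.conjugate_self[OF level_subgroup[OF assms(1)] assms(3)] level_subset[OF assms(1)] by auto
  have "zeta J (a \<otimes>\<^bsub>A\<^esub> k) = push M J J k (zeta J a)"
    unfolding zeta_def c using P assms(1) h iota_one_closed by (intro M.push_comp) auto
  then show ?thesis using M.push_inner assms zeta_closed by simp
qed

text \<open>As b lies in \<open>B\<close>, \<iota> commutes with the push along b from bPb^-1 to P.
  On the trivial functor this push is an isomorphism of levels, of index 1, and sends the generator
  to the generator.\<close>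

lemma zeta_left_invariant:
  assumes "J \<in> \<Upsilon>" "a \<in> carrier A" "b \<in> B"
  shows "zeta J (b \<otimes>\<^bsub>A\<^esub> a) = zeta J a"
proof -
  interpret R: cring R by (rule cring_R)
  have b: "b \<in> carrier A" using assms B_subset by blast
  define P where "P = conjugate A a J"
  have c: "conjugate A (b \<otimes>\<^bsub>A\<^esub> a) J = conjugate A b P"
    using A.conjugate_conjugate b assms level_subset by (simp add: P_def)
  have P: "P \<in> \<Upsilon>" "P \<inter> B \<in> \<Upsilon>'" "conjugate A b P \<in> \<Upsilon>" "conjugate A b P \<inter> B \<in> \<Upsilon>'"
    using G.T1 restrict_level assms b by (auto simp: P_def)
  have inv_eq: "conjugate A (inv\<^bsub>A\<^esub> b) (conjugate A b P \<inter> B) = P \<inter> B"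
    using A.conjugate_Int[of "inv\<^bsub>A\<^esub> b" "conjugate A b P" B] b level_subset[OF P(1)] level_subset[OF P(3)] B_subset
      A.conjugate_inv_cancel A.conjugate_self[OF subgroup_B] subgroup.m_inv_closed[OF subgroup_B assms(3)] by simp
  have inv_eq': "conjugate (A\<lparr>carrier := B\<rparr>) (inv\<^bsub>A\<lparr>carrier := B\<rparr>\<^esub> b) (conjugate A b P \<inter> B) = P \<inter> B"
    using inv_eq A.conjugate_restrict[OF subgroup_B] A.m_inv_restrict_subgroup[OF subgroup_B assms(3)]
      subgroup.m_inv_closed[OF subgroup_B assms(3)] by simp
  have h: "b \<in> level_hom A (conjugate A b P) P" "a \<in> level_hom A P J"
    using level_hom_conjugate[OF P(3) b _ level_subset[OF P(1)]]
      level_hom_conjugate[OF P(1) assms(2) _ level_subset[OF assms(1)]] by (auto simp: P_def)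
  have h': "b \<in> level_hom (A\<lparr>carrier := B\<rparr>) (conjugate A b P \<inter> B) (P \<inter> B)"
    using inv_eq' assms(3) by (simp add: level_hom_def)
  have "index (A\<lparr>carrier := B\<rparr>) (P \<inter> B) (P \<inter> B) = 1"
    using H.compact_open[OF P(2)] A.subgroup_imp_group[OF subgroup_B]
    by (intro index_self) (auto simp: compact_open_subgroup_def)
  then have "push (trivial_functor R (A\<lparr>carrier := B\<rparr>)) (conjugate A b P \<inter> B) (P \<inter> B) b \<one>\<^bsub>R\<^esub> = \<one>\<^bsub>R\<^esub>"
    by (simp add: trivial_functor_def inv_eq')
  then have "\<iota> (P \<inter> B) P \<one>\<^bsub>R\<^esub> = push M (conjugate A b P) P b (\<iota> (conjugate A b P \<inter> B) (conjugate A b P) \<one>\<^bsub>R\<^esub>)"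
    using commutes[OF P(2) P(4) P(1) P(3) _ _ _ h' h(1) one_in_val] assms(3) by simp
  moreover have "zeta J (b \<otimes>\<^bsub>A\<^esub> a) = push M P J a (push M (conjugate A b P) P b (\<iota> (conjugate A b P \<inter> B) (conjugate A b P) \<one>\<^bsub>R\<^esub>))"
    unfolding zeta_def c using P assms(1) h iota_one_closed by (intro M.push_comp) auto
  ultimately show ?thesis by (simp add: zeta_def P_def)
qed

text \<open>The morphism a from aJ'a^-1 to J factors through J' and also through aJa^-1. The second
  factorisation puts the trace directly behind \<iota>, where \<open>push_iota\<close> evaluates
  it.\<close>

lemma push_zeta:
  assumes "J \<in> \<Upsilon>" "J' \<in> \<Upsilon>" "J' \<subseteq> J" "a \<in> carrier A"
  shows "push M J' J \<one>\<^bsub>A\<^esub> (zeta J' a) =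
    ([index A (conjugate A a J \<inter> B) (conjugate A a J' \<inter> B)] \<cdot>\<^bsub>R\<^esub> \<one>\<^bsub>R\<^esub>) \<odot>\<^bsub>val M J\<^esub> zeta J a"
proof -
  interpret R: cring R by (rule cring_R)
  define P P' where "P = conjugate A a J" and "P' = conjugate A a J'"
  have P: "P \<in> \<Upsilon>" "P' \<in> \<Upsilon>" "P' \<subseteq> P" "P' \<inter> B \<in> \<Upsilon>'" "P \<inter> B \<in> \<Upsilon>'"
    using G.T1 restrict_level A.conjugate_mono assms by (auto simp: P_def P'_def)
  have h: "a \<in> level_hom A P J" "a \<in> level_hom A P' J'"
    using level_hom_conjugate[OF P(1) assms(4) _ level_subset[OF assms(1)]]
      level_hom_conjugate[OF P(2) assms(4) _ level_subset[OF assms(2)]] by (auto simp: P_def P'_def)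
  let ?x = "\<iota> (P' \<inter> B) P' \<one>\<^bsub>R\<^esub>"
  have x: "?x \<in> carrier (val M P')" using iota_one_closed P by simp
  have "push M J' J \<one>\<^bsub>A\<^esub> (zeta J' a) = push M P' J (a \<otimes>\<^bsub>A\<^esub> \<one>\<^bsub>A\<^esub>) ?x"
    unfolding zeta_def P'_def[symmetric]
    using P assms h x level_hom_one by (intro M.push_comp[symmetric]) auto
  also have "\<dots> = push M P' J (\<one>\<^bsub>A\<^esub> \<otimes>\<^bsub>A\<^esub> a) ?x" using assms by simp
  also have "\<dots> = push M P J a (push M P' P \<one>\<^bsub>A\<^esub> ?x)"
    using P assms h x level_hom_one by (intro M.push_comp) auto
  also have "\<dots> = push M P J a (([index A (P \<inter> B) (P' \<inter> B)] \<cdot>\<^bsub>R\<^esub> \<one>\<^bsub>R\<^esub>) \<odot>\<^bsub>val M P\<^esub> \<iota> (P \<inter> B) P \<one>\<^bsub>R\<^esub>)"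
    using push_iota P by simp
  also have "\<dots> = ([index A (P \<inter> B) (P' \<inter> B)] \<cdot>\<^bsub>R\<^esub> \<one>\<^bsub>R\<^esub>) \<odot>\<^bsub>val M J\<^esub> zeta J a"
    unfolding zeta_def P_def[symmetric]
    using P assms h iota_one_closed by (intro linear_maps_smult[OF M.push_linear]) auto
  finally show ?thesis by (simp add: P_def P'_def)
qed

section \<open>Hecke correspondences on zeta classes\<close>

lemma pull_push_conjugate:
  assumes "J \<in> \<Upsilon>" "J' \<in> \<Upsilon>" "J' \<subseteq> J" "a \<in> carrier A" "x \<in> carrier (val M (conjugate A a J))"
  shows "pull M J' J \<one>\<^bsub>A\<^esub> (push M (conjugate A a J) J a x) =
    push M (conjugate A a J') J' a (pull M (conjugate A a J') (conjugate A a J) \<one>\<^bsub>A\<^esub> x)"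
proof -
  define P P' where "P = conjugate A a J" and "P' = conjugate A a J'"
  have P: "P \<in> \<Upsilon>" "P' \<in> \<Upsilon>" "P' \<subseteq> P"
    using G.T1 A.conjugate_mono assms by (auto simp: P_def P'_def)
  have h: "inv\<^bsub>A\<^esub> a \<in> level_hom A J P" "inv\<^bsub>A\<^esub> a \<in> level_hom A J' P'" "a \<in> level_hom A P J"
    using assms P A.conjugate_inv_cancel level_subset by (auto simp: level_hom_def P_def P'_def)
  have x: "x \<in> carrier (val M P)" using assms by (simp add: P_def)
  \<comment> \<open>Along an isomorphism of levels a push is the pull along the inverse. This turns
    the exchange of restriction and conjugation into contravariant functoriality alone.\<close>
  have push_eq: "push M P J a x = pull M J P (inv\<^bsub>A\<^esub> a) x"
    using M.pull_eq_push[of J P "inv\<^bsub>A\<^esub> a" x] assms P x by (simp add: P_def)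
  have y: "pull M P' P \<one>\<^bsub>A\<^esub> x \<in> carrier (val M P')"
    using linear_maps_closed[OF M.pull_linear x] P level_hom_one by simp
  have "pull M J' J \<one>\<^bsub>A\<^esub> (pull M J P (inv\<^bsub>A\<^esub> a) x) = pull M J' P (\<one>\<^bsub>A\<^esub> \<otimes>\<^bsub>A\<^esub> inv\<^bsub>A\<^esub> a) x"
    using P assms h x level_hom_one by (intro M.pull_comp[symmetric]) auto
  also have "\<dots> = pull M J' P (inv\<^bsub>A\<^esub> a \<otimes>\<^bsub>A\<^esub> \<one>\<^bsub>A\<^esub>) x" using assms by simp
  also have "\<dots> = pull M J' P' (inv\<^bsub>A\<^esub> a) (pull M P' P \<one>\<^bsub>A\<^esub> x)"
    using P assms h x level_hom_one by (intro M.pull_comp) auto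
  also have "\<dots> = push M P' J' a (pull M P' P \<one>\<^bsub>A\<^esub> x)"
    using M.pull_eq_push[of J' P' "inv\<^bsub>A\<^esub> a" "pull M P' P \<one>\<^bsub>A\<^esub> x"] assms P y by (simp add: P'_def)
  finally show ?thesis using push_eq by (simp add: P_def P'_def)
qed

text \<open>The middle map of the correspondence is a pull along the inverse of \<sigma> between
  conjugate levels, hence a push along \<sigma>, and it merges with the trace that follows. What
  remains is one restriction followed by one push.\<close>

lemma hecke_push_eq:
  assumes "J \<in> \<Upsilon>" "\<sigma> \<in> carrier A" "x \<in> carrier (val M J)"
  shows "hecke_push M A J \<sigma> J x =
    push M (J \<inter> conjugate A \<sigma> J) J \<sigma> (pull M (J \<inter> conjugate A \<sigma> J) J \<one>\<^bsub>A\<^esub> x)"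
proof -
  define Q Q' where "Q = J \<inter> conjugate A \<sigma> J" and "Q' = J \<inter> conjugate A (inv\<^bsub>A\<^esub> \<sigma>) J"
  have Q: "Q \<in> \<Upsilon>" "Q' \<in> \<Upsilon>" "Q \<subseteq> J" "Q' \<subseteq> J" using G.T1 G.T3 assms by (auto simp: Q_def Q'_def)
  note J = level_subset[OF assms(1)]
  have c: "conjugate A (inv\<^bsub>A\<^esub> \<sigma>) Q = Q'"
    using A.conjugate_Int[of "inv\<^bsub>A\<^esub> \<sigma>" J "conjugate A \<sigma> J"] A.conjugate_inv_cancel A.conjugate_closed assms J
    by (auto simp: Q_def Q'_def)
  have c': "conjugate A \<sigma> Q' = Q" unfolding c[symmetric]
    using A.conjugate_cancel_inv level_subset[OF Q(1)] assms by simp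
  define y where "y = pull M Q J \<one>\<^bsub>A\<^esub> x"
  have y: "y \<in> carrier (val M Q)"
    unfolding y_def using linear_maps_closed[OF M.pull_linear assms(3)] Q assms level_hom_one by simp
  have "hecke_push M A J \<sigma> J x = push M Q' J \<one>\<^bsub>A\<^esub> (pull M Q' Q (inv\<^bsub>A\<^esub> \<sigma>) y)"
    using assms by (simp add: hecke_push_def hecke_def Q_def Q'_def y_def)
  also have "pull M Q' Q (inv\<^bsub>A\<^esub> \<sigma>) y = push M Q Q' \<sigma> y"
    using M.pull_eq_push[of Q' Q "inv\<^bsub>A\<^esub> \<sigma>" y] Q c' y assms by simp
  also have "push M Q' J \<one>\<^bsub>A\<^esub> (push M Q Q' \<sigma> y) = push M Q J (\<sigma> \<otimes>\<^bsub>A\<^esub> \<one>\<^bsub>A\<^esub>) y"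
    using Q assms y c level_hom_one by (intro M.push_comp[symmetric]) (auto simp: level_hom_def)
  finally show ?thesis using assms by (simp add: Q_def y_def)
qed

text \<open>Restriction to J \<inter> \<sigma>J\<sigma>^-1 passes through the push along a, and the
  Mackey axiom of \<iota> expands it at the conjugate level P = aJa^-1. The term at \<gamma> is then
  carried along \<gamma>a\<sigma>. Factoring this morphism through the conjugate of J by
  \<gamma>a\<sigma> isolates a trace, which contributes the index, and leaves a zeta class.\<close>

lemma hecke_push_zeta:
  assumes "J \<in> \<Upsilon>" "\<sigma> \<in> carrier A" "a \<in> carrier A"
    and \<Gamma>: "double_coset_reps A (conjugate A a J \<inter> B) (conjugate A a J) (conjugate A a (J \<inter> conjugate A \<sigma> J)) \<Gamma>"
  shows "hecke_push M A J \<sigma> J (zeta J a) =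
    (\<Oplus>\<^bsub>val M J\<^esub>\<gamma>\<in>\<Gamma>. ([index A (conjugate A (\<gamma> \<otimes>\<^bsub>A\<^esub> a \<otimes>\<^bsub>A\<^esub> \<sigma>) J \<inter> B)
        (conjugate A (\<gamma> \<otimes>\<^bsub>A\<^esub> a \<otimes>\<^bsub>A\<^esub> \<sigma>) J \<inter> conjugate A a J \<inter> B)] \<cdot>\<^bsub>R\<^esub> \<one>\<^bsub>R\<^esub>)
      \<odot>\<^bsub>val M J\<^esub> zeta J (\<gamma> \<otimes>\<^bsub>A\<^esub> a \<otimes>\<^bsub>A\<^esub> \<sigma>))"
proof -
  interpret R: cring R by (rule cring_R)
  define Q P P' where "Q = J \<inter> conjugate A \<sigma> J" and "P = conjugate A a J" and "P' = conjugate A a Q"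
  have Q: "Q \<in> \<Upsilon>" "Q \<subseteq> J" "Q \<subseteq> conjugate A \<sigma> J" using G.T1 G.T3 assms by (auto simp: Q_def)
  have P: "P \<in> \<Upsilon>" "P' \<in> \<Upsilon>" "P' \<subseteq> P" "P \<inter> B \<in> \<Upsilon>'"
    using G.T1 A.conjugate_mono Q assms restrict_level by (auto simp: P_def P'_def)
  note J = level_subset[OF assms(1)]
  have P'_eq: "P' = P \<inter> conjugate A (a \<otimes>\<^bsub>A\<^esub> \<sigma>) J"
    unfolding P'_def Q_def P_def
    using A.conjugate_Int A.conjugate_conjugate A.conjugate_closed assms J by simp
  have h: "a \<in> level_hom A P' Q" "\<sigma> \<in> level_hom A Q J"
    using level_hom_conjugate[OF P(2) assms(3) _ level_subset[OF Q(1)]]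
      level_hom_conjugate[OF Q(1) assms(2) Q(3) J] by (auto simp: P'_def)
  have h_comp: "a \<otimes>\<^bsub>A\<^esub> \<sigma> \<in> level_hom A P' J"
    using level_hom_conjugate[OF P(2) _ _ J] assms by (simp add: P'_eq)
  define x where "x = \<iota> (P \<inter> B) P \<one>\<^bsub>R\<^esub>"
  have x: "x \<in> carrier (val M P)" unfolding x_def using iota_one_closed P by simp
  define y where "y = pull M P' P \<one>\<^bsub>A\<^esub> x"
  have y: "y \<in> carrier (val M P')"
    unfolding y_def using linear_maps_closed[OF M.pull_linear x] P level_hom_one by simp
  define u where "u \<gamma> = conjugate A \<gamma> P'" for \<gamma>
  define z where "z \<gamma> = \<iota> ((P \<inter> B) \<inter> u \<gamma>) (u \<gamma>) \<one>\<^bsub>R\<^esub>" for \<gamma>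
  have \<Gamma>_P: "\<Gamma> \<subseteq> P" using \<Gamma> by (simp add: double_coset_reps_def P_def)
  then have \<Gamma>_A: "\<gamma> \<in> carrier A" if "\<gamma> \<in> \<Gamma>" for \<gamma> using level_subset[OF P(1)] that by blast
  have u: "u \<gamma> \<in> \<Upsilon>" "(P \<inter> B) \<inter> u \<gamma> \<in> \<Upsilon>'" "\<gamma> \<in> level_hom A (u \<gamma>) P'" if "\<gamma> \<in> \<Gamma>" for \<gamma>
  proof -
    show 1: "u \<gamma> \<in> \<Upsilon>" using G.T1[OF P(2) \<Gamma>_A[OF that]] by (simp add: u_def)
    \<comment> \<open>Membership in \<open>\<Upsilon>'\<close> comes from writing the set as the
      intersection of a level of \<open>A\<close> with \<open>B\<close>.\<close>
    have "(P \<inter> B) \<inter> u \<gamma> = (P \<inter> u \<gamma>) \<inter> B" by blast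
    then show "(P \<inter> B) \<inter> u \<gamma> \<in> \<Upsilon>'" using restrict_level[OF G.T3[OF P(1) 1]] by simp
    show "\<gamma> \<in> level_hom A (u \<gamma>) P'"
      using level_hom_conjugate[OF 1 \<Gamma>_A[OF that] _ level_subset[OF P(2)]] by (simp add: u_def)
  qed
  have z: "z \<gamma> \<in> carrier (val M (u \<gamma>))" if "\<gamma> \<in> \<Gamma>" for \<gamma>
    unfolding z_def using iota_one_closed[OF u(2)[OF that] u(1)[OF that]] by simp
  have "y = (\<Oplus>\<^bsub>val M P'\<^esub>\<gamma>\<in>\<Gamma>. push M (u \<gamma>) P' \<gamma> (z \<gamma>))"
    unfolding y_def x_def z_def u_def
    by (subst mackey[OF P(4) P(2) P(1) _ P(3) _ one_in_val, of \<Gamma>])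
      (use \<Gamma> in \<open>simp_all add: trivial_functor_def P_def P'_def Q_def\<close>)
  moreover have "hecke_push M A J \<sigma> J (zeta J a) = push M P' J (a \<otimes>\<^bsub>A\<^esub> \<sigma>) y"
  proof -
    have "hecke_push M A J \<sigma> J (zeta J a) = push M Q J \<sigma> (pull M Q J \<one>\<^bsub>A\<^esub> (push M P J a x))"
      using hecke_push_eq[OF assms(1,2) zeta_closed[OF assms(1,3)]] by (simp add: zeta_def Q_def P_def x_def)
    also have "pull M Q J \<one>\<^bsub>A\<^esub> (push M P J a x) = push M P' Q a y"
      unfolding y_def P_def P'_def using pull_push_conjugate[OF assms(1) Q(1,2) assms(3)] x by (simp add: P_def)
    also have "push M Q J \<sigma> (push M P' Q a y) = push M P' J (a \<otimes>\<^bsub>A\<^esub> \<sigma>) y"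
      using P Q h y assms by (intro M.push_comp[symmetric]) auto
    finally show ?thesis .
  qed
  ultimately have "hecke_push M A J \<sigma> J (zeta J a) =
      (\<Oplus>\<^bsub>val M J\<^esub>\<gamma>\<in>\<Gamma>. push M P' J (a \<otimes>\<^bsub>A\<^esub> \<sigma>) (push M (u \<gamma>) P' \<gamma> (z \<gamma>)))"
    using linear_maps_finsum[OF M.val_module[OF P(2)] M.val_module[OF assms(1)] M.push_linear[OF P(2) assms(1) h_comp],
        of "\<lambda>\<gamma>. push M (u \<gamma>) P' \<gamma> (z \<gamma>)" \<Gamma>] u z linear_maps_closed[OF M.push_linear] P(2) by (simp add: Pi_def)
  also have "\<dots> = (\<Oplus>\<^bsub>val M J\<^esub>\<gamma>\<in>\<Gamma>. ([index A (conjugate A (\<gamma> \<otimes>\<^bsub>A\<^esub> a \<otimes>\<^bsub>A\<^esub> \<sigma>) J \<inter> B)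
        (conjugate A (\<gamma> \<otimes>\<^bsub>A\<^esub> a \<otimes>\<^bsub>A\<^esub> \<sigma>) J \<inter> P \<inter> B)] \<cdot>\<^bsub>R\<^esub> \<one>\<^bsub>R\<^esub>)
      \<odot>\<^bsub>val M J\<^esub> zeta J (\<gamma> \<otimes>\<^bsub>A\<^esub> a \<otimes>\<^bsub>A\<^esub> \<sigma>))"
  proof (rule abelian_monoid.finsum_eq[OF abelian_group.axioms(1)[OF module.axioms(2)[OF M.val_module[OF assms(1)]]] refl])
    interpret module R "val M J" by (rule M.val_module[OF assms(1)])
    show "(\<lambda>\<gamma>. ([index A (conjugate A (\<gamma> \<otimes>\<^bsub>A\<^esub> a \<otimes>\<^bsub>A\<^esub> \<sigma>) J \<inter> B)
        (conjugate A (\<gamma> \<otimes>\<^bsub>A\<^esub> a \<otimes>\<^bsub>A\<^esub> \<sigma>) J \<inter> P \<inter> B)] \<cdot>\<^bsub>R\<^esub> \<one>\<^bsub>R\<^esub>)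
        \<odot>\<^bsub>val M J\<^esub> zeta J (\<gamma> \<otimes>\<^bsub>A\<^esub> a \<otimes>\<^bsub>A\<^esub> \<sigma>)) \<in> \<Gamma> \<rightarrow> carrier (val M J)"
      using assms \<Gamma>_A by (auto intro!: smult_closed zeta_closed)
    fix \<gamma> assume \<gamma>: "\<gamma> \<in> \<Gamma>"
    define c where "c = \<gamma> \<otimes>\<^bsub>A\<^esub> a \<otimes>\<^bsub>A\<^esub> \<sigma>"
    define C where "C = conjugate A c J"
    have c: "c \<in> carrier A" using \<Gamma>_A[OF \<gamma>] assms by (simp add: c_def)
    have C: "C \<in> \<Upsilon>" "C \<inter> B \<in> \<Upsilon>'" using G.T1[OF assms(1) c] restrict_level by (auto simp: C_def)
    have "\<gamma> \<in> P" using \<gamma> \<Gamma>_P by blast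
    then have "conjugate A \<gamma> P = P" using A.conjugate_self[OF level_subgroup[OF P(1)]] by simp
    \<comment> \<open>Here P is unchanged under conjugation by \<gamma>, because \<gamma> lies in P;
      only the second factor of \<open>P'\<close> moves, to \<open>C\<close>.\<close>
    then have u_eq: "u \<gamma> = P \<inter> C"
      unfolding u_def P'_eq C_def c_def
      using A.conjugate_Int[OF \<Gamma>_A[OF \<gamma>] level_subset[OF P(1)]] A.conjugate_conjugate A.conjugate_closed
        \<Gamma>_A[OF \<gamma>] assms J by (simp add: A.m_assoc)
    have hc: "c \<in> level_hom A C J" using level_hom_conjugate[OF C(1) c _ J] by (simp add: C_def)
    have "push M P' J (a \<otimes>\<^bsub>A\<^esub> \<sigma>) (push M (u \<gamma>) P' \<gamma> (z \<gamma>)) = push M (u \<gamma>) J (\<gamma> \<otimes>\<^bsub>A\<^esub> (a \<otimes>\<^bsub>A\<^esub> \<sigma>)) (z \<gamma>)"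
      using P u[OF \<gamma>] h_comp z[OF \<gamma>] assms by (intro M.push_comp[symmetric]) auto
    \<comment> \<open>The morphism c from \<open>u \<gamma>\<close> to J is the inclusion into
      \<open>C\<close> followed by c. The inclusion acts first, directly on the image of
      \<iota>.\<close>
    also have "\<dots> = push M (u \<gamma>) J (\<one>\<^bsub>A\<^esub> \<otimes>\<^bsub>A\<^esub> c) (z \<gamma>)"
      using \<Gamma>_A[OF \<gamma>] assms by (simp add: c_def A.m_assoc)
    also have "\<dots> = push M C J c (push M (u \<gamma>) C \<one>\<^bsub>A\<^esub> (z \<gamma>))"
      using C u[OF \<gamma>] hc z[OF \<gamma>] assms level_hom_one u_eq by (intro M.push_comp) auto
    also have "push M (u \<gamma>) C \<one>\<^bsub>A\<^esub> (z \<gamma>) =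
        ([index A (C \<inter> B) ((P \<inter> B) \<inter> u \<gamma>)] \<cdot>\<^bsub>R\<^esub> \<one>\<^bsub>R\<^esub>) \<odot>\<^bsub>val M C\<^esub> \<iota> (C \<inter> B) C \<one>\<^bsub>R\<^esub>"
      unfolding z_def using push_iota[OF u(2)[OF \<gamma>] u(1)[OF \<gamma>] Int_lower2 C(1)] u_eq by blast
    also have "push M C J c \<dots> = ([index A (C \<inter> B) ((P \<inter> B) \<inter> u \<gamma>)] \<cdot>\<^bsub>R\<^esub> \<one>\<^bsub>R\<^esub>) \<odot>\<^bsub>val M J\<^esub> zeta J c"
      unfolding zeta_def C_def[symmetric]
      using C assms hc iota_one_closed by (intro linear_maps_smult[OF M.push_linear]) auto
    also have "(P \<inter> B) \<inter> u \<gamma> = C \<inter> P \<inter> B" using u_eq by blast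
    finally show "push M P' J (a \<otimes>\<^bsub>A\<^esub> \<sigma>) (push M (u \<gamma>) P' \<gamma> (z \<gamma>)) =
        ([index A (conjugate A (\<gamma> \<otimes>\<^bsub>A\<^esub> a \<otimes>\<^bsub>A\<^esub> \<sigma>) J \<inter> B)
          (conjugate A (\<gamma> \<otimes>\<^bsub>A\<^esub> a \<otimes>\<^bsub>A\<^esub> \<sigma>) J \<inter> P \<inter> B)] \<cdot>\<^bsub>R\<^esub> \<one>\<^bsub>R\<^esub>)
        \<odot>\<^bsub>val M J\<^esub> zeta J (\<gamma> \<otimes>\<^bsub>A\<^esub> a \<otimes>\<^bsub>A\<^esub> \<sigma>)" by (simp add: C_def c_def)
  qed
  finally show ?thesis by (simp add: P_def)
qed

end

section \<open>Hecke degrees as sums over double cosets\<close>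

context group
begin

lemma rcoset_eq_iff:
  assumes "subgroup A G" "a \<in> carrier G" "b \<in> carrier G"
  shows "A #> a = A #> b \<longleftrightarrow> a \<otimes> inv b \<in> A"
proof
  assume "A #> a = A #> b"
  then have "a \<in> A #> b" using rcos_self[OF assms(2,1)] by simp
  then obtain x where "x \<in> A" "a = x \<otimes> b" by (auto simp: r_coset_def)
  then show "a \<otimes> inv b \<in> A"
    using subgroup.subset[OF assms(1)] assms by (simp add: m_assoc subset_iff)
next
  assume x: "a \<otimes> inv b \<in> A"
  have "a = (a \<otimes> inv b) \<otimes> b" using assms by (simp add: m_assoc)
  then have "a \<in> A #> b" unfolding r_coset_def using x by blast
  from repr_independence[OF this assms(3) assms(1)] show "A #> a = A #> b" by simp
qed

lemma double_coset_subset: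
  "\<lbrakk>A \<subseteq> carrier G; x \<in> carrier G; B \<subseteq> carrier G\<rbrakk> \<Longrightarrow> double_coset G A x B \<subseteq> carrier G"
  by (auto simp: mem_double_coset subset_iff)

lemma self_in_double_coset:
  assumes "subgroup A G" "subgroup B G" "x \<in> carrier G"
  shows "x \<in> double_coset G A x B"
proof -
  have "x = \<one> \<otimes> x \<otimes> \<one>" using assms by simp
  then show ?thesis unfolding mem_double_coset using assms subgroup.one_closed by blast
qed

lemma double_coset_translate:
  assumes "subgroup A G" "subgroup B G" "x \<in> carrier G" "a \<in> A" "b \<in> B"
  shows "double_coset G A (a \<otimes> x \<otimes> b) B = double_coset G A x B"
proof (intro equalityI subsetI)
  note s = subgroup.mem_carrier[OF assms(1)] subgroup.mem_carrier[OF assms(2)]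
  fix y assume "y \<in> double_coset G A (a \<otimes> x \<otimes> b) B"
  then obtain a' b' where y: "a' \<in> A" "b' \<in> B" "y = a' \<otimes> (a \<otimes> x \<otimes> b) \<otimes> b'" by (auto simp: mem_double_coset)
  then have "y = (a' \<otimes> a) \<otimes> x \<otimes> (b \<otimes> b')" using assms s by (simp add: m_assoc)
  then show "y \<in> double_coset G A x B" unfolding mem_double_coset
    using y subgroup.m_closed[OF assms(1)] subgroup.m_closed[OF assms(2)] assms(4,5) by blast
next
  note s = subgroup.mem_carrier[OF assms(1)] subgroup.mem_carrier[OF assms(2)]
  fix y assume "y \<in> double_coset G A x B"
  then obtain a' b' where y: "a' \<in> A" "b' \<in> B" "y = a' \<otimes> x \<otimes> b'" by (auto simp: mem_double_coset)
  then have "y = (a' \<otimes> inv a) \<otimes> (a \<otimes> x \<otimes> b) \<otimes> (inv b \<otimes> b')"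
    using assms s by (simp add: m_assoc inv_mult_cancel)
  moreover have "a' \<otimes> inv a \<in> A" "inv b \<otimes> b' \<in> B"
    using y assms by (auto intro: subgroup.m_closed subgroup.m_inv_closed)
  ultimately show "y \<in> double_coset G A (a \<otimes> x \<otimes> b) B" unfolding mem_double_coset by blast
qed

lemma double_coset_eq:
  assumes "subgroup A G" "subgroup B G" "x \<in> carrier G" "y \<in> double_coset G A x B"
  shows "double_coset G A y B = double_coset G A x B"
  using assms double_coset_translate by (auto simp: mem_double_coset)

lemma card_cosets_in_double_coset:
  assumes H: "subgroup H G" and K: "subgroup K G"
    and g: "g \<in> carrier G" and h: "h \<in> H" and k: "k \<in> K" and x: "x = h \<otimes> g \<otimes> k"
  shows "card ((\<lambda>y. (H \<inter> K) #> y) ` {y \<in> H. y \<otimes> g \<in> double_coset G (H \<inter> K) x K}) =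
    index G (conjugate G x K \<inter> H) (conjugate G x K \<inter> K \<inter> H)"
proof -
  define U Q where "U = H \<inter> K" and "Q = conjugate G x K \<inter> H"
  have s: "\<And>y. y \<in> H \<Longrightarrow> y \<in> carrier G" "\<And>y. y \<in> K \<Longrightarrow> y \<in> carrier G"
    using subgroup.mem_carrier[OF H] subgroup.mem_carrier[OF K] by auto
  have xG: "x \<in> carrier G" using x g h k s by simp
  have U: "subgroup U G" unfolding U_def using subgroups_Inter_pair[OF H K] .
  have QU: "subgroup (conjugate G x K \<inter> K \<inter> H) G"
    using subgroups_Inter_pair[OF subgroups_Inter_pair[OF subgroup_conjugate[OF xG K] K] H] .
  have QG: "\<And>q. q \<in> Q \<Longrightarrow> q \<in> carrier G" by (simp add: Q_def s)
  have x_inv: "inv x \<otimes> (h \<otimes> g) = inv k" "g \<otimes> k = inv h \<otimes> x"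
    using g h k s by (simp_all add: x inv_mult_group m_assoc inv_mult_cancel)
  have "(\<lambda>y. U #> y) ` {y \<in> H. y \<otimes> g \<in> double_coset G U x K} = (\<lambda>q. U #> (q \<otimes> h)) ` Q"
  proof (intro equalityI subsetI)
    fix C assume "C \<in> (\<lambda>y. U #> y) ` {y \<in> H. y \<otimes> g \<in> double_coset G U x K}"
    then obtain y u \<kappa> where y: "y \<in> H" "C = U #> y" "u \<in> U" "\<kappa> \<in> K" "y \<otimes> g = u \<otimes> x \<otimes> \<kappa>"
      by (auto simp: mem_double_coset)
    have uG: "u \<in> carrier G" "u \<in> H" using y s by (auto simp: U_def)
    define q where "q = inv u \<otimes> y \<otimes> inv h"
    have qH: "q \<in> H" unfolding q_def
      using uG y h by (intro subgroup.m_closed[OF H] subgroup.m_inv_closed[OF H])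
    have "q \<otimes> x = inv u \<otimes> (y \<otimes> g) \<otimes> k"
      using y(1) s uG g h k by (simp add: q_def x m_assoc inv_mult_cancel)
    also have "\<dots> = x \<otimes> (\<kappa> \<otimes> k)"
      unfolding y(5) using y(4) s uG xG k by (simp add: m_assoc inv_mult_cancel)
    finally have "inv x \<otimes> q \<otimes> x = \<kappa> \<otimes> k"
      using qH s xG y k by (simp add: m_assoc inv_mult_cancel)
    then have "q \<in> Q" unfolding Q_def
      using mem_conjugate_iff[OF xG subgroup.subset[OF K]] qH s subgroup.m_closed[OF K \<open>\<kappa> \<in> K\<close> k] by simp
    moreover have "U #> y = U #> (q \<otimes> h)"
      unfolding rcoset_eq_iff[OF U s(1)[OF y(1)] m_closed[OF s(1)[OF qH] s(1)[OF h]]]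
      using y uG s h by (simp add: q_def m_assoc inv_mult_group inv_mult_cancel)
    ultimately show "C \<in> (\<lambda>q. U #> (q \<otimes> h)) ` Q" using y by blast
  next
    fix C assume "C \<in> (\<lambda>q. U #> (q \<otimes> h)) ` Q"
    then obtain q where q: "q \<in> Q" "C = U #> (q \<otimes> h)" by auto
    have qK: "inv x \<otimes> q \<otimes> x \<in> K" and qH: "q \<in> H"
      using mem_conjugate_iff[OF xG subgroup.subset[OF K]] q by (auto simp: Q_def s)
    have "(q \<otimes> h) \<otimes> g = \<one> \<otimes> x \<otimes> ((inv x \<otimes> q \<otimes> x) \<otimes> inv k)"
      using xG QG[OF q(1)] g h k s by (simp add: m_assoc inv_mult_cancel x_inv(1)[symmetric])
    moreover have "(inv x \<otimes> q \<otimes> x) \<otimes> inv k \<in> K"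
      using subgroup.m_closed[OF K qK subgroup.m_inv_closed[OF K k]] .
    ultimately have "(q \<otimes> h) \<otimes> g \<in> double_coset G U x K"
      unfolding mem_double_coset using subgroup.one_closed[OF U] by blast
    then show "C \<in> (\<lambda>y. U #> y) ` {y \<in> H. y \<otimes> g \<in> double_coset G U x K}"
      using q subgroup.m_closed[OF H qH h] by blast
  qed
  moreover have "card ((\<lambda>q. U #> (q \<otimes> h)) ` Q) = card ((\<lambda>q. (conjugate G x K \<inter> K \<inter> H) #> q) ` Q)"
  proof (rule card_image_eq_card_image)
    fix a b assume ab: "a \<in> Q" "b \<in> Q"
    have "subgroup Q G" unfolding Q_def using subgroups_Inter_pair[OF subgroup_conjugate[OF xG K] H] .
    then have "a \<otimes> inv b \<in> Q"
      using ab subgroup.m_closed subgroup.m_inv_closed by metis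
    then show "U #> (a \<otimes> h) = U #> (b \<otimes> h) \<longleftrightarrow>
        (conjugate G x K \<inter> K \<inter> H) #> a = (conjugate G x K \<inter> K \<inter> H) #> b"
      using ab[THEN QG] h s rcoset_eq_iff[OF U] rcoset_eq_iff[OF QU]
      by (auto simp: m_assoc inv_mult_group inv_mult_cancel U_def Q_def)
  qed
  ultimately show ?thesis by (simp add: index_altdef U_def Q_def)
qed

section \<open>Hecke functions, and the comparison of Mackey sums with degrees\<close>

lemma hecke_function_closed:
  assumes "cring R" "c \<in> S \<rightarrow> carrier R"
  shows "hecke_function R G K S c x \<in> carrier R"
proof -
  interpret R: cring R by fact
  show ?thesis unfolding hecke_function_def using assms by (intro R.finsum_closed) (auto simp: Pi_def)
qed

lemma hecke_function_translate:
  assumes "cring R" "c \<in> S \<rightarrow> carrier R"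
    and "subgroup K G" "S \<subseteq> carrier G" "x \<in> carrier G" "a \<in> K" "b \<in> K"
  shows "hecke_function R G K S c (a \<otimes> x \<otimes> b) = hecke_function R G K S c x"
proof -
  interpret R: cring R by fact
  have ab: "a \<in> carrier G" "b \<in> carrier G" using subgroup.mem_carrier[OF assms(3)] assms by auto
  have "a \<otimes> x \<otimes> b \<in> double_coset G K \<sigma> K \<longleftrightarrow> x \<in> double_coset G K \<sigma> K" if "\<sigma> \<in> carrier G" for \<sigma>
    using double_coset_eq[OF assms(3,3) that] double_coset_translate[OF assms(3,3,5,6,7)]
      self_in_double_coset[OF assms(3,3)] assms(5) ab by (metis m_closed)
  with assms(4) show ?thesis
    unfolding hecke_function_def using assms(2) by (intro R.finsum_eq) (auto simp: Pi_def)
qed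


text \<open>Both sides are sums over the double cosets D in U\<setminus>G/K, with U = H \<inter> K.
  On the left, \<gamma> in \<open>\<Gamma> \<sigma>\<close> corresponds to D = U\<gamma>\<sigma>K
  inside K\<sigma>K, and summing over \<sigma> replaces the coefficients by the value of the Hecke
  function on D. On the right, D lies in a class H g_i K, where \<Xi> takes the value \<Xi>(g_i) and
  the index attached to D counts the cosets that enter the degree. The module \<open>E\<close> and
  the map \<Xi> are kept abstract so that only invariance of \<Xi> matters; it will be a zeta class
  translated at one place.\<close>

lemma sum_hecke_double_cosets:
  assumes H: "subgroup H G" and K: "subgroup K G"
    and S: "finite S" "S \<subseteq> carrier G" "c \<in> S \<rightarrow> carrier R"
    and E: "module R E" and \<Xi>: "\<And>x. x \<in> carrier G \<Longrightarrow> \<Xi> x \<in> carrier E"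
    and \<Xi>_left: "\<And>h x. \<lbrakk>h \<in> H; x \<in> carrier G\<rbrakk> \<Longrightarrow> \<Xi> (h \<otimes> x) = \<Xi> x"
    and \<Xi>_right: "\<And>x k. \<lbrakk>x \<in> carrier G; k \<in> K\<rbrakk> \<Longrightarrow> \<Xi> (x \<otimes> k) = \<Xi> x"
    and \<Gamma>: "\<And>\<sigma>. \<sigma> \<in> S \<Longrightarrow> finite (\<Gamma> \<sigma>)"
      "\<And>\<sigma>. \<sigma> \<in> S \<Longrightarrow> double_coset_reps G (H \<inter> K) K (K \<inter> conjugate G \<sigma> K) (\<Gamma> \<sigma>)"
    and g: "finite X" "inj_on g X"
      "double_coset_reps G H (H <#> hecke_support R G K S c) K (g ` X)"
  shows "(\<Oplus>\<^bsub>E\<^esub>\<sigma>\<in>S. c \<sigma> \<odot>\<^bsub>E\<^esub> (\<Oplus>\<^bsub>E\<^esub>\<gamma>\<in>\<Gamma> \<sigma>.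
        ([index G (conjugate G (\<gamma> \<otimes> \<sigma>) K \<inter> H) (conjugate G (\<gamma> \<otimes> \<sigma>) K \<inter> K \<inter> H)] \<cdot>\<^bsub>R\<^esub> \<one>\<^bsub>R\<^esub>)
          \<odot>\<^bsub>E\<^esub> \<Xi> (\<gamma> \<otimes> \<sigma>))) =
    (\<Oplus>\<^bsub>E\<^esub>i\<in>X. hecke_degree R (G\<lparr>carrier := H\<rparr>) (H \<inter> K) (H \<inter> conjugate G (g i) K)
        (\<lambda>h. hecke_function R G K S c (h \<otimes> g i)) \<odot>\<^bsub>E\<^esub> \<Xi> (g i))"
proof -
  interpret E: module R E by fact
  note HG = subgroup.mem_carrier[OF H] and KG = subgroup.mem_carrier[OF K]
  define U where "U = H \<inter> K"
  have U: "subgroup U G" unfolding U_def using subgroups_Inter_pair[OF H K] .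
  define dc where "dc x = double_coset G U x K" for x
  define n where "n x = index G (conjugate G x K \<inter> H) (conjugate G x K \<inter> K \<inter> H)" for x
  define \<phi> where "\<phi> x = ([n x] \<cdot>\<^bsub>R\<^esub> \<one>\<^bsub>R\<^esub>) \<odot>\<^bsub>E\<^esub> \<Xi> x" for x
  define F where "F = hecke_function R G K S c"
  \<comment> \<open>An arbitrary representative of D is enough, because the functions evaluated at
    it are constant on the double cosets of U and K.\<close>
  define t where "t D = (SOME x. x \<in> D)" for D :: "'a set"
  define \<D> where "\<D> \<sigma> = dc ` double_coset G K \<sigma> K" for \<sigma>
  have S_G: "\<And>\<sigma>. \<sigma> \<in> S \<Longrightarrow> \<sigma> \<in> carrier G" using S(2) by blast
  have c_R: "\<And>\<sigma>. \<sigma> \<in> S \<Longrightarrow> c \<sigma> \<in> carrier R" using S(3) by blast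
  have nR [simp]: "[n x] \<cdot>\<^bsub>R\<^esub> \<one>\<^bsub>R\<^esub> \<in> carrier R" for x
    by (rule E.R.add.nat_pow_closed) simp
  have F_closed [simp]: "F x \<in> carrier R" for x
    unfolding F_def by (rule hecke_function_closed[OF module.axioms(1)[OF E] S(3)])
  have F_translate: "F (a \<otimes> x \<otimes> b) = F x" if "x \<in> carrier G" "a \<in> K" "b \<in> K" for a x b
    unfolding F_def using hecke_function_translate[OF module.axioms(1)[OF E] S(3) K S(2)] that by simp
  have \<phi>_closed: "\<phi> x \<in> carrier E" if "x \<in> carrier G" for x
    unfolding \<phi>_def using \<Xi>[OF that] nR by (rule E.smult_closed[rotated])
  have dc_self: "x \<in> dc x" if "x \<in> carrier G" for x
    unfolding dc_def using self_in_double_coset[OF U K that] .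
  have dc_G: "dc x \<subseteq> carrier G" if "x \<in> carrier G" for x
    unfolding dc_def using double_coset_subset[OF subgroup.subset[OF U] that subgroup.subset[OF K]] .
  have dc_eq: "dc y = dc x" if "x \<in> carrier G" "y \<in> dc x" for x y
    using double_coset_eq[OF U K] that unfolding dc_def by blast
  have KK_G: "double_coset G K \<sigma> K \<subseteq> carrier G" if "\<sigma> \<in> S" for \<sigma>
    using double_coset_subset[OF subgroup.subset[OF K] S_G[OF that] subgroup.subset[OF K]] .
  have dc_KK: "dc x \<subseteq> double_coset G K \<sigma> K" if "\<sigma> \<in> S" "x \<in> double_coset G K \<sigma> K" for x \<sigma>
  proof -
    have "dc x \<subseteq> double_coset G K x K"
    proof
      fix y assume "y \<in> dc x"
      then obtain u k where "u \<in> K" "k \<in> K" "y = u \<otimes> x \<otimes> k" by (auto simp: dc_def mem_double_coset U_def)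
      then show "y \<in> double_coset G K x K" unfolding mem_double_coset by blast
    qed
    then show ?thesis using double_coset_eq[OF K K S_G[OF that(1)] that(2)] by simp
  qed
  have n_card: "card ((\<lambda>y. U #> y) ` {y \<in> H. y \<otimes> a \<in> dc x}) = n x"
    if "a \<in> carrier G" "h \<in> H" "k \<in> K" "x = h \<otimes> a \<otimes> k" for a h k x
    unfolding U_def dc_def n_def using card_cosets_in_double_coset[OF H K that] .
  have dc_cases: "\<exists>u\<in>U. \<exists>k\<in>K. y = u \<otimes> x \<otimes> k" if "y \<in> dc x" for x y
    using that by (auto simp: dc_def mem_double_coset)
  \<comment> \<open>For y in UxK both indices count the right cosets of U in the same set of all z
    in H with z x in UxK: once via y = u x k, once via x itself.\<close>
  have \<phi>_eq: "\<phi> y = \<phi> x" and F_eq: "F y = F x" if x: "x \<in> carrier G" and y: "y \<in> dc x" for x y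
  proof -
    obtain u k where uk: "u \<in> H" "u \<in> K" "k \<in> K" "y = u \<otimes> x \<otimes> k"
      using dc_cases[OF y] by (auto simp: U_def)
    have "n y = card ((\<lambda>z. U #> z) ` {z \<in> H. z \<otimes> x \<in> dc x})"
      using n_card[OF x uk(1,3,4)] dc_eq[OF x y] by simp
    also have "\<dots> = n x"
      using n_card[OF x subgroup.one_closed[OF H] subgroup.one_closed[OF K]] x by simp
    finally have "n y = n x" .
    moreover have "\<Xi> y = \<Xi> x" unfolding uk(4) using \<Xi>_right \<Xi>_left uk x HG by simp
    ultimately show "\<phi> y = \<phi> x" by (simp add: \<phi>_def)
    show "F y = F x" unfolding uk(4) using F_translate x uk by simp
  qed
  have t: "t D \<in> dc x" "t D \<in> carrier G" "dc (t D) = D" "\<phi> (t D) = \<phi> x" "F (t D) = F x"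
    if "x \<in> carrier G" "D = dc x" for x D
  proof -
    show 1: "t D \<in> dc x" unfolding t_def that(2) by (rule someI[of "\<lambda>y. y \<in> dc x", OF dc_self[OF that(1)]])
    show "t D \<in> carrier G" using 1 dc_G[OF that(1)] by blast
    show "dc (t D) = D" using dc_eq[OF that(1) 1] that(2) by simp
    show "\<phi> (t D) = \<phi> x" "F (t D) = F x" using \<phi>_eq[OF that(1) 1] F_eq[OF that(1) 1] .
  qed
  \<comment> \<open>The right stabiliser matches: a\<sigma> and b\<sigma> give the same double coset
    of U and K exactly when a and b, both in K, differ by U on the left and by K \<inter>
    \<sigma>K\<sigma>^-1 on the right.\<close>
  have bij: "bij_betw (\<lambda>\<gamma>. dc (\<gamma> \<otimes> \<sigma>)) (\<Gamma> \<sigma>) (\<D> \<sigma>)" if \<sigma>: "\<sigma> \<in> S" for \<sigma>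
  proof (rule bij_betw_imageI)
    note \<sigma>G = S_G[OF \<sigma>]
    have \<Gamma>K: "\<gamma> \<in> K" if "\<gamma> \<in> \<Gamma> \<sigma>" for \<gamma> using \<Gamma>(2)[OF \<sigma>] that by (auto simp: double_coset_reps_def)
    have uniq: "\<exists>!\<gamma>. \<gamma> \<in> \<Gamma> \<sigma> \<and> x \<in> double_coset G (H \<inter> K) \<gamma> (K \<inter> conjugate G \<sigma> K)" if "x \<in> K" for x
      using \<Gamma>(2)[OF \<sigma>] that by (auto simp: double_coset_reps_def)
    have sub: "subgroup (K \<inter> conjugate G \<sigma> K) G"
      using subgroups_Inter_pair[OF K subgroup_conjugate[OF \<sigma>G K]] .
    show "inj_on (\<lambda>\<gamma>. dc (\<gamma> \<otimes> \<sigma>)) (\<Gamma> \<sigma>)"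
    proof (rule inj_onI)
      fix a b assume ab: "a \<in> \<Gamma> \<sigma>" "b \<in> \<Gamma> \<sigma>" "dc (a \<otimes> \<sigma>) = dc (b \<otimes> \<sigma>)"
      note K_ab = \<Gamma>K[OF ab(1)] \<Gamma>K[OF ab(2)]
      have "a \<otimes> \<sigma> \<in> dc (b \<otimes> \<sigma>)" using dc_self ab(3) K_ab KG \<sigma>G by blast
      then obtain u k where uk: "u \<in> H" "u \<in> K" "k \<in> K" "a \<otimes> \<sigma> = u \<otimes> (b \<otimes> \<sigma>) \<otimes> k"
        using dc_cases[of "a \<otimes> \<sigma>" "b \<otimes> \<sigma>"] by (auto simp: U_def)
      have "a = a \<otimes> \<sigma> \<otimes> inv \<sigma>" using K_ab KG \<sigma>G by (simp add: m_assoc)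
      also have "\<dots> = u \<otimes> b \<otimes> (\<sigma> \<otimes> k \<otimes> inv \<sigma>)"
        unfolding uk(4) using uk(1-3) K_ab KG \<sigma>G by (simp add: m_assoc)
      finally have a: "a = u \<otimes> b \<otimes> (\<sigma> \<otimes> k \<otimes> inv \<sigma>)" .
      have "\<sigma> \<otimes> k \<otimes> inv \<sigma> = inv b \<otimes> (inv u \<otimes> a)"
        unfolding a using uk(1-3) K_ab KG \<sigma>G by (simp add: m_assoc inv_mult_cancel)
      also have "\<dots> \<in> K" using K_ab uk by (intro subgroup.m_closed[OF K] subgroup.m_inv_closed[OF K])
      finally have "\<sigma> \<otimes> k \<otimes> inv \<sigma> \<in> K \<inter> conjugate G \<sigma> K" using uk(3) by (auto simp: conjugate_def)
      then have "a \<in> double_coset G (H \<inter> K) b (K \<inter> conjugate G \<sigma> K)"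
        unfolding mem_double_coset using a uk by blast
      moreover have "a \<in> double_coset G (H \<inter> K) a (K \<inter> conjugate G \<sigma> K)"
        using self_in_double_coset[OF U[unfolded U_def] sub] K_ab KG by blast
      ultimately show "a = b" using uniq[OF K_ab(1)] ab by blast
    qed
    show "(\<lambda>\<gamma>. dc (\<gamma> \<otimes> \<sigma>)) ` \<Gamma> \<sigma> = \<D> \<sigma>"
    proof (intro equalityI subsetI)
      fix D assume "D \<in> (\<lambda>\<gamma>. dc (\<gamma> \<otimes> \<sigma>)) ` \<Gamma> \<sigma>"
      then obtain a where a: "a \<in> \<Gamma> \<sigma>" "D = dc (a \<otimes> \<sigma>)" by auto
      have "a \<otimes> \<sigma> = a \<otimes> \<sigma> \<otimes> \<one>" using \<Gamma>K[OF a(1)] KG \<sigma>G by simp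
      then have "a \<otimes> \<sigma> \<in> double_coset G K \<sigma> K"
        unfolding mem_double_coset using \<Gamma>K[OF a(1)] subgroup.one_closed[OF K] by blast
      then show "D \<in> \<D> \<sigma>" unfolding \<D>_def a(2) by blast
    next
      fix D assume "D \<in> \<D> \<sigma>"
      then obtain x where x: "x \<in> double_coset G K \<sigma> K" "D = dc x" by (auto simp: \<D>_def)
      then obtain k l where kl: "k \<in> K" "l \<in> K" "x = k \<otimes> \<sigma> \<otimes> l" by (auto simp: mem_double_coset)
      obtain a where a: "a \<in> \<Gamma> \<sigma>" "k \<in> double_coset G (H \<inter> K) a (K \<inter> conjugate G \<sigma> K)"
        using uniq[OF kl(1)] by blast
      then obtain u m where um: "u \<in> U" "m \<in> K" "k = u \<otimes> a \<otimes> (\<sigma> \<otimes> m \<otimes> inv \<sigma>)"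
        by (auto simp: mem_double_coset conjugate_def U_def)
      have uG: "u \<in> carrier G" using subgroup.mem_carrier[OF U um(1)] .
      have aG: "a \<in> carrier G" using \<Gamma>K[OF a(1)] KG by blast
      have "x = u \<otimes> (a \<otimes> \<sigma>) \<otimes> (m \<otimes> l)"
        unfolding kl(3) um(3) using uG aG um(2) kl KG \<sigma>G by (simp add: m_assoc inv_mult_cancel)
      then have "x \<in> dc (a \<otimes> \<sigma>)"
        unfolding dc_def mem_double_coset using um(1) subgroup.m_closed[OF K um(2) kl(2)] by blast
      then show "D \<in> (\<lambda>\<gamma>. dc (\<gamma> \<otimes> \<sigma>)) ` \<Gamma> \<sigma>" using dc_eq[OF m_closed[OF aG \<sigma>G]] x a by blast
    qed
  qed
  have fin\<sigma>: "finite (\<D> \<sigma>)" if "\<sigma> \<in> S" for \<sigma>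
    using bij_betw_finite[OF bij[OF that]] \<Gamma>(1)[OF that] by simp
  \<comment> \<open>Distinct \<sigma> in \<open>S\<close> are allowed to give the same K\<sigma>K,
    so this union need not be disjoint. Every inner sum is extended to the whole union by means of
    the indicator \<open>ch\<close>.\<close>
  define \<DD> where "\<DD> = (\<Union>\<sigma>\<in>S. \<D> \<sigma>)"
  have fin: "finite \<DD>" unfolding \<DD>_def using S(1) fin\<sigma> by blast
  have \<D>_t: "t D \<in> carrier G" "dc (t D) = D" if "D \<in> \<DD>" for D
    using that t KK_G by (auto simp: \<DD>_def \<D>_def subset_iff)
  have \<D>_iff: "D \<in> \<D> \<sigma> \<longleftrightarrow> t D \<in> double_coset G K \<sigma> K" if "D \<in> \<DD>" "\<sigma> \<in> S" for D \<sigma>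
  proof
    assume "D \<in> \<D> \<sigma>"
    then obtain x where x: "x \<in> double_coset G K \<sigma> K" "D = dc x" by (auto simp: \<D>_def)
    then show "t D \<in> double_coset G K \<sigma> K" using t(1)[OF _ x(2)] dc_KK[OF that(2) x(1)] KK_G[OF that(2)] by blast
  next
    assume "t D \<in> double_coset G K \<sigma> K"
    then show "D \<in> \<D> \<sigma>" unfolding \<D>_def using \<D>_t(2)[OF that(1)] by (metis imageI)
  qed
  define ch where "ch \<sigma> D = (if t D \<in> double_coset G K \<sigma> K then \<one>\<^bsub>R\<^esub> else \<zero>\<^bsub>R\<^esub>)" for \<sigma> D
  have \<phi>t: "\<phi> (t D) \<in> carrier E" if "D \<in> \<DD>" for D using \<phi>_closed \<D>_t that by blast
  have inner: "(\<Oplus>\<^bsub>E\<^esub>\<gamma>\<in>\<Gamma> \<sigma>. \<phi> (\<gamma> \<otimes> \<sigma>)) = (\<Oplus>\<^bsub>E\<^esub>D\<in>\<DD>. ch \<sigma> D \<odot>\<^bsub>E\<^esub> \<phi> (t D))" if \<sigma>: "\<sigma> \<in> S" for \<sigma>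
  proof -
    have G\<sigma>: "\<gamma> \<otimes> \<sigma> \<in> carrier G" if "\<gamma> \<in> \<Gamma> \<sigma>" for \<gamma>
      using \<Gamma>(2)[OF \<sigma>] that KG S_G[OF \<sigma>] by (auto simp: double_coset_reps_def)
    have "(\<Oplus>\<^bsub>E\<^esub>\<gamma>\<in>\<Gamma> \<sigma>. \<phi> (\<gamma> \<otimes> \<sigma>)) = (\<Oplus>\<^bsub>E\<^esub>\<gamma>\<in>\<Gamma> \<sigma>. \<phi> (t (dc (\<gamma> \<otimes> \<sigma>))))"
      using t(2,4) G\<sigma> by (intro E.M.finsum_eq) (auto intro!: \<phi>_closed)
    also have "\<dots> = (\<Oplus>\<^bsub>E\<^esub>D\<in>\<D> \<sigma>. \<phi> (t D))"
      unfolding bij_betw_imp_surj_on[OF bij[OF \<sigma>], symmetric]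
      using t(2) G\<sigma> bij_betw_imp_inj_on[OF bij[OF \<sigma>]]
      by (intro E.M.add.finprod_reindex[symmetric]) (auto intro!: \<phi>_closed)
    also have "\<dots> = (\<Oplus>\<^bsub>E\<^esub>D\<in>\<DD>. ch \<sigma> D \<odot>\<^bsub>E\<^esub> \<phi> (t D))"
    proof (rule E.M.finsum_mono_neutral_cong_right[symmetric, OF fin])
      show "\<D> \<sigma> \<subseteq> \<DD>" using \<sigma> by (auto simp: \<DD>_def)
      then show "ch \<sigma> D \<odot>\<^bsub>E\<^esub> \<phi> (t D) = \<phi> (t D)" if "D \<in> \<D> \<sigma>" for D
        using that \<D>_iff[OF _ \<sigma>] \<phi>t by (auto simp: ch_def)
      show "ch \<sigma> D \<odot>\<^bsub>E\<^esub> \<phi> (t D) = \<zero>\<^bsub>E\<^esub>" if "D \<in> \<DD> - \<D> \<sigma>" for D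
        using that \<D>_iff[OF _ \<sigma>] \<phi>t by (auto simp: ch_def)
      show "(\<lambda>D. ch \<sigma> D \<odot>\<^bsub>E\<^esub> \<phi> (t D)) \<in> \<DD> \<rightarrow> carrier E"
        using \<phi>t by (auto simp: ch_def)
    qed
    finally show ?thesis .
  qed
  have ch_R: "ch \<sigma> D \<in> carrier R" for \<sigma> D by (simp add: ch_def)
  have F_t: "F (t D) = (\<Oplus>\<^bsub>R\<^esub>\<sigma>\<in>S. c \<sigma> \<otimes>\<^bsub>R\<^esub> ch \<sigma> D)" for D
    by (simp add: F_def hecke_function_def ch_def)
  have "(\<Oplus>\<^bsub>E\<^esub>\<sigma>\<in>S. c \<sigma> \<odot>\<^bsub>E\<^esub> (\<Oplus>\<^bsub>E\<^esub>\<gamma>\<in>\<Gamma> \<sigma>. \<phi> (\<gamma> \<otimes> \<sigma>))) =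
      (\<Oplus>\<^bsub>E\<^esub>\<sigma>\<in>S. \<Oplus>\<^bsub>E\<^esub>D\<in>\<DD>. (c \<sigma> \<otimes>\<^bsub>R\<^esub> ch \<sigma> D) \<odot>\<^bsub>E\<^esub> \<phi> (t D))"
  proof (rule E.M.finsum_eq[OF refl])
    fix \<sigma> assume \<sigma>: "\<sigma> \<in> S"
    show "c \<sigma> \<odot>\<^bsub>E\<^esub> (\<Oplus>\<^bsub>E\<^esub>\<gamma>\<in>\<Gamma> \<sigma>. \<phi> (\<gamma> \<otimes> \<sigma>)) = (\<Oplus>\<^bsub>E\<^esub>D\<in>\<DD>. (c \<sigma> \<otimes>\<^bsub>R\<^esub> ch \<sigma> D) \<odot>\<^bsub>E\<^esub> \<phi> (t D))"
      unfolding inner[OF \<sigma>] using fin c_R[OF \<sigma>] ch_R \<phi>t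
      by (subst E.finsum_smult_ldistr) (auto intro!: E.M.finsum_eq simp: E.smult_assoc1)
  qed (use c_R ch_R \<phi>t in \<open>auto intro!: E.M.finsum_closed\<close>)
  \<comment> \<open>After the interchange, the inner sum for fixed D is by definition the value of
    the Hecke function at \<open>t D\<close>.\<close>
  also have "\<dots> = (\<Oplus>\<^bsub>E\<^esub>D\<in>\<DD>. \<Oplus>\<^bsub>E\<^esub>\<sigma>\<in>S. (c \<sigma> \<otimes>\<^bsub>R\<^esub> ch \<sigma> D) \<odot>\<^bsub>E\<^esub> \<phi> (t D))"
    using c_R ch_R \<phi>t by (intro E.M.finsum_swap S(1) fin) auto
  also have "\<dots> = (\<Oplus>\<^bsub>E\<^esub>D\<in>\<DD>. F (t D) \<odot>\<^bsub>E\<^esub> \<phi> (t D))"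
    using \<phi>t c_R ch_R F_closed
    by (intro E.M.finsum_eq refl) (auto simp: F_t E.finsum_smult_rdistr Pi_def intro!: E.smult_closed E.R.finsum_closed)
  finally have lhs: "(\<Oplus>\<^bsub>E\<^esub>\<sigma>\<in>S. c \<sigma> \<odot>\<^bsub>E\<^esub> (\<Oplus>\<^bsub>E\<^esub>\<gamma>\<in>\<Gamma> \<sigma>. \<phi> (\<gamma> \<otimes> \<sigma>))) = (\<Oplus>\<^bsub>E\<^esub>D\<in>\<DD>. F (t D) \<odot>\<^bsub>E\<^esub> \<phi> (t D))" .

  \<comment> \<open>Double cosets on which the Hecke function is nonzero, sorted by the class H g_i
    K that contains them.\<close>
  define \<DD>i where "\<DD>i i = {D \<in> \<DD>. F (t D) \<noteq> \<zero>\<^bsub>R\<^esub> \<and> t D \<in> double_coset G H (g i) K}" for i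
  have uniq: "\<exists>!\<gamma>. \<gamma> \<in> g ` X \<and> x \<in> double_coset G H \<gamma> K"
    if "x \<in> H <#> hecke_support R G K S c" for x
    using g(3) that by (auto simp: double_coset_reps_def)
  have supp_mem: "x \<in> H <#> hecke_support R G K S c" if "x \<in> carrier G" "F x \<noteq> \<zero>\<^bsub>R\<^esub>" for x
  proof -
    have "x = \<one> \<otimes> x" using that by simp
    then show ?thesis using that subgroup.one_closed[OF H]
      unfolding set_mult_def hecke_support_def F_def by blast
  qed
  have "H <#> hecke_support R G K S c \<subseteq> carrier G"
    using HG by (auto simp: set_mult_def hecke_support_def)
  then have gG: "g i \<in> carrier G" if "i \<in> X" for i
    using g(3) that by (auto simp: double_coset_reps_def)
  have rhs: "(\<Oplus>\<^bsub>E\<^esub>D\<in>\<DD>i i. F (t D) \<odot>\<^bsub>E\<^esub> \<phi> (t D)) =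
      hecke_degree R (G\<lparr>carrier := H\<rparr>) U (H \<inter> conjugate G (g i) K) (\<lambda>h. F (h \<otimes> g i)) \<odot>\<^bsub>E\<^esub> \<Xi> (g i)"
    if i: "i \<in> X" for i
  proof -
    note gi = gG[OF i]
    \<comment> \<open>The slice of D along H g_i, moved back into H. It turns a double coset of U
      and K into one of U and H \<inter> g_i K g_i^-1, which is the kind of double coset that
      \<open>hecke_degree\<close> sums over.\<close>
    define e where "e D = {h \<in> H. h \<otimes> g i \<in> D}" for D
    define \<E> where "\<E> = {double_coset G U h (H \<inter> conjugate G (g i) K) | h. h \<in> H \<and> F (h \<otimes> g i) \<noteq> \<zero>\<^bsub>R\<^esub>}"
    have e_dc: "e (dc (h \<otimes> g i)) = double_coset G U h (H \<inter> conjugate G (g i) K)" if h: "h \<in> H" for h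
    proof (intro equalityI subsetI)
      fix y assume "y \<in> e (dc (h \<otimes> g i))"
      then obtain u k where y: "y \<in> H" "u \<in> U" "k \<in> K" "y \<otimes> g i = u \<otimes> (h \<otimes> g i) \<otimes> k"
        using dc_cases[of "y \<otimes> g i" "h \<otimes> g i"] by (auto simp: e_def)
      have u: "u \<in> H" "u \<in> carrier G" using y HG by (auto simp: U_def)
      have "y = y \<otimes> g i \<otimes> inv (g i)" using y(1) gi HG by (simp add: m_assoc)
      also have "\<dots> = u \<otimes> h \<otimes> (g i \<otimes> k \<otimes> inv (g i))"
        unfolding y(4) using u h y(3) gi HG KG by (simp add: m_assoc)
      finally have y_eq: "y = u \<otimes> h \<otimes> (g i \<otimes> k \<otimes> inv (g i))" .
      have "g i \<otimes> k \<otimes> inv (g i) = inv h \<otimes> (inv u \<otimes> y)"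
        unfolding y_eq using u h y(3) gi HG KG by (simp add: m_assoc inv_mult_cancel)
      also have "\<dots> \<in> H" using u h y by (intro subgroup.m_closed[OF H] subgroup.m_inv_closed[OF H])
      finally show "y \<in> double_coset G U h (H \<inter> conjugate G (g i) K)"
        unfolding mem_double_coset conjugate_def using y_eq y by blast
    next
      fix y assume "y \<in> double_coset G U h (H \<inter> conjugate G (g i) K)"
      then obtain u k where y: "u \<in> U" "k \<in> K" "g i \<otimes> k \<otimes> inv (g i) \<in> H" "y = u \<otimes> h \<otimes> (g i \<otimes> k \<otimes> inv (g i))"
        by (auto simp: mem_double_coset conjugate_def)
      have u: "u \<in> H" "u \<in> carrier G" using y HG by (auto simp: U_def)
      have "y \<in> H" unfolding y(4) using subgroup.m_closed[OF H] u h y(3) by simp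
      moreover have "y \<otimes> g i = u \<otimes> (h \<otimes> g i) \<otimes> k"
        unfolding y(4) using u h y(2) gi HG KG by (simp add: m_assoc)
      ultimately show "y \<in> e (dc (h \<otimes> g i))"
        unfolding e_def dc_def mem_double_coset using y by blast
    qed
    have \<DD>i_cases: "\<exists>h\<in>H. D = dc (h \<otimes> g i) \<and> F (h \<otimes> g i) \<noteq> \<zero>\<^bsub>R\<^esub> \<and> (\<exists>k\<in>K. t D = h \<otimes> g i \<otimes> k)"
      if D: "D \<in> \<DD>i i" for D
    proof -
      obtain h k where hk: "h \<in> H" "k \<in> K" "t D = h \<otimes> g i \<otimes> k"
        using D by (auto simp: \<DD>i_def mem_double_coset)
      have hG: "h \<otimes> g i \<in> carrier G" using hk HG gi by simp
      have "t D = \<one> \<otimes> (h \<otimes> g i) \<otimes> k" using hk hG by simp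
      then have "t D \<in> dc (h \<otimes> g i)"
        unfolding dc_def mem_double_coset using hk subgroup.one_closed[OF U] by blast
      then have "dc (t D) = dc (h \<otimes> g i)" "F (t D) = F (h \<otimes> g i)"
        using dc_eq[OF hG] F_eq[OF hG] by simp_all
      moreover have "dc (t D) = D" using \<D>_t D by (simp add: \<DD>i_def)
      ultimately have "D = dc (h \<otimes> g i)" "F (t D) = F (h \<otimes> g i)" by simp_all
      then show ?thesis using hk D by (auto simp: \<DD>i_def)
    qed
    have nonempty: "h \<in> e (dc (h \<otimes> g i))" if "h \<in> H" for h
      using that dc_self HG gi by (auto simp: e_def)
    have inj: "inj_on e (\<DD>i i)"
    proof (rule inj_onI)
      fix D D' assume D: "D \<in> \<DD>i i" "D' \<in> \<DD>i i" "e D = e D'"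
      obtain h where h: "h \<in> H" "D = dc (h \<otimes> g i)" using \<DD>i_cases[OF D(1)] by blast
      obtain h' where h': "h' \<in> H" "D' = dc (h' \<otimes> g i)" using \<DD>i_cases[OF D(2)] by blast
      have "h \<otimes> g i \<in> D'" using nonempty[OF h(1)] D(3) h(2) by (auto simp: e_def)
      then have "dc (h \<otimes> g i) = dc (h' \<otimes> g i)"
        using dc_eq[of "h' \<otimes> g i" "h \<otimes> g i"] h' HG gi by simp
      then show "D = D'" using h h' by simp
    qed
    have image: "e ` \<DD>i i = \<E>"
    proof (intro equalityI subsetI)
      fix Z assume "Z \<in> e ` \<DD>i i"
      then obtain D where "D \<in> \<DD>i i" "Z = e D" by blast
      then show "Z \<in> \<E>" using \<DD>i_cases[of D] e_dc by (auto simp: \<E>_def)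
    next
      fix Z assume "Z \<in> \<E>"
      then obtain h where h: "h \<in> H" "F (h \<otimes> g i) \<noteq> \<zero>\<^bsub>R\<^esub>" "Z = e (dc (h \<otimes> g i))"
        using e_dc by (auto simp: \<E>_def)
      define x where "x = h \<otimes> g i"
      have x: "x \<in> carrier G" using h HG gi by (simp add: x_def)
      \<comment> \<open>A point with nonzero value lies in some K\<sigma>K, so its double coset has
        already been counted in the finite set \<open>\<DD>\<close>.\<close>
      have "\<exists>\<sigma>\<in>S. x \<in> double_coset G K \<sigma> K"
      proof (rule ccontr)
        assume "\<not> ?thesis"
        then have "F x = (\<Oplus>\<^bsub>R\<^esub>\<sigma>\<in>S. \<zero>\<^bsub>R\<^esub>)"
          unfolding F_def hecke_function_def using c_R by (intro E.R.finsum_eq) auto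
        then show False using h(2) by (simp add: x_def)
      qed
      then obtain \<sigma> where "\<sigma> \<in> S" "x \<in> double_coset G K \<sigma> K" by blast
      then have \<DD>: "dc x \<in> \<DD>" by (auto simp: \<DD>_def \<D>_def)
      obtain u k where uk: "u \<in> U" "k \<in> K" "t (dc x) = u \<otimes> x \<otimes> k"
        using dc_cases t(1)[OF x refl] by blast
      have uH: "u \<in> H" using uk by (simp add: U_def)
      have "t (dc x) = (u \<otimes> h) \<otimes> g i \<otimes> k"
        unfolding uk(3) using uk(2) uH h(1) HG KG gi by (simp add: x_def m_assoc)
      then have "t (dc x) \<in> double_coset G H (g i) K"
        unfolding mem_double_coset using uk(2) subgroup.m_closed[OF H uH h(1)] by blast
      then have "dc x \<in> \<DD>i i" using \<DD> t(5)[OF x refl] h(2) by (simp add: \<DD>i_def x_def)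
      then show "Z \<in> e ` \<DD>i i" using h(3) by (simp add: x_def)
    qed
    \<comment> \<open>The degree evaluates the function at its own arbitrarily chosen point of the
      slice. That point times g_i lies in D, where the Hecke function is constant, so it may be
      exchanged for \<open>t D\<close>.\<close>
    have summand: "[card ((\<lambda>x. U #> x) ` e D)] \<cdot>\<^bsub>R\<^esub> F ((SOME h. h \<in> e D) \<otimes> g i) = F (t D) \<otimes>\<^bsub>R\<^esub> [n (t D)] \<cdot>\<^bsub>R\<^esub> \<one>\<^bsub>R\<^esub>"
      if D: "D \<in> \<DD>i i" for D
    proof -
      obtain h k where h: "h \<in> H" "D = dc (h \<otimes> g i)" "k \<in> K" "t D = h \<otimes> g i \<otimes> k"
        using \<DD>i_cases[OF D] by blast
      have "dc (t D) = D" using \<D>_t D by (simp add: \<DD>i_def)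
      then have "card ((\<lambda>x. U #> x) ` e D) = n (t D)"
        using n_card[OF gi h(1,3,4)] by (simp add: e_def)
      moreover have "(SOME h. h \<in> e D) \<in> e D"
        by (rule someI[of "\<lambda>h. h \<in> e D"]) (use nonempty[OF h(1)] h(2) in simp)
      then have "(SOME h. h \<in> e D) \<otimes> g i \<in> D" by (simp add: e_def)
      then have "F ((SOME h. h \<in> e D) \<otimes> g i) = F (t D)"
        using F_eq[of "t D"] \<open>dc (t D) = D\<close> \<D>_t(1) D by (simp add: \<DD>i_def)
      ultimately show ?thesis by (simp add: E.R.add_pow_rdistr)
    qed
    have \<Xi>_eq: "\<Xi> (t D) = \<Xi> (g i)" if D: "D \<in> \<DD>i i" for D
    proof -
      obtain h k where h: "h \<in> H" "k \<in> K" "t D = h \<otimes> g i \<otimes> k" using \<DD>i_cases[OF D] by blast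
      then show ?thesis using \<Xi>_right \<Xi>_left gi HG by simp
    qed
    have "hecke_degree R (G\<lparr>carrier := H\<rparr>) U (H \<inter> conjugate G (g i) K) (\<lambda>h. F (h \<otimes> g i)) =
        (\<Oplus>\<^bsub>R\<^esub>Z\<in>e ` \<DD>i i. [card ((\<lambda>x. U #> x) ` Z)] \<cdot>\<^bsub>R\<^esub> F ((SOME h. h \<in> Z) \<otimes> g i))"
      unfolding image by (simp add: hecke_degree_def \<E>_def double_coset_def r_coset_def set_mult_def)
    also have "\<dots> = (\<Oplus>\<^bsub>R\<^esub>D\<in>\<DD>i i. [card ((\<lambda>x. U #> x) ` e D)] \<cdot>\<^bsub>R\<^esub> F ((SOME h. h \<in> e D) \<otimes> g i))"
      by (rule E.R.add.finprod_reindex[OF _ inj]) (auto intro!: E.R.add.nat_pow_closed)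
    also have "\<dots> = (\<Oplus>\<^bsub>R\<^esub>D\<in>\<DD>i i. F (t D) \<otimes>\<^bsub>R\<^esub> [n (t D)] \<cdot>\<^bsub>R\<^esub> \<one>\<^bsub>R\<^esub>)"
      using summand nR by (intro E.R.finsum_eq) (auto intro!: E.R.m_closed)
    finally have "hecke_degree R (G\<lparr>carrier := H\<rparr>) U (H \<inter> conjugate G (g i) K) (\<lambda>h. F (h \<otimes> g i)) \<odot>\<^bsub>E\<^esub> \<Xi> (g i) =
        (\<Oplus>\<^bsub>E\<^esub>D\<in>\<DD>i i. (F (t D) \<otimes>\<^bsub>R\<^esub> [n (t D)] \<cdot>\<^bsub>R\<^esub> \<one>\<^bsub>R\<^esub>) \<odot>\<^bsub>E\<^esub> \<Xi> (g i))"
      using \<Xi>[OF gi] nR by (simp add: E.finsum_smult_rdistr)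
    also have "\<dots> = (\<Oplus>\<^bsub>E\<^esub>D\<in>\<DD>i i. F (t D) \<odot>\<^bsub>E\<^esub> \<phi> (t D))"
    proof (rule E.M.finsum_eq[OF refl])
      show "(\<lambda>D. F (t D) \<odot>\<^bsub>E\<^esub> \<phi> (t D)) \<in> \<DD>i i \<rightarrow> carrier E" using \<phi>t by (auto simp: \<DD>i_def)
      fix D assume "D \<in> \<DD>i i"
      then show "(F (t D) \<otimes>\<^bsub>R\<^esub> [n (t D)] \<cdot>\<^bsub>R\<^esub> \<one>\<^bsub>R\<^esub>) \<odot>\<^bsub>E\<^esub> \<Xi> (g i) = F (t D) \<odot>\<^bsub>E\<^esub> \<phi> (t D)"
        unfolding \<phi>_def using \<Xi>[OF gi] nR by (simp add: \<Xi>_eq E.smult_assoc1 del: E.R.r_one)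
    qed
    finally show ?thesis by simp
  qed
  have disj: "pairwise (\<lambda>i j. disjnt (\<DD>i i) (\<DD>i j)) X"
  proof (intro pairwiseI)
    fix i j assume ij: "i \<in> X" "j \<in> X" "i \<noteq> j"
    have False if D: "D \<in> \<DD>i i" "D \<in> \<DD>i j" for D
    proof -
      have "t D \<in> H <#> hecke_support R G K S c"
        using D supp_mem \<D>_t by (simp add: \<DD>i_def)
      from uniq[OF this] have "g i = g j" using D ij by (auto simp: \<DD>i_def)
      then show False using ij g(2) by (auto simp: inj_on_def)
    qed
    then show "disjnt (\<DD>i i) (\<DD>i j)" by (auto simp: disjnt_def)
  qed
  \<comment> \<open>The representatives g_i cover only the support. Coefficients may vanish or
    cancel, so \<open>\<DD>\<close> can contain double cosets outside the support; their summands
    are zero and are dropped.\<close>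
  have cover: "(\<Union>i\<in>X. \<DD>i i) = {D \<in> \<DD>. F (t D) \<noteq> \<zero>\<^bsub>R\<^esub>}"
    using uniq[OF supp_mem[OF \<D>_t(1)]] by (auto simp: \<DD>i_def) blast
  have "(\<Oplus>\<^bsub>E\<^esub>D\<in>\<DD>. F (t D) \<odot>\<^bsub>E\<^esub> \<phi> (t D)) = (\<Oplus>\<^bsub>E\<^esub>D\<in>(\<Union>i\<in>X. \<DD>i i). F (t D) \<odot>\<^bsub>E\<^esub> \<phi> (t D))"
    unfolding cover using \<phi>t by (intro E.M.finsum_mono_neutral_cong_right[OF fin]) auto
  also have "\<dots> = (\<Oplus>\<^bsub>E\<^esub>i\<in>X. \<Oplus>\<^bsub>E\<^esub>D\<in>\<DD>i i. F (t D) \<odot>\<^bsub>E\<^esub> \<phi> (t D))"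
    using \<phi>t fin by (intro E.M.finsum_UN_disjoint g(1) disj) (auto simp: \<DD>i_def)
  also have "\<dots> = (\<Oplus>\<^bsub>E\<^esub>i\<in>X. hecke_degree R (G\<lparr>carrier := H\<rparr>) U (H \<inter> conjugate G (g i) K)
      (\<lambda>h. F (h \<otimes> g i)) \<odot>\<^bsub>E\<^esub> \<Xi> (g i))"
  proof (rule E.M.finsum_eq[OF refl])
    have "(\<Oplus>\<^bsub>E\<^esub>D\<in>\<DD>i i. F (t D) \<odot>\<^bsub>E\<^esub> \<phi> (t D)) \<in> carrier E" for i
      using \<phi>t by (intro E.M.finsum_closed) (auto simp: \<DD>i_def)
    then show "(\<lambda>i. hecke_degree R (G\<lparr>carrier := H\<rparr>) U (H \<inter> conjugate G (g i) K)
      (\<lambda>h. F (h \<otimes> g i)) \<odot>\<^bsub>E\<^esub> \<Xi> (g i)) \<in> X \<rightarrow> carrier E" using rhs by (metis (mono_tags, lifting) Pi_I)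
  qed (use rhs in blast)
  finally show ?thesis using lhs by (simp add: \<phi>_def n_def F_def U_def)
qed

end

section \<open>Double coset representatives\<close>

context group
begin

section \<open>Open translates, existence and finiteness of double coset representatives\<close>

lemma openin_conjugate:
  assumes "topological_group G T" "a \<in> carrier G" "openin T W"
  shows "openin T (conjugate G a W)"
proof -
  have top: "topspace T = carrier G" and mult: "continuous_map (prod_topology T T) T (\<lambda>(x, y). x \<otimes>\<^bsub>G\<^esub> y)"
    using assms(1) by (auto simp: topological_group_def)
  have cont_mult: "continuous_map T T (\<lambda>x. f x \<otimes>\<^bsub>G\<^esub> h x)"
    if "continuous_map T T f" "continuous_map T T h" for f h
    using continuous_map_compose[OF continuous_map_pairedI[OF that] mult] by (simp add: o_def)
  have W: "W \<subseteq> carrier G" using openin_subset[OF assms(3)] top by simp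
  have const: "continuous_map T T (\<lambda>x. b)" if "b \<in> carrier G" for b
    using that top by simp
  have "continuous_map T T (\<lambda>x. inv a \<otimes> x \<otimes> a)"
    using assms(2) by (intro cont_mult const continuous_map_id[unfolded id_def]) auto
  then have "openin T {x \<in> topspace T. inv a \<otimes> x \<otimes> a \<in> W}"
    using assms(3) by (rule openin_continuous_map_preimage)
  also have "{x \<in> topspace T. inv a \<otimes> x \<otimes> a \<in> W} = conjugate G a W"
    using mem_conjugate_iff[OF assms(2) W] conjugate_closed[OF assms(2) W] top by blast
  finally show ?thesis .
qed

lemma openin_l_coset:
  assumes "topological_group G T" "a \<in> carrier G" "openin T W"
  shows "openin T (a <#\<^bsub>G\<^esub> W)"
proof -
  have top: "topspace T = carrier G" and mult: "continuous_map (prod_topology T T) T (\<lambda>(x, y). x \<otimes>\<^bsub>G\<^esub> y)"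
    using assms(1) by (auto simp: topological_group_def)
  have W: "W \<subseteq> carrier G" using openin_subset[OF assms(3)] top by simp
  have "continuous_map T T (\<lambda>x. inv a \<otimes> x)"
    using continuous_map_compose[OF continuous_map_pairedI[of T T "\<lambda>x. inv a" T "\<lambda>x. x"] mult] assms(2) top
    by (simp add: o_def)
  then have "openin T {x \<in> topspace T. inv a \<otimes> x \<in> W}"
    using assms(3) by (rule openin_continuous_map_preimage)
  also have "{x \<in> topspace T. inv a \<otimes> x \<in> W} = a <#\<^bsub>G\<^esub> W"
  proof (intro equalityI subsetI)
    fix x assume x: "x \<in> {x \<in> topspace T. inv a \<otimes> x \<in> W}"
    then have "x = a \<otimes> (inv a \<otimes> x)" using assms(2) top by (simp add: inv_mult_cancel)
    then show "x \<in> a <#\<^bsub>G\<^esub> W" using x by (auto simp: l_coset_def)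
  qed (use W assms(2) top in \<open>auto simp: l_coset_def inv_mult_cancel subset_iff\<close>)
  finally show ?thesis .
qed

text \<open>Finitely many of the open cosets xQ cover the compact K. Two representatives in one such
  coset would lie in the same double coset, so choosing a covering coset for each representative is
  injective. Finiteness is essential because \<open>finsum\<close> over an infinite set is zero by
  convention.\<close>

lemma finite_double_coset_reps:
  assumes T: "topological_group G T" and K: "subgroup K G" "compactin T K"
    and Q: "subgroup Q G" "openin T Q" and U: "subgroup U G"
    and \<Gamma>: "double_coset_reps G U K Q \<Gamma>"
  shows "finite \<Gamma>"
proof -
  note KG = subgroup.mem_carrier[OF K(1)] and QG = subgroup.mem_carrier[OF Q(1)]
  have self: "x \<in> x <#\<^bsub>G\<^esub> Q" if "x \<in> K" for x
    using that KG subgroup.one_closed[OF Q(1)] by (force simp: l_coset_def)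
  obtain \<F> where \<F>: "finite \<F>" "\<F> \<subseteq> (\<lambda>x. x <#\<^bsub>G\<^esub> Q) ` K" "K \<subseteq> \<Union>\<F>"
    using compactinD[OF K(2), of "(\<lambda>x. x <#\<^bsub>G\<^esub> Q) ` K"] openin_l_coset[OF T KG Q(2)] self by blast
  have \<Gamma>K: "\<Gamma> \<subseteq> K" and uniq: "\<And>x. x \<in> K \<Longrightarrow> \<exists>!\<gamma>. \<gamma> \<in> \<Gamma> \<and> x \<in> double_coset G U \<gamma> Q"
    using \<Gamma> by (auto simp: double_coset_reps_def)
  have "\<exists>C\<in>\<F>. \<gamma> \<in> C" if "\<gamma> \<in> \<Gamma>" for \<gamma> using that \<Gamma>K \<F>(3) by blast
  then obtain C where C: "\<And>\<gamma>. \<gamma> \<in> \<Gamma> \<Longrightarrow> C \<gamma> \<in> \<F> \<and> \<gamma> \<in> C \<gamma>" by metis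
  have "inj_on C \<Gamma>"
  proof (rule inj_onI)
    fix a b assume ab: "a \<in> \<Gamma>" "b \<in> \<Gamma>" "C a = C b"
    note abG = KG[OF subsetD[OF \<Gamma>K ab(1)]] KG[OF subsetD[OF \<Gamma>K ab(2)]]
    obtain x where "x \<in> K" "C a = x <#\<^bsub>G\<^esub> Q" using C[OF ab(1)] \<F>(2) by blast
    then obtain q q' where q: "q \<in> Q" "q' \<in> Q" "a = x \<otimes> q" "b = x \<otimes> q'"
      using C[OF ab(1)] C[OF ab(2)] ab(3) by (auto simp: l_coset_def)
    have "a = \<one> \<otimes> b \<otimes> (inv q' \<otimes> q)"
      unfolding q(3,4) using q(1,2) \<open>x \<in> K\<close> KG QG by (simp add: m_assoc inv_mult_cancel)
    moreover have "inv q' \<otimes> q \<in> Q"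
      using subgroup.m_closed[OF Q(1) subgroup.m_inv_closed[OF Q(1) q(2)] q(1)] .
    ultimately have "a \<in> double_coset G U b Q"
      unfolding mem_double_coset using subgroup.one_closed[OF U] by blast
    moreover have "a = \<one> \<otimes> a \<otimes> \<one>" using abG by simp
    then have "a \<in> double_coset G U a Q"
      unfolding mem_double_coset using subgroup.one_closed[OF U] subgroup.one_closed[OF Q(1)] by blast
    ultimately show "a = b" using uniq[of a] ab \<Gamma>K by blast
  qed
  moreover have "C ` \<Gamma> \<subseteq> \<F>" using C by blast
  ultimately show "finite \<Gamma>" using \<F>(1) by (meson finite_imageD finite_subset)
qed

text \<open>The choice \<open>t x\<close> depends on x only through its double coset, so the image
  of K under \<open>t\<close> meets each double coset exactly once.\<close>

lemma ex_double_coset_reps: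
  assumes "subgroup U G" "subgroup Q G" "subgroup K G" "U \<subseteq> K" "Q \<subseteq> K"
  obtains \<Gamma> where "double_coset_reps G U K Q \<Gamma>"
proof -
  define dc where "dc x = double_coset G U x Q" for x
  define t where "t x = (SOME y. y \<in> dc x)" for x
  note KG = subgroup.mem_carrier[OF assms(3)]
  have self: "x \<in> dc x" if "x \<in> K" for x
    unfolding dc_def using self_in_double_coset assms(1,2) KG[OF that] by blast
  have t: "t x \<in> dc x" if "x \<in> K" for x
    unfolding t_def using self[OF that] by (rule someI[of "\<lambda>y. y \<in> dc x"])
  have eq: "dc y = dc x" if "x \<in> K" "y \<in> dc x" for x y
    using double_coset_eq[OF assms(1,2) KG[OF that(1)]] that(2) by (simp add: dc_def)
  have sub: "dc x \<subseteq> K" if "x \<in> K" for x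
    using that subsetD[OF assms(4)] subsetD[OF assms(5)] subgroup.m_closed[OF assms(3)]
    by (auto simp: dc_def mem_double_coset)
  have "double_coset_reps G U K Q (t ` K)"
    unfolding double_coset_reps_def dc_def[symmetric]
  proof (intro conjI ballI)
    show "t ` K \<subseteq> K" using t sub by blast
    fix x assume x: "x \<in> K"
    have tx: "t x \<in> K" using t sub x by blast
    show "\<exists>!\<gamma>. \<gamma> \<in> t ` K \<and> x \<in> dc \<gamma>"
    proof (rule ex1I[of _ "t x"])
      show "t x \<in> t ` K \<and> x \<in> dc (t x)" using x self eq[OF x t[OF x]] by auto
      fix \<gamma> assume \<gamma>: "\<gamma> \<in> t ` K \<and> x \<in> dc \<gamma>"
      then obtain y where y: "y \<in> K" "\<gamma> = t y" by blast
      have "dc x = dc y" using eq[of \<gamma> x] eq[OF y(1) t[OF y(1)]] \<gamma> y t sub by auto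
      then show "\<gamma> = t x" by (simp add: y(2) t_def)
    qed
  qed
  then show thesis by (rule that)
qed

end

section \<open>Restricted products\<close>

locale restricted_family =
  fixes I :: "'i set" and G :: "'i \<Rightarrow> ('g, 'x) monoid_scheme" and K :: "'i \<Rightarrow> 'g set"
  assumes group_factor: "v \<in> I \<Longrightarrow> group (G v)"
    and subgroup_factor: "v \<in> I \<Longrightarrow> subgroup (K v) (G v)"
begin

abbreviation "A \<equiv> restricted_product I G K"
abbreviation "emb \<equiv> place_embedding I G"

lemma carrier_A: "carrier A = {x \<in> \<Pi>\<^sub>E v\<in>I. carrier (G v). finite {v \<in> I. x v \<notin> K v}}"
  by (simp add: restricted_product_def)

lemma mult_A: "x \<otimes>\<^bsub>A\<^esub> y = (\<lambda>v\<in>I. x v \<otimes>\<^bsub>G v\<^esub> y v)"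
  by (simp add: restricted_product_def)

lemma one_A: "\<one>\<^bsub>A\<^esub> = (\<lambda>v\<in>I. \<one>\<^bsub>G v\<^esub>)"
  by (simp add: restricted_product_def)

lemma product_group_factors: "group (product_group I G)"
  by (simp add: group_factor)

lemma subgroup_A: "subgroup (carrier A) (product_group I G)"
proof -
  interpret group "product_group I G" by (rule product_group_factors)
  show ?thesis
  proof (rule subgroupI)
    show "carrier A \<subseteq> carrier (product_group I G)" by (auto simp: carrier_A)
    have "{v \<in> I. (\<lambda>v\<in>I. \<one>\<^bsub>G v\<^esub>) v \<notin> K v} = {}"
      using subgroup.one_closed[OF subgroup_factor] by auto
    then have "\<one>\<^bsub>A\<^esub> \<in> carrier A"
      using one_closed by (simp add: carrier_A one_A)
    then show "carrier A \<noteq> {}" by blast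
  next
    fix x assume x: "x \<in> carrier A"
    then have "{v \<in> I. (\<lambda>v\<in>I. inv\<^bsub>G v\<^esub> x v) v \<notin> K v} \<subseteq> {v \<in> I. x v \<notin> K v}"
      using subgroup.m_inv_closed[OF subgroup_factor] by auto
    then have "finite {v \<in> I. (\<lambda>v\<in>I. inv\<^bsub>G v\<^esub> x v) v \<notin> K v}"
      by (rule finite_subset) (use x in \<open>simp add: carrier_A\<close>)
    moreover have "inv\<^bsub>product_group I G\<^esub> x \<in> carrier (product_group I G)"
      using x by (intro inv_closed) (simp add: carrier_A)
    ultimately show "inv\<^bsub>product_group I G\<^esub> x \<in> carrier A"
      using x by (simp add: carrier_A group_factor)
  next
    fix x y assume xy: "x \<in> carrier A" "y \<in> carrier A"
    then have "{v \<in> I. (\<lambda>v\<in>I. x v \<otimes>\<^bsub>G v\<^esub> y v) v \<notin> K v} \<subseteq> {v \<in> I. x v \<notin> K v} \<union> {v \<in> I. y v \<notin> K v}"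
      using subgroup.m_closed[OF subgroup_factor] by auto
    then have "finite {v \<in> I. (\<lambda>v\<in>I. x v \<otimes>\<^bsub>G v\<^esub> y v) v \<notin> K v}"
      by (rule finite_subset) (use xy in \<open>simp add: carrier_A\<close>)
    moreover have "x \<otimes>\<^bsub>product_group I G\<^esub> y \<in> carrier (product_group I G)"
      using xy by (intro m_closed) (simp_all add: carrier_A)
    ultimately show "x \<otimes>\<^bsub>product_group I G\<^esub> y \<in> carrier A"
      using xy by (simp add: carrier_A)
  qed
qed

lemma A_eq: "A = product_group I G\<lparr>carrier := carrier A\<rparr>"
  by (simp add: restricted_product_def)

lemma group_A: "group A"
  by (subst A_eq) (rule group.subgroup_imp_group[OF product_group_factors subgroup_A])

lemma inv_A: "x \<in> carrier A \<Longrightarrow> inv\<^bsub>A\<^esub> x = (\<lambda>v\<in>I. inv\<^bsub>G v\<^esub> x v)"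
  using group.m_inv_consistent[OF product_group_factors subgroup_A, of x]
  by (subst A_eq) (simp add: carrier_A group_factor)

lemma component_closed: "\<lbrakk>x \<in> carrier A; v \<in> I\<rbrakk> \<Longrightarrow> x v \<in> carrier (G v)"
  by (auto simp: carrier_A PiE_iff)

lemma conjugate_PiE:
  assumes "a \<in> carrier A" "\<And>v. v \<in> I \<Longrightarrow> J v \<subseteq> carrier (G v)"
  shows "conjugate A a (Pi\<^sub>E I J) = (\<Pi>\<^sub>E v\<in>I. conjugate (G v) (a v) (J v))"
proof (intro equalityI subsetI)
  fix x assume "x \<in> conjugate A a (Pi\<^sub>E I J)"
  then show "x \<in> (\<Pi>\<^sub>E v\<in>I. conjugate (G v) (a v) (J v))"
    by (auto simp: conjugate_def mult_A inv_A[OF assms(1)] PiE_iff)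
next
  fix x assume x: "x \<in> (\<Pi>\<^sub>E v\<in>I. conjugate (G v) (a v) (J v))"
  define y where "y = (\<lambda>v\<in>I. inv\<^bsub>G v\<^esub> a v \<otimes>\<^bsub>G v\<^esub> x v \<otimes>\<^bsub>G v\<^esub> a v)"
  have *: "x v \<in> carrier (G v)" "y v \<in> J v" "a v \<otimes>\<^bsub>G v\<^esub> y v \<otimes>\<^bsub>G v\<^esub> inv\<^bsub>G v\<^esub> a v = x v" if v: "v \<in> I" for v
  proof -
    interpret group "G v" by (rule group_factor[OF v])
    note av = component_closed[OF assms(1) v]
    have xv: "x v \<in> conjugate (G v) (a v) (J v)" using x v by auto
    then show xG: "x v \<in> carrier (G v)" using conjugate_closed[OF av assms(2)[OF v]] by blast
    show "y v \<in> J v" using mem_conjugate_iff[OF av assms(2)[OF v] xG] xv v by (simp add: y_def)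
    show "a v \<otimes>\<^bsub>G v\<^esub> y v \<otimes>\<^bsub>G v\<^esub> inv\<^bsub>G v\<^esub> a v = x v" using av xG v by (simp add: y_def m_assoc inv_mult_cancel)
  qed
  have "y \<in> Pi\<^sub>E I J" using *(2) by (auto simp: y_def)
  moreover have "x = a \<otimes>\<^bsub>A\<^esub> y \<otimes>\<^bsub>A\<^esub> inv\<^bsub>A\<^esub> a"
    using x *(3) by (auto simp: mult_A inv_A[OF assms(1)] fun_eq_iff PiE_iff extensional_def)
  ultimately show "x \<in> conjugate A a (Pi\<^sub>E I J)" unfolding conjugate_def by blast
qed

lemma double_coset_PiE:
  assumes "x \<in> extensional I"
  shows "double_coset A (Pi\<^sub>E I P) x (Pi\<^sub>E I Q) = (\<Pi>\<^sub>E v\<in>I. double_coset (G v) (P v) (x v) (Q v))"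
proof (intro equalityI subsetI)
  fix y assume "y \<in> double_coset A (Pi\<^sub>E I P) x (Pi\<^sub>E I Q)"
  then show "y \<in> (\<Pi>\<^sub>E v\<in>I. double_coset (G v) (P v) (x v) (Q v))"
    unfolding group.mem_double_coset[OF group_A]
    by (auto simp: mult_A PiE_iff group.mem_double_coset[OF group_factor]) blast
next
  fix y assume y: "y \<in> (\<Pi>\<^sub>E v\<in>I. double_coset (G v) (P v) (x v) (Q v))"
  then have "\<exists>a b. a \<in> P v \<and> b \<in> Q v \<and> y v = a \<otimes>\<^bsub>G v\<^esub> x v \<otimes>\<^bsub>G v\<^esub> b" if "v \<in> I" for v
    using that by (auto simp: PiE_iff group.mem_double_coset[OF group_factor]) blast
  then obtain a b where ab: "\<And>v. v \<in> I \<Longrightarrow> a v \<in> P v \<and> b v \<in> Q v \<and> y v = a v \<otimes>\<^bsub>G v\<^esub> x v \<otimes>\<^bsub>G v\<^esub> b v"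
    by metis
  then have "y = restrict a I \<otimes>\<^bsub>A\<^esub> x \<otimes>\<^bsub>A\<^esub> restrict b I"
    using y by (auto simp: mult_A fun_eq_iff PiE_iff extensional_def)
  then show "y \<in> double_coset A (Pi\<^sub>E I P) x (Pi\<^sub>E I Q)"
    unfolding group.mem_double_coset[OF group_A]
    using ab by (intro bexI[of _ "restrict a I"] bexI[of _ "restrict b I"]) auto
qed

text \<open>Right cosets of a product are products of right cosets. At places outside the finite set
  \<nu> there is only one coset, so restricting to \<nu> loses nothing and the cosets form a finite
  product of finite or infinite sets, whose cardinality \<open>card_PiE\<close> computes.\<close>

lemma index_PiE:
  assumes P: "\<And>v. v \<in> I \<Longrightarrow> subgroup (P v) (G v)" and Q: "\<And>v. v \<in> I \<Longrightarrow> subgroup (Q v) (G v)"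
    and \<nu>: "finite \<nu>" "\<nu> \<subseteq> I" "\<And>v. v \<in> I - \<nu> \<Longrightarrow> Q v = P v"
  shows "index A (Pi\<^sub>E I P) (Pi\<^sub>E I Q) = (\<Prod>v\<in>\<nu>. index (G v) (P v) (Q v))"
proof -
  define X where "X v = (\<lambda>a. Q v #>\<^bsub>G v\<^esub> a) ` P v" for v
  have rcoset: "Pi\<^sub>E I Q #>\<^bsub>A\<^esub> a = (\<Pi>\<^sub>E v\<in>I. Q v #>\<^bsub>G v\<^esub> a v)" for a
  proof (intro equalityI subsetI)
    fix y assume "y \<in> Pi\<^sub>E I Q #>\<^bsub>A\<^esub> a"
    then show "y \<in> (\<Pi>\<^sub>E v\<in>I. Q v #>\<^bsub>G v\<^esub> a v)" by (auto simp: r_coset_def mult_A PiE_iff)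
  next
    fix y assume y: "y \<in> (\<Pi>\<^sub>E v\<in>I. Q v #>\<^bsub>G v\<^esub> a v)"
    then have "\<exists>q. q \<in> Q v \<and> y v = q \<otimes>\<^bsub>G v\<^esub> a v" if "v \<in> I" for v
      using that by (auto simp: PiE_iff r_coset_def)
    then obtain q where q: "\<And>v. v \<in> I \<Longrightarrow> q v \<in> Q v \<and> y v = q v \<otimes>\<^bsub>G v\<^esub> a v" by metis
    then have "y = restrict q I \<otimes>\<^bsub>A\<^esub> a" "restrict q I \<in> Pi\<^sub>E I Q"
      using y by (auto simp: mult_A fun_eq_iff PiE_iff extensional_def)
    then show "y \<in> Pi\<^sub>E I Q #>\<^bsub>A\<^esub> a" unfolding r_coset_def by blast
  qed
  have triv: "Q v #>\<^bsub>G v\<^esub> a = P v" if "v \<in> I - \<nu>" "a \<in> P v" for v a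
  proof -
    interpret group "G v" using group_factor that by blast
    show ?thesis
      using coset_join2[OF subgroup.mem_carrier[OF P] P] that \<nu>(3) by auto
  qed
  have "card ((\<lambda>a. Pi\<^sub>E I Q #>\<^bsub>A\<^esub> a) ` Pi\<^sub>E I P) = card ((\<lambda>a. \<lambda>v\<in>\<nu>. Q v #>\<^bsub>G v\<^esub> a v) ` Pi\<^sub>E I P)"
  proof (rule card_image_eq_card_image)
    fix a b assume ab: "a \<in> Pi\<^sub>E I P" "b \<in> Pi\<^sub>E I P"
    have ne: "Q v #>\<^bsub>G v\<^esub> x \<noteq> {}" if "v \<in> I" for v x
      using subgroup.one_closed[OF Q[OF that]] by (auto simp: r_coset_def)
    have "Pi\<^sub>E I Q #>\<^bsub>A\<^esub> a = Pi\<^sub>E I Q #>\<^bsub>A\<^esub> b \<longleftrightarrow> (\<forall>v\<in>I. Q v #>\<^bsub>G v\<^esub> a v = Q v #>\<^bsub>G v\<^esub> b v)"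
      unfolding rcoset by (rule PiE_eq_iff_not_empty) (use ne in auto)
    also have "\<dots> \<longleftrightarrow> (\<forall>v\<in>\<nu>. Q v #>\<^bsub>G v\<^esub> a v = Q v #>\<^bsub>G v\<^esub> b v)"
    proof -
      have "Q v #>\<^bsub>G v\<^esub> a v = Q v #>\<^bsub>G v\<^esub> b v" if "v \<in> I - \<nu>" for v
        using triv[OF that, of "a v"] triv[OF that, of "b v"] ab that by (auto simp: PiE_iff)
      then show ?thesis using \<nu>(2) by blast
    qed
    also have "\<dots> \<longleftrightarrow> (\<lambda>v\<in>\<nu>. Q v #>\<^bsub>G v\<^esub> a v) = (\<lambda>v\<in>\<nu>. Q v #>\<^bsub>G v\<^esub> b v)"
      by (auto simp: fun_eq_iff)
    finally show "Pi\<^sub>E I Q #>\<^bsub>A\<^esub> a = Pi\<^sub>E I Q #>\<^bsub>A\<^esub> b \<longleftrightarrow>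
      (\<lambda>v\<in>\<nu>. Q v #>\<^bsub>G v\<^esub> a v) = (\<lambda>v\<in>\<nu>. Q v #>\<^bsub>G v\<^esub> b v)" .
  qed
  also have "(\<lambda>a. \<lambda>v\<in>\<nu>. Q v #>\<^bsub>G v\<^esub> a v) ` Pi\<^sub>E I P = Pi\<^sub>E \<nu> X"
  proof (intro equalityI subsetI)
    fix f assume f: "f \<in> Pi\<^sub>E \<nu> X"
    then have "\<exists>a. a \<in> P v \<and> f v = Q v #>\<^bsub>G v\<^esub> a" if "v \<in> \<nu>" for v
      using that by (auto simp: PiE_iff X_def)
    then obtain a where a: "\<And>v. v \<in> \<nu> \<Longrightarrow> a v \<in> P v \<and> f v = Q v #>\<^bsub>G v\<^esub> a v" by metis
    define b where "b = (\<lambda>v\<in>I. if v \<in> \<nu> then a v else \<one>\<^bsub>G v\<^esub>)"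
    have "b \<in> Pi\<^sub>E I P" using a subgroup.one_closed[OF P] by (auto simp: b_def)
    moreover have "f = (\<lambda>v\<in>\<nu>. Q v #>\<^bsub>G v\<^esub> b v)"
      using f a \<nu>(2) by (auto simp: b_def fun_eq_iff PiE_iff extensional_def)
    ultimately show "f \<in> (\<lambda>a. \<lambda>v\<in>\<nu>. Q v #>\<^bsub>G v\<^esub> a v) ` Pi\<^sub>E I P" by blast
  next
    fix f assume "f \<in> (\<lambda>a. \<lambda>v\<in>\<nu>. Q v #>\<^bsub>G v\<^esub> a v) ` Pi\<^sub>E I P"
    then show "f \<in> Pi\<^sub>E \<nu> X" using \<nu>(2) by (auto simp: X_def PiE_iff)
  qed
  finally show ?thesis
    unfolding index_altdef using card_PiE[OF \<nu>(1), of X] by (simp add: X_def)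
qed

section \<open>Elements supported at a single place\<close>

lemma emb_apply: "\<lbrakk>v \<in> I; w \<in> I\<rbrakk> \<Longrightarrow> emb v \<sigma> w = (if w = v then \<sigma> else \<one>\<^bsub>G w\<^esub>)"
  by (simp add: place_embedding_def)

lemma emb_mem_PiE:
  "\<lbrakk>v \<in> I; \<sigma> \<in> P v; \<And>w. w \<in> I \<Longrightarrow> subgroup (P w) (G w)\<rbrakk> \<Longrightarrow> emb v \<sigma> \<in> Pi\<^sub>E I P"
  using subgroup.one_closed by (force simp: place_embedding_def)

lemma emb_closed:
  assumes "v \<in> I" "\<sigma> \<in> carrier (G v)"
  shows "emb v \<sigma> \<in> carrier A"
proof -
  have "{w \<in> I. emb v \<sigma> w \<notin> K w} \<subseteq> {v}"
    using assms(1) subgroup.one_closed[OF subgroup_factor] by (auto simp: emb_apply split: if_splits)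
  then have "finite {w \<in> I. emb v \<sigma> w \<notin> K w}" by (rule finite_subset) simp
  moreover have "emb v \<sigma> \<in> (\<Pi>\<^sub>E v\<in>I. carrier (G v))"
    using assms group.subgroup_self[OF group_factor] by (intro emb_mem_PiE) auto
  ultimately show ?thesis by (simp add: carrier_A)
qed

lemma emb_mult:
  assumes "v \<in> I"
  shows "emb v (\<sigma> \<otimes>\<^bsub>G v\<^esub> \<tau>) = emb v \<sigma> \<otimes>\<^bsub>A\<^esub> emb v \<tau>"
  using assms monoid.l_one[OF group.is_monoid[OF group_factor] monoid.one_closed[OF group.is_monoid[OF group_factor]]]
  by (auto simp: mult_A place_embedding_def fun_eq_iff)

text \<open>At every place one of the two factors is 1. This lets a Hecke translation at v pass
  through an element that collects the translations at other places.\<close>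

lemma emb_commute:
  assumes "v \<in> I" "a \<in> carrier A" "a v = \<one>\<^bsub>G v\<^esub>" "\<sigma> \<in> carrier (G v)"
  shows "a \<otimes>\<^bsub>A\<^esub> emb v \<sigma> = emb v \<sigma> \<otimes>\<^bsub>A\<^esub> a"
  using assms component_closed[OF assms(2)] monoid.l_one[OF group.is_monoid[OF group_factor]]
    monoid.r_one[OF group.is_monoid[OF group_factor]]
  by (auto simp: mult_A place_embedding_def fun_eq_iff)

text \<open>At each w other than v the right-hand group is all of \<open>P w\<close>, so there is a
  single double coset, represented by 1. Only the component at v distinguishes double
  cosets.\<close>

lemma double_coset_reps_PiE:
  assumes v: "v \<in> I" and W: "\<And>w. w \<in> I \<Longrightarrow> subgroup (W w) (G w)"
    and P: "\<And>w. w \<in> I \<Longrightarrow> subgroup (P w) (G w)"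
    and sub: "\<And>w. w \<in> I \<Longrightarrow> W w \<subseteq> P w" and Q: "\<And>w. \<lbrakk>w \<in> I; w \<noteq> v\<rbrakk> \<Longrightarrow> Q w = P w"
    and \<Gamma>: "double_coset_reps (G v) (W v) (P v) (Q v) \<Gamma>"
  shows "double_coset_reps A (Pi\<^sub>E I W) (Pi\<^sub>E I P) (Pi\<^sub>E I Q) (emb v ` \<Gamma>)"
proof -
  have \<Gamma>P: "\<Gamma> \<subseteq> P v" and uniq: "\<And>x. x \<in> P v \<Longrightarrow> \<exists>!\<gamma>. \<gamma> \<in> \<Gamma> \<and> x \<in> double_coset (G v) (W v) \<gamma> (Q v)"
    using \<Gamma> by (auto simp: double_coset_reps_def)
  have other: "P w \<subseteq> double_coset (G w) (W w) \<one>\<^bsub>G w\<^esub> (Q w)" if w: "w \<in> I" "w \<noteq> v" for w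
  proof
    interpret group "G w" by (rule group_factor[OF w(1)])
    fix x assume "x \<in> P w"
    moreover from this have "x = \<one>\<^bsub>G w\<^esub> \<otimes>\<^bsub>G w\<^esub> \<one>\<^bsub>G w\<^esub> \<otimes>\<^bsub>G w\<^esub> x"
      using subgroup.mem_carrier[OF P[OF w(1)]] by simp
    ultimately show "x \<in> double_coset (G w) (W w) \<one>\<^bsub>G w\<^esub> (Q w)"
      unfolding mem_double_coset using subgroup.one_closed[OF W[OF w(1)]] Q[OF w] by blast
  qed
  have mem: "x \<in> double_coset A (Pi\<^sub>E I W) (emb v \<gamma>) (Pi\<^sub>E I Q) \<longleftrightarrow> x v \<in> double_coset (G v) (W v) \<gamma> (Q v)"
    if "x \<in> Pi\<^sub>E I P" for x \<gamma>
  proof -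
    have "emb v \<gamma> \<in> extensional I" by (simp add: place_embedding_def)
    then have "x \<in> double_coset A (Pi\<^sub>E I W) (emb v \<gamma>) (Pi\<^sub>E I Q) \<longleftrightarrow>
        (\<forall>w\<in>I. x w \<in> double_coset (G w) (W w) (emb v \<gamma> w) (Q w))"
      using that by (simp add: double_coset_PiE PiE_iff)
    also have "\<dots> \<longleftrightarrow> x v \<in> double_coset (G v) (W v) \<gamma> (Q v)"
    proof
      assume "\<forall>w\<in>I. x w \<in> double_coset (G w) (W w) (emb v \<gamma> w) (Q w)"
      from bspec[OF this v] show "x v \<in> double_coset (G v) (W v) \<gamma> (Q v)" by (simp add: emb_apply v)
    next
      assume xv: "x v \<in> double_coset (G v) (W v) \<gamma> (Q v)"
      show "\<forall>w\<in>I. x w \<in> double_coset (G w) (W w) (emb v \<gamma> w) (Q w)"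
      proof
        fix w assume w: "w \<in> I"
        show "x w \<in> double_coset (G w) (W w) (emb v \<gamma> w) (Q w)"
          using xv other[OF w] that w by (cases "w = v") (auto simp: emb_apply v PiE_iff)
      qed
    qed
    finally show ?thesis .
  qed
  show ?thesis unfolding double_coset_reps_def
  proof (intro conjI ballI)
    show "emb v ` \<Gamma> \<subseteq> Pi\<^sub>E I P" using emb_mem_PiE[OF v _ P] \<Gamma>P by blast
    fix x assume x: "x \<in> Pi\<^sub>E I P"
    then have "x v \<in> P v" using v by auto
    from uniq[OF this] show "\<exists>!\<gamma>. \<gamma> \<in> emb v ` \<Gamma> \<and> x \<in> double_coset A (Pi\<^sub>E I W) \<gamma> (Pi\<^sub>E I Q)"
      using mem[OF x] by auto
  qed
qed

lemma inj_emb: "v \<in> I \<Longrightarrow> inj (emb v)"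
  by (auto simp: inj_def place_embedding_def fun_eq_iff)

end

section \<open>The Hecke action at one place\<close>

lemma linear_maps_compose:
  "\<lbrakk>f \<in> linear_maps R M N; h \<in> linear_maps R N P\<rbrakk> \<Longrightarrow> (\<lambda>x. h (f x)) \<in> linear_maps R M P"
  by (auto simp: linear_maps_def Pi_iff)

lemma linear_maps_finsum_smult:
  assumes "module R M" "module R N" "\<And>i. i \<in> X \<Longrightarrow> f i \<in> linear_maps R M N" "c \<in> X \<rightarrow> carrier R"
  shows "(\<lambda>x. \<Oplus>\<^bsub>N\<^esub>i\<in>X. c i \<odot>\<^bsub>N\<^esub> f i x) \<in> linear_maps R M N"
proof -
  interpret M: module R M by fact
  interpret N: module R N by fact
  note cl = linear_maps_closed[OF assms(3)]
  have add: "f i (x \<oplus>\<^bsub>M\<^esub> y) = f i x \<oplus>\<^bsub>N\<^esub> f i y" if "i \<in> X" "x \<in> carrier M" "y \<in> carrier M" for i x y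
    using assms(3)[OF that(1)] that(2,3) by (simp add: linear_maps_def)
  have c: "c i \<in> carrier R" if "i \<in> X" for i using assms(4) that by blast
  show ?thesis
  proof (cases "finite X")
    case True
    have "(\<Oplus>\<^bsub>N\<^esub>i\<in>X. c i \<odot>\<^bsub>N\<^esub> f i (x \<oplus>\<^bsub>M\<^esub> y)) =
        (\<Oplus>\<^bsub>N\<^esub>i\<in>X. c i \<odot>\<^bsub>N\<^esub> f i x) \<oplus>\<^bsub>N\<^esub> (\<Oplus>\<^bsub>N\<^esub>i\<in>X. c i \<odot>\<^bsub>N\<^esub> f i y)"
      if xy: "x \<in> carrier M" "y \<in> carrier M" for x y
    proof -
      have "(\<Oplus>\<^bsub>N\<^esub>i\<in>X. c i \<odot>\<^bsub>N\<^esub> f i (x \<oplus>\<^bsub>M\<^esub> y)) = (\<Oplus>\<^bsub>N\<^esub>i\<in>X. c i \<odot>\<^bsub>N\<^esub> f i x \<oplus>\<^bsub>N\<^esub> c i \<odot>\<^bsub>N\<^esub> f i y)"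
        using xy by (intro N.M.finsum_eq) (auto simp: add N.smult_r_distr c cl)
      also have "\<dots> = (\<Oplus>\<^bsub>N\<^esub>i\<in>X. c i \<odot>\<^bsub>N\<^esub> f i x) \<oplus>\<^bsub>N\<^esub> (\<Oplus>\<^bsub>N\<^esub>i\<in>X. c i \<odot>\<^bsub>N\<^esub> f i y)"
        using xy c cl by (intro N.M.add.finprod_multf) auto
      finally show ?thesis .
    qed
    moreover have "(\<Oplus>\<^bsub>N\<^esub>i\<in>X. c i \<odot>\<^bsub>N\<^esub> f i (a \<odot>\<^bsub>M\<^esub> x)) = a \<odot>\<^bsub>N\<^esub> (\<Oplus>\<^bsub>N\<^esub>i\<in>X. c i \<odot>\<^bsub>N\<^esub> f i x)"
      if ax: "a \<in> carrier R" "x \<in> carrier M" for a x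
    proof -
      have "a \<odot>\<^bsub>N\<^esub> (\<Oplus>\<^bsub>N\<^esub>i\<in>X. c i \<odot>\<^bsub>N\<^esub> f i x) = (\<Oplus>\<^bsub>N\<^esub>i\<in>X. a \<odot>\<^bsub>N\<^esub> (c i \<odot>\<^bsub>N\<^esub> f i x))"
        using ax c cl by (intro N.finsum_smult_ldistr True) auto
      also have "\<dots> = (\<Oplus>\<^bsub>N\<^esub>i\<in>X. c i \<odot>\<^bsub>N\<^esub> f i (a \<odot>\<^bsub>M\<^esub> x))"
        using ax c cl
        by (intro N.M.finsum_eq)
          (auto simp: linear_maps_smult[OF assms(3)] N.smult_assoc1[symmetric] M.R.m_comm)
      finally show ?thesis by simp
    qed
    ultimately show ?thesis
      using c cl by (auto simp: linear_maps_def intro!: N.M.finsum_closed)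
  qed (auto simp: linear_maps_def)
qed

text \<open>The index of a trace is a product of natural numbers, whereas weights are products in
  \<open>R\<close>; this allows them to be combined factor by factor.\<close>

lemma (in cring) finprod_nat:
  fixes f :: "'i \<Rightarrow> nat"
  shows "(\<Otimes>i\<in>X. [f i] \<cdot> \<one>) = [(\<Prod>i\<in>X. f i)] \<cdot> \<one>"
proof (induction X rule: infinite_finite_induct)
  case (insert i X)
  then have "(\<Otimes>i\<in>insert i X. [f i] \<cdot> \<one>) = [f i] \<cdot> \<one> \<otimes> [(\<Prod>i\<in>X. f i)] \<cdot> \<one>"
    using add.nat_pow_closed[OF one_closed] by (simp add: Pi_def)
  also have "\<dots> = [(f i * (\<Prod>i\<in>X. f i))] \<cdot> \<one>"
    using add.nat_pow_closed[OF one_closed]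
    by (simp add: add_pow_ldistr add.nat_pow_pow mult.commute)
  finally show ?case using insert by simp
qed simp_all

text \<open>Local and adelic data together. The quotients \<open>z\<close> are parameters of the
  locale, so that the classes at all levels are built from the same ones.\<close>

locale zeta_data =
  restricted_family I G K + trivial_pushforward R "restricted_product I G K" T \<Upsilon> B T' \<Upsilon>' M \<iota>
  for I :: "'i set" and G :: "'i \<Rightarrow> ('g, 'x) monoid_scheme" and K
    and R :: "'r ring" and T \<Upsilon> B T' \<Upsilon>' and M :: "('i \<Rightarrow> 'g, 'r, 'm) ric" and \<iota> +
  fixes \<tau> :: "'i \<Rightarrow> 'g topology" and H L S :: "'i \<Rightarrow> 'g set" and c :: "'i \<Rightarrow> 'g \<Rightarrow> 'r"
    and r :: "'i \<Rightarrow> nat" and g :: "'i \<Rightarrow> nat \<Rightarrow> 'g" and z :: "'i \<Rightarrow> nat \<Rightarrow> 'r"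
  assumes topological_factor: "v \<in> I \<Longrightarrow> topological_group (G v) (\<tau> v)"
    and compact_open_factor: "v \<in> I \<Longrightarrow> compact_open_subgroup (G v) (\<tau> v) (K v)"
    and subgroup_H: "v \<in> I \<Longrightarrow> subgroup (H v) (G v)"
    and subgroup_L: "v \<in> I \<Longrightarrow> subgroup (L v) (G v)"
    and L_subset: "v \<in> I \<Longrightarrow> L v \<subseteq> K v"
    and B_eq: "B = carrier (restricted_product I G K) \<inter> Pi\<^sub>E I H"
    and product_level: "\<lbrakk>finite \<nu>; \<nu> \<subseteq> I\<rbrakk> \<Longrightarrow> product_level I K L \<nu> \<in> \<Upsilon>"
    and S: "v \<in> I \<Longrightarrow> finite (S v)" "v \<in> I \<Longrightarrow> S v \<subseteq> carrier (G v)" "v \<in> I \<Longrightarrow> c v \<in> S v \<rightarrow> carrier R"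
    and inj_g: "v \<in> I \<Longrightarrow> inj_on (g v) {1..r v}"
    and g_reps: "v \<in> I \<Longrightarrow> double_coset_reps (G v) (H v)
      (H v <#>\<^bsub>G v\<^esub> hecke_support R (G v) (K v) (S v) (c v)) (K v) (g v ` {1..r v})"
    and z: "\<lbrakk>v \<in> I; i \<in> {1..r v}\<rbrakk> \<Longrightarrow> z v i \<in> carrier R"
    and degree: "\<lbrakk>v \<in> I; i \<in> {1..r v}\<rbrakk> \<Longrightarrow>
      hecke_degree R (G v\<lparr>carrier := H v\<rparr>) (H v \<inter> K v) (H v \<inter> conjugate (G v) (g v i) (K v))
        (\<lambda>h. hecke_function R (G v) (K v) (S v) (c v) (h \<otimes>\<^bsub>G v\<^esub> g v i)) =
      [index (G v) (H v \<inter> conjugate (G v) (g v i) (K v)) (H v \<inter> conjugate (G v) (g v i) (L v))] \<cdot>\<^bsub>R\<^esub> z v i"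
begin

lemma nat_one_closed: "[(n::nat)] \<cdot>\<^bsub>R\<^esub> \<one>\<^bsub>R\<^esub> \<in> carrier R"
proof -
  interpret R: cring R by (rule cring_R)
  show ?thesis by (rule R.add.nat_pow_closed) simp
qed

lemma g_closed:
  assumes "v \<in> I" "i \<in> {1..r v}"
  shows "g v i \<in> carrier (G v)"
proof -
  interpret group "G v" by (rule group_factor[OF assms(1)])
  have "H v <#>\<^bsub>G v\<^esub> hecke_support R (G v) (K v) (S v) (c v) \<subseteq> carrier (G v)"
    using subgroup.mem_carrier[OF subgroup_H[OF assms(1)]] by (auto simp: set_mult_def hecke_support_def)
  moreover have "g v i \<in> H v <#>\<^bsub>G v\<^esub> hecke_support R (G v) (K v) (S v) (c v)"
    using g_reps[OF assms(1)] assms(2) by (auto simp: double_coset_reps_def)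
  ultimately show ?thesis by blast
qed

text \<open>The finiteness condition in \<open>B\<close> holds automatically on the conjugate, which
  already lies in the restricted product. The intersection is therefore a plain product of local
  intersections.\<close>

lemma conjugate_PiE_Int_B:
  assumes "x \<in> carrier A" "\<And>w. w \<in> I \<Longrightarrow> J w \<subseteq> carrier (G w)" "Pi\<^sub>E I J \<in> \<Upsilon>"
  shows "conjugate A x (Pi\<^sub>E I J) \<inter> B = (\<Pi>\<^sub>E w\<in>I. conjugate (G w) (x w) (J w) \<inter> H w)"
proof -
  have "conjugate A x (Pi\<^sub>E I J) \<subseteq> carrier A"
    using A.conjugate_closed[OF assms(1) level_subset[OF assms(3)]] .
  then have "conjugate A x (Pi\<^sub>E I J) \<inter> B = conjugate A x (Pi\<^sub>E I J) \<inter> Pi\<^sub>E I H" by (auto simp: B_eq)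
  then show ?thesis by (simp add: conjugate_PiE[OF assms(1,2)] PiE_Int)
qed

text \<open>With a trivial at v and J equal to K_v there, the conjugate level aJa^-1 has component
  K_v at v. At the other places the correspondence is trivial, so double cosets and indices in the
  global expansion reduce to their components at v.\<close>

lemma hecke_push_zeta_emb:
  assumes J: "\<And>w. w \<in> I \<Longrightarrow> subgroup (J w) (G w)" "Pi\<^sub>E I J \<in> \<Upsilon>" "J v = K v"
    and v: "v \<in> I" and a: "a \<in> carrier A" "a v = \<one>\<^bsub>G v\<^esub>" and \<sigma>: "\<sigma> \<in> carrier (G v)"
    and \<Gamma>: "double_coset_reps (G v) (H v \<inter> K v) (K v) (K v \<inter> conjugate (G v) \<sigma> (K v)) \<Gamma>"
  shows "hecke_push M A (Pi\<^sub>E I J) (emb v \<sigma>) (Pi\<^sub>E I J) (zeta (Pi\<^sub>E I J) a) =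
    (\<Oplus>\<^bsub>val M (Pi\<^sub>E I J)\<^esub>\<gamma>\<in>\<Gamma>.
      ([index (G v) (conjugate (G v) (\<gamma> \<otimes>\<^bsub>G v\<^esub> \<sigma>) (K v) \<inter> H v)
        (conjugate (G v) (\<gamma> \<otimes>\<^bsub>G v\<^esub> \<sigma>) (K v) \<inter> K v \<inter> H v)] \<cdot>\<^bsub>R\<^esub> \<one>\<^bsub>R\<^esub>)
      \<odot>\<^bsub>val M (Pi\<^sub>E I J)\<^esub> zeta (Pi\<^sub>E I J) (emb v (\<gamma> \<otimes>\<^bsub>G v\<^esub> \<sigma>) \<otimes>\<^bsub>A\<^esub> a))"
proof -
  interpret E: module R "val M (Pi\<^sub>E I J)" by (rule M.val_module[OF J(2)])
  interpret Gv: group "G v" by (rule group_factor[OF v])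
  note Kv = subgroup_factor[OF v]
  have J_G: "J w \<subseteq> carrier (G w)" if "w \<in> I" for w using subgroup.subset[OF J(1)[OF that]] .
  have emb\<sigma>: "emb v \<sigma> \<in> carrier A" using emb_closed[OF v \<sigma>] .
  have conj_J: "conjugate A x (Pi\<^sub>E I J) = (\<Pi>\<^sub>E w\<in>I. conjugate (G w) (x w) (J w))"
    "conjugate A x (Pi\<^sub>E I J) \<inter> B = (\<Pi>\<^sub>E w\<in>I. conjugate (G w) (x w) (J w) \<inter> H w)" if "x \<in> carrier A" for x
    using conjugate_PiE[of x J] conjugate_PiE_Int_B[of x J] that J_G J(2) by auto
  \<comment> \<open>The embedded \<sigma> is 1 away from v, so intersecting J with its conjugate
    changes only the component at v.\<close>
  define Q where "Q w = (if w = v then K v \<inter> conjugate (G v) \<sigma> (K v) else J w)" for w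
  have Q_G: "Q w \<subseteq> carrier (G w)" if "w \<in> I" for w
    using J_G[OF that] subgroup.subset[OF Kv] by (auto simp: Q_def)
  have Q_eq: "Pi\<^sub>E I J \<inter> conjugate A (emb v \<sigma>) (Pi\<^sub>E I J) = Pi\<^sub>E I Q"
    unfolding conj_J(1)[OF emb\<sigma>] PiE_Int
  proof (rule PiE_cong)
    fix w assume w: "w \<in> I"
    show "J w \<inter> conjugate (G w) (emb v \<sigma> w) (J w) = Q w"
      using group.conjugate_one[OF group_factor[OF w] J_G[OF w]] J(3) v w by (auto simp: Q_def emb_apply)
  qed
  define P where "P w = conjugate (G w) (a w) (J w)" for w
  have Pv: "P v = K v" using Gv.conjugate_one subgroup.subset[OF Kv] by (simp add: P_def a J(3))
  have P_sub: "subgroup (P w) (G w)" if "w \<in> I" for w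
    unfolding P_def using group.subgroup_conjugate[OF group_factor component_closed[OF a(1)] J(1)] that by blast
  have P_eq: "conjugate A a (Pi\<^sub>E I J) = Pi\<^sub>E I P"
    unfolding conj_J(1)[OF a(1)] P_def ..
  have PB_eq: "conjugate A a (Pi\<^sub>E I J) \<inter> B = (\<Pi>\<^sub>E w\<in>I. P w \<inter> H w)"
    unfolding conj_J(2)[OF a(1)] P_def ..
  have conj_Q: "conjugate A a (Pi\<^sub>E I Q) = (\<Pi>\<^sub>E w\<in>I. conjugate (G w) (a w) (Q w))"
    using conjugate_PiE[of a Q] a(1) Q_G by auto
  have reps: "double_coset_reps A (conjugate A a (Pi\<^sub>E I J) \<inter> B) (conjugate A a (Pi\<^sub>E I J))
      (conjugate A a (Pi\<^sub>E I J \<inter> conjugate A (emb v \<sigma>) (Pi\<^sub>E I J))) (emb v ` \<Gamma>)"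
    unfolding Q_eq PB_eq conj_Q unfolding P_eq
  proof (rule double_coset_reps_PiE[OF v _ P_sub])
    show "subgroup (P w \<inter> H w) (G w)" if "w \<in> I" for w
      using group.subgroups_Inter_pair[OF group_factor P_sub subgroup_H] that by blast
    show "conjugate (G w) (a w) (Q w) = P w" if "w \<noteq> v" for w
      using that by (simp add: Q_def P_def)
    have "conjugate (G v) (a v) (Q v) = K v \<inter> conjugate (G v) \<sigma> (K v)"
      using Gv.conjugate_one Q_G[OF v] by (simp add: a Q_def)
    then show "double_coset_reps (G v) (P v \<inter> H v) (P v) (conjugate (G v) (a v) (Q v)) \<Gamma>"
      using \<Gamma> by (simp add: Pv Int_commute)
  qed auto
  have \<Gamma>G: "\<gamma> \<in> carrier (G v)" if "\<gamma> \<in> \<Gamma>" for \<gamma>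
    using \<Gamma> that subgroup.mem_carrier[OF Kv] by (auto simp: double_coset_reps_def)
  define x where "x \<gamma> = emb v (\<gamma> \<otimes>\<^bsub>G v\<^esub> \<sigma>) \<otimes>\<^bsub>A\<^esub> a" for \<gamma>
  have x: "x \<gamma> \<in> carrier A" "x \<gamma> = emb v \<gamma> \<otimes>\<^bsub>A\<^esub> a \<otimes>\<^bsub>A\<^esub> emb v \<sigma>"
    "x \<gamma> v = \<gamma> \<otimes>\<^bsub>G v\<^esub> \<sigma>" "\<And>w. w \<in> I \<Longrightarrow> w \<noteq> v \<Longrightarrow> x \<gamma> w = a w" if "\<gamma> \<in> \<Gamma>" for \<gamma>
  proof -
    note \<gamma>G = \<Gamma>G[OF that]
    show "x \<gamma> \<in> carrier A" unfolding x_def using a emb_closed[OF v] \<gamma>G \<sigma> by simp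
    show "x \<gamma> = emb v \<gamma> \<otimes>\<^bsub>A\<^esub> a \<otimes>\<^bsub>A\<^esub> emb v \<sigma>"
      using emb_closed[OF v] \<gamma>G \<sigma> a(1)
      by (simp add: x_def emb_mult[OF v] A.m_assoc emb_commute[OF v a \<sigma>])
    show "x \<gamma> v = \<gamma> \<otimes>\<^bsub>G v\<^esub> \<sigma>" using v a \<gamma>G \<sigma> by (simp add: x_def mult_A emb_apply)
    show "x \<gamma> w = a w" if "w \<in> I" "w \<noteq> v" for w
      using v that monoid.l_one[OF group.is_monoid[OF group_factor[OF that(1)]] component_closed[OF a(1) that(1)]]
      by (simp add: x_def mult_A emb_apply)
  qed
  \<comment> \<open>Away from v the elements \<open>x \<gamma>\<close> and a agree, so the two
    groups coincide there and contribute 1 to the index.\<close>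
  have idx: "index A (conjugate A (x \<gamma>) (Pi\<^sub>E I J) \<inter> B) (conjugate A (x \<gamma>) (Pi\<^sub>E I J) \<inter> conjugate A a (Pi\<^sub>E I J) \<inter> B) =
      index (G v) (conjugate (G v) (\<gamma> \<otimes>\<^bsub>G v\<^esub> \<sigma>) (K v) \<inter> H v)
        (conjugate (G v) (\<gamma> \<otimes>\<^bsub>G v\<^esub> \<sigma>) (K v) \<inter> K v \<inter> H v)" if \<gamma>: "\<gamma> \<in> \<Gamma>" for \<gamma>
  proof -
    define C where "C w = conjugate (G w) (x \<gamma> w) (J w)" for w
    have C_sub: "subgroup (C w) (G w)" if "w \<in> I" for w
      unfolding C_def using group.subgroup_conjugate[OF group_factor component_closed[OF x(1)[OF \<gamma>]] J(1)] that by blast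
    have C_eq: "conjugate A (x \<gamma>) (Pi\<^sub>E I J) = Pi\<^sub>E I C" "conjugate A (x \<gamma>) (Pi\<^sub>E I J) \<inter> B = (\<Pi>\<^sub>E w\<in>I. C w \<inter> H w)"
      unfolding C_def using conj_J[OF x(1)[OF \<gamma>]] by auto
    have "conjugate A (x \<gamma>) (Pi\<^sub>E I J) \<inter> conjugate A a (Pi\<^sub>E I J) \<inter> B =
        Pi\<^sub>E I C \<inter> (\<Pi>\<^sub>E w\<in>I. P w \<inter> H w)"
      unfolding C_eq(1)[symmetric] PB_eq[symmetric] by blast
    then have CP_eq: "conjugate A (x \<gamma>) (Pi\<^sub>E I J) \<inter> conjugate A a (Pi\<^sub>E I J) \<inter> B = (\<Pi>\<^sub>E w\<in>I. C w \<inter> P w \<inter> H w)"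
      by (simp add: PiE_Int Int_assoc)
    have "index A (\<Pi>\<^sub>E w\<in>I. C w \<inter> H w) (\<Pi>\<^sub>E w\<in>I. C w \<inter> P w \<inter> H w) =
        (\<Prod>w\<in>{v}. index (G w) (C w \<inter> H w) (C w \<inter> P w \<inter> H w))"
    proof (rule index_PiE)
      fix w assume w: "w \<in> I"
      interpret group "G w" by (rule group_factor[OF w])
      show "subgroup (C w \<inter> H w) (G w)" "subgroup (C w \<inter> P w \<inter> H w) (G w)"
        using subgroups_Inter_pair C_sub[OF w] P_sub[OF w] subgroup_H[OF w] by auto
    next
      fix w assume w: "w \<in> I - {v}"
      then have "C w = P w" using x(4)[OF \<gamma>] by (simp add: C_def P_def)
      then show "C w \<inter> P w \<inter> H w = C w \<inter> H w" by simp
    qed (use v in auto)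
    then show ?thesis unfolding CP_eq C_eq(2) by (simp add: Pv C_def x(3)[OF \<gamma>] J(3))
  qed
  define f where "f y = ([index A (conjugate A (y \<otimes>\<^bsub>A\<^esub> a \<otimes>\<^bsub>A\<^esub> emb v \<sigma>) (Pi\<^sub>E I J) \<inter> B)
      (conjugate A (y \<otimes>\<^bsub>A\<^esub> a \<otimes>\<^bsub>A\<^esub> emb v \<sigma>) (Pi\<^sub>E I J) \<inter> conjugate A a (Pi\<^sub>E I J) \<inter> B)] \<cdot>\<^bsub>R\<^esub> \<one>\<^bsub>R\<^esub>)
    \<odot>\<^bsub>val M (Pi\<^sub>E I J)\<^esub> zeta (Pi\<^sub>E I J) (y \<otimes>\<^bsub>A\<^esub> a \<otimes>\<^bsub>A\<^esub> emb v \<sigma>)" for y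
  have f_eq: "f (emb v \<gamma>) = ([index (G v) (conjugate (G v) (\<gamma> \<otimes>\<^bsub>G v\<^esub> \<sigma>) (K v) \<inter> H v)
        (conjugate (G v) (\<gamma> \<otimes>\<^bsub>G v\<^esub> \<sigma>) (K v) \<inter> K v \<inter> H v)] \<cdot>\<^bsub>R\<^esub> \<one>\<^bsub>R\<^esub>)
      \<odot>\<^bsub>val M (Pi\<^sub>E I J)\<^esub> zeta (Pi\<^sub>E I J) (x \<gamma>)" if "\<gamma> \<in> \<Gamma>" for \<gamma>
    unfolding f_def x(2)[OF that, symmetric] idx[OF that] ..
  have f_cl: "f (emb v \<gamma>) \<in> carrier (val M (Pi\<^sub>E I J))" if "\<gamma> \<in> \<Gamma>" for \<gamma>
    unfolding f_eq[OF that] using nat_one_closed zeta_closed[OF J(2) x(1)[OF that]] by (rule E.smult_closed)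
  have "hecke_push M A (Pi\<^sub>E I J) (emb v \<sigma>) (Pi\<^sub>E I J) (zeta (Pi\<^sub>E I J) a) =
      (\<Oplus>\<^bsub>val M (Pi\<^sub>E I J)\<^esub>y\<in>emb v ` \<Gamma>. f y)"
    unfolding f_def by (rule hecke_push_zeta[OF J(2) emb\<sigma> a(1) reps])
  also have "\<dots> = (\<Oplus>\<^bsub>val M (Pi\<^sub>E I J)\<^esub>\<gamma>\<in>\<Gamma>. f (emb v \<gamma>))"
    using f_cl inj_emb[OF v] by (intro E.M.add.finprod_reindex) (auto intro: inj_on_subset)
  also have "\<dots> = (\<Oplus>\<^bsub>val M (Pi\<^sub>E I J)\<^esub>\<gamma>\<in>\<Gamma>.
      ([index (G v) (conjugate (G v) (\<gamma> \<otimes>\<^bsub>G v\<^esub> \<sigma>) (K v) \<inter> H v)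
        (conjugate (G v) (\<gamma> \<otimes>\<^bsub>G v\<^esub> \<sigma>) (K v) \<inter> K v \<inter> H v)] \<cdot>\<^bsub>R\<^esub> \<one>\<^bsub>R\<^esub>)
      \<odot>\<^bsub>val M (Pi\<^sub>E I J)\<^esub> zeta (Pi\<^sub>E I J) (x \<gamma>))"
    using f_cl f_eq by (intro E.M.finsum_eq) auto
  finally show ?thesis unfolding x_def .
qed

definition hecke_deg :: "'i \<Rightarrow> nat \<Rightarrow> 'r" where
  "hecke_deg v i = hecke_degree R (G v\<lparr>carrier := H v\<rparr>) (H v \<inter> K v) (H v \<inter> conjugate (G v) (g v i) (K v))
    (\<lambda>h. hecke_function R (G v) (K v) (S v) (c v) (h \<otimes>\<^bsub>G v\<^esub> g v i))"

text \<open>The local sum formula applies to the map that sends y to the zeta class of y, placed at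
  v, times a. It is left invariant under H_v because zeta classes are left invariant under
  \<open>B\<close>. It is right invariant under K_v because an element k of K_v placed at v commutes
  with a and lies in the level.\<close>

lemma place_operator_zeta:
  assumes J: "\<And>w. w \<in> I \<Longrightarrow> subgroup (J w) (G w)" "Pi\<^sub>E I J \<in> \<Upsilon>" "J v = K v"
    and v: "v \<in> I" and a: "a \<in> carrier A" "a v = \<one>\<^bsub>G v\<^esub>"
  shows "place_operator I G K M S c (Pi\<^sub>E I J) v (zeta (Pi\<^sub>E I J) a) =
    (\<Oplus>\<^bsub>val M (Pi\<^sub>E I J)\<^esub>i\<in>{1..r v}. hecke_deg v i \<odot>\<^bsub>val M (Pi\<^sub>E I J)\<^esub> zeta (Pi\<^sub>E I J) (emb v (g v i) \<otimes>\<^bsub>A\<^esub> a))"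
proof -
  let ?E = "val M (Pi\<^sub>E I J)"
  interpret E: module R ?E by (rule M.val_module[OF J(2)])
  interpret Gv: group "G v" by (rule group_factor[OF v])
  note Kv = subgroup_factor[OF v] and Hv = subgroup_H[OF v]
  have S_G: "\<sigma> \<in> carrier (G v)" if "\<sigma> \<in> S v" for \<sigma> using S(2)[OF v] that by blast
  have Q: "subgroup (K v \<inter> conjugate (G v) \<sigma> (K v)) (G v)" if "\<sigma> \<in> S v" for \<sigma>
    using Gv.subgroups_Inter_pair[OF Kv Gv.subgroup_conjugate[OF S_G[OF that] Kv]] .
  have U: "subgroup (H v \<inter> K v) (G v)" using Gv.subgroups_Inter_pair[OF Hv Kv] .
  have "\<exists>\<Gamma>. double_coset_reps (G v) (H v \<inter> K v) (K v) (K v \<inter> conjugate (G v) \<sigma> (K v)) \<Gamma>" if "\<sigma> \<in> S v" for \<sigma>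
    using Gv.ex_double_coset_reps[OF U Q[OF that] Kv] by blast
  then obtain \<Gamma> where \<Gamma>: "\<And>\<sigma>. \<sigma> \<in> S v \<Longrightarrow>
      double_coset_reps (G v) (H v \<inter> K v) (K v) (K v \<inter> conjugate (G v) \<sigma> (K v)) (\<Gamma> \<sigma>)" by metis
  have K_top: "compactin (\<tau> v) (K v)" "openin (\<tau> v) (K v)"
    using compact_open_factor[OF v] by (auto simp: compact_open_subgroup_def)
  have fin: "finite (\<Gamma> \<sigma>)" if "\<sigma> \<in> S v" for \<sigma>
    using Gv.finite_double_coset_reps[OF topological_factor[OF v] Kv K_top(1) Q[OF that] _ U \<Gamma>[OF that]]
      openin_Int[OF K_top(2) Gv.openin_conjugate[OF topological_factor[OF v] S_G[OF that] K_top(2)]] by blast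
  have B_emb: "emb v h \<in> B" if "h \<in> H v" for h
    unfolding B_eq using emb_closed[OF v] emb_mem_PiE[of v h H, OF v that subgroup_H] subgroup.mem_carrier[OF Hv that] by blast
  have K_emb: "emb v k \<in> Pi\<^sub>E I J" if "k \<in> K v" for k
    using emb_mem_PiE[of v k J, OF v _ J(1)] that J(3) by simp
  define \<Xi> where "\<Xi> y = zeta (Pi\<^sub>E I J) (emb v y \<otimes>\<^bsub>A\<^esub> a)" for y
  have eG: "emb v y \<in> carrier A" if "y \<in> carrier (G v)" for y using emb_closed[OF v that] .
  have \<Xi>: "\<Xi> y \<in> carrier ?E" if "y \<in> carrier (G v)" for y
    unfolding \<Xi>_def using zeta_closed[OF J(2)] eG[OF that] a by simp
  have \<Xi>_left: "\<Xi> (h \<otimes>\<^bsub>G v\<^esub> y) = \<Xi> y" if h: "h \<in> H v" and y: "y \<in> carrier (G v)" for h y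
    using zeta_left_invariant[OF J(2) _ B_emb[OF h], of "emb v y \<otimes>\<^bsub>A\<^esub> a"] eG[OF y] a
      eG[OF subgroup.mem_carrier[OF Hv h]] by (simp add: \<Xi>_def emb_mult[OF v] A.m_assoc)
  have \<Xi>_right: "\<Xi> (y \<otimes>\<^bsub>G v\<^esub> k) = \<Xi> y" if y: "y \<in> carrier (G v)" and k: "k \<in> K v" for y k
  proof -
    have kG: "k \<in> carrier (G v)" using subgroup.mem_carrier[OF Kv k] .
    have "emb v (y \<otimes>\<^bsub>G v\<^esub> k) \<otimes>\<^bsub>A\<^esub> a = (emb v y \<otimes>\<^bsub>A\<^esub> a) \<otimes>\<^bsub>A\<^esub> emb v k"
      using eG[OF y] eG[OF kG] a(1) by (simp add: emb_mult[OF v] A.m_assoc emb_commute[OF v a kG])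
    then show ?thesis
      using zeta_right_invariant[OF J(2) _ K_emb[OF k], of "emb v y \<otimes>\<^bsub>A\<^esub> a"] eG[OF y] a(1) by (simp add: \<Xi>_def)
  qed
  let ?n = "\<lambda>y. [index (G v) (conjugate (G v) y (K v) \<inter> H v) (conjugate (G v) y (K v) \<inter> K v \<inter> H v)] \<cdot>\<^bsub>R\<^esub> \<one>\<^bsub>R\<^esub>"
  have "place_operator I G K M S c (Pi\<^sub>E I J) v (zeta (Pi\<^sub>E I J) a) =
      (\<Oplus>\<^bsub>?E\<^esub>\<sigma>\<in>S v. c v \<sigma> \<odot>\<^bsub>?E\<^esub> (\<Oplus>\<^bsub>?E\<^esub>\<gamma>\<in>\<Gamma> \<sigma>. ?n (\<gamma> \<otimes>\<^bsub>G v\<^esub> \<sigma>) \<odot>\<^bsub>?E\<^esub> \<Xi> (\<gamma> \<otimes>\<^bsub>G v\<^esub> \<sigma>)))"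
    unfolding place_operator_def
  proof (rule E.M.finsum_eq[OF refl])
    have \<Gamma>G: "\<gamma> \<in> carrier (G v)" if "\<sigma> \<in> S v" "\<gamma> \<in> \<Gamma> \<sigma>" for \<sigma> \<gamma>
      using \<Gamma>[OF that(1)] that(2) subgroup.mem_carrier[OF Kv] by (auto simp: double_coset_reps_def)
    show "(\<lambda>\<sigma>. c v \<sigma> \<odot>\<^bsub>?E\<^esub> (\<Oplus>\<^bsub>?E\<^esub>\<gamma>\<in>\<Gamma> \<sigma>. ?n (\<gamma> \<otimes>\<^bsub>G v\<^esub> \<sigma>) \<odot>\<^bsub>?E\<^esub> \<Xi> (\<gamma> \<otimes>\<^bsub>G v\<^esub> \<sigma>))) \<in> S v \<rightarrow> carrier ?E"
      using S(3)[OF v] \<Xi> S_G nat_one_closed \<Gamma>G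
      by (auto intro!: E.smult_closed E.M.finsum_closed)
  qed (simp add: hecke_push_zeta_emb[OF J v a S_G \<Gamma>] \<Xi>_def)
  also have "\<dots> = (\<Oplus>\<^bsub>?E\<^esub>i\<in>{1..r v}. hecke_deg v i \<odot>\<^bsub>?E\<^esub> \<Xi> (g v i))"
    unfolding hecke_deg_def
    by (rule Gv.sum_hecke_double_cosets[OF Hv Kv S(1)[OF v] S(2)[OF v] S(3)[OF v] E.module_axioms \<Xi> \<Xi>_left \<Xi>_right
      fin \<Gamma> _ inj_g[OF v] g_reps[OF v]]) auto
  finally show ?thesis by (simp add: \<Xi>_def)
qed

end

section \<open>The norm relations\<close>

context zeta_data
begin

abbreviation "lev \<equiv> product_level I K L"

lemma lev_eq: "lev \<nu> = (\<Pi>\<^sub>E w\<in>I. if w \<in> \<nu> then L w else K w)"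
  by (simp add: product_level_def)

lemma lev_mono: "\<nu> \<subseteq> \<mu> \<Longrightarrow> lev \<mu> \<subseteq> lev \<nu>"
  unfolding lev_eq using L_subset by (intro PiE_mono) auto

definition rep :: "'i set \<Rightarrow> ('i \<Rightarrow> nat) \<Rightarrow> 'i \<Rightarrow> 'g" where
  "rep \<mu> \<alpha> = (\<lambda>w\<in>I. if w \<in> \<mu> then g w (\<alpha> w) else \<one>\<^bsub>G w\<^esub>)"

abbreviation choices :: "'i set \<Rightarrow> ('i \<Rightarrow> nat) set" where
  "choices \<mu> \<equiv> \<Pi>\<^sub>E w\<in>\<mu>. {1..r w}"

text \<open>Places in \<nu> are those where the level has already been lowered to L: they carry the
  quotient z. The remaining places of \<mu> carry the full degree d z.\<close>

definition weight :: "'i set \<Rightarrow> 'i set \<Rightarrow> ('i \<Rightarrow> nat) \<Rightarrow> 'r" where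
  "weight \<nu> \<mu> \<alpha> = (\<Otimes>\<^bsub>R\<^esub>w\<in>\<mu>. if w \<in> \<nu> then z w (\<alpha> w) else hecke_deg w (\<alpha> w))"

text \<open>\<open>zeta_sum \<nu> \<mu>\<close> lives at level \<open>K[\<nu>]\<close>. It is the class \<open>y\<^sub>\<nu>\<close> when \<open>\<mu> = \<nu>\<close>, and in general both
  the image of \<open>y\<^sub>\<mu>\<close> under the trace and the result of applying the Hecke operators at \<open>\<mu> - \<nu>\<close>
  to \<open>y\<^sub>\<nu>\<close>.\<close>

definition zeta_sum :: "'i set \<Rightarrow> 'i set \<Rightarrow> 'm" where
  "zeta_sum \<nu> \<mu> = (\<Oplus>\<^bsub>val M (lev \<nu>)\<^esub>\<alpha>\<in>choices \<mu>. weight \<nu> \<mu> \<alpha> \<odot>\<^bsub>val M (lev \<nu>)\<^esub> zeta (lev \<nu>) (rep \<mu> \<alpha>))"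

lemma finite_choices: "finite \<mu> \<Longrightarrow> finite (choices \<mu>)"
  by (rule finite_PiE) auto

lemma rep_closed:
  assumes "finite \<mu>" "\<mu> \<subseteq> I" "\<alpha> \<in> choices \<mu>"
  shows "rep \<mu> \<alpha> \<in> carrier A"
proof -
  have "{w \<in> I. rep \<mu> \<alpha> w \<notin> K w} \<subseteq> \<mu>"
    using subgroup.one_closed[OF subgroup_factor] by (auto simp: rep_def)
  then have "finite {w \<in> I. rep \<mu> \<alpha> w \<notin> K w}" using assms(1) by (rule finite_subset)
  moreover have "rep \<mu> \<alpha> \<in> (\<Pi>\<^sub>E w\<in>I. carrier (G w))"
    using g_closed assms(3) monoid.one_closed[OF group.is_monoid[OF group_factor]]
    by (auto simp: rep_def PiE_iff)
  ultimately show ?thesis by (simp add: carrier_A)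
qed

lemma hecke_deg_eq:
  assumes "v \<in> I" "i \<in> {1..r v}"
  shows "hecke_deg v i = [index (G v) (H v \<inter> conjugate (G v) (g v i) (K v))
    (H v \<inter> conjugate (G v) (g v i) (L v))] \<cdot>\<^bsub>R\<^esub> z v i"
  using degree[OF assms] by (simp add: hecke_deg_def)

lemma hecke_deg_closed: "\<lbrakk>v \<in> I; i \<in> {1..r v}\<rbrakk> \<Longrightarrow> hecke_deg v i \<in> carrier R"
proof -
  interpret R: cring R by (rule cring_R)
  show "\<lbrakk>v \<in> I; i \<in> {1..r v}\<rbrakk> \<Longrightarrow> hecke_deg v i \<in> carrier R"
    unfolding hecke_deg_eq using z R.add.nat_pow_closed by blast
qed

lemma weight_factor_closed:
  "\<lbrakk>\<mu> \<subseteq> I; \<alpha> \<in> choices \<mu>\<rbrakk> \<Longrightarrow> (\<lambda>w. if w \<in> \<nu> then z w (\<alpha> w) else hecke_deg w (\<alpha> w)) \<in> \<mu> \<rightarrow> carrier R"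
  using z hecke_deg_closed by (auto simp: PiE_iff)

lemma weight_closed:
  assumes "\<mu> \<subseteq> I" "\<alpha> \<in> choices \<mu>"
  shows "weight \<nu> \<mu> \<alpha> \<in> carrier R"
proof -
  interpret R: cring R by (rule cring_R)
  show ?thesis unfolding weight_def by (rule R.finprod_closed[OF weight_factor_closed[OF assms]])
qed

lemma zeta_sum_summand_closed:
  assumes "finite \<nu>" "\<nu> \<subseteq> I" "finite \<mu>" "\<mu> \<subseteq> I" "\<alpha> \<in> choices \<mu>"
  shows "zeta (lev \<nu>) (rep \<mu> \<alpha>) \<in> carrier (val M (lev \<nu>))"
    "weight \<nu> \<mu> \<alpha> \<odot>\<^bsub>val M (lev \<nu>)\<^esub> zeta (lev \<nu>) (rep \<mu> \<alpha>) \<in> carrier (val M (lev \<nu>))"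
proof -
  interpret E: module R "val M (lev \<nu>)" by (rule M.val_module[OF product_level[OF assms(1,2)]])
  show "zeta (lev \<nu>) (rep \<mu> \<alpha>) \<in> carrier (val M (lev \<nu>))"
    using zeta_closed[OF product_level[OF assms(1,2)] rep_closed[OF assms(3-5)]] .
  then show "weight \<nu> \<mu> \<alpha> \<odot>\<^bsub>val M (lev \<nu>)\<^esub> zeta (lev \<nu>) (rep \<mu> \<alpha>) \<in> carrier (val M (lev \<nu>))"
    using weight_closed[OF assms(4,5)] by simp
qed

lemma zeta_sum_closed:
  assumes "finite \<nu>" "\<nu> \<subseteq> I" "finite \<mu>" "\<mu> \<subseteq> I"
  shows "zeta_sum \<nu> \<mu> \<in> carrier (val M (lev \<nu>))"
proof -
  interpret E: module R "val M (lev \<nu>)" by (rule M.val_module[OF product_level[OF assms(1,2)]])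
  show ?thesis unfolding zeta_sum_def
    using zeta_sum_summand_closed[OF assms] by (intro E.M.finsum_closed) blast
qed

lemma hecke_push_linear:
  assumes "J \<in> \<Upsilon>" "\<sigma> \<in> carrier A"
  shows "hecke_push M A J \<sigma> J \<in> linear_maps R (val M J) (val M J)"
proof -
  define Q Q' where "Q = J \<inter> conjugate A \<sigma> J" and "Q' = J \<inter> conjugate A (inv\<^bsub>A\<^esub> \<sigma>) J"
  have Q: "Q \<in> \<Upsilon>" "Q' \<in> \<Upsilon>" "Q \<subseteq> J" "Q' \<subseteq> J" using G.T1 G.T3 assms by (auto simp: Q_def Q'_def)
  have J: "J \<subseteq> carrier A" using level_subset[OF assms(1)] .
  have "conjugate A \<sigma> Q' \<subseteq> Q"
    using A.conjugate_Int[of \<sigma> J "conjugate A (inv\<^bsub>A\<^esub> \<sigma>) J"] A.conjugate_cancel_inv A.conjugate_closed assms J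
    by (auto simp: Q_def Q'_def)
  then have "inv\<^bsub>A\<^esub> \<sigma> \<in> level_hom A Q' Q" using assms(2) by (simp add: level_hom_def)
  then have "(\<lambda>x. push M Q' J \<one>\<^bsub>A\<^esub> (pull M Q' Q (inv\<^bsub>A\<^esub> \<sigma>) (pull M Q J \<one>\<^bsub>A\<^esub> x))) \<in> linear_maps R (val M J) (val M J)"
    using Q assms(1) level_hom_one
    by (intro linear_maps_compose[OF _ M.push_linear] linear_maps_compose[OF M.pull_linear M.pull_linear]) auto
  moreover have "hecke_push M A J \<sigma> J = (\<lambda>x. push M Q' J \<one>\<^bsub>A\<^esub> (pull M Q' Q (inv\<^bsub>A\<^esub> \<sigma>) (pull M Q J \<one>\<^bsub>A\<^esub> x)))"
    using assms(2) by (simp add: fun_eq_iff hecke_push_def hecke_def Q_def Q'_def)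
  ultimately show ?thesis by simp
qed

lemma place_operator_linear:
  assumes "J \<in> \<Upsilon>" "v \<in> I"
  shows "place_operator I G K M S c J v \<in> linear_maps R (val M J) (val M J)"
  unfolding place_operator_def
  using S(2,3)[OF assms(2)] emb_closed[OF assms(2)] hecke_push_linear[OF assms(1)]
  by (intro linear_maps_finsum_smult M.val_module assms) auto

text \<open>Because v is not in \<mu>, hence not in \<nu>, each \<open>rep \<mu> \<alpha>\<close> is
  trivial at v and the level is K_v there, as the one-place formula requires. That formula extends
  the choice \<alpha> by every index i at v, with the degree at i as new factor of the
  weight.\<close>

lemma place_operator_zeta_sum:
  assumes \<mu>: "finite \<mu>" "\<mu> \<subseteq> I" "\<nu> \<subseteq> \<mu>" and v: "v \<in> I" "v \<notin> \<mu>"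
  shows "place_operator I G K M S c (lev \<nu>) v (zeta_sum \<nu> \<mu>) = zeta_sum \<nu> (insert v \<mu>)"
proof -
  have \<nu>: "finite \<nu>" "\<nu> \<subseteq> I" "v \<notin> \<nu>" using \<mu> v finite_subset by blast+
  have \<mu>': "finite (insert v \<mu>)" "insert v \<mu> \<subseteq> I" using \<mu> v by auto
  note lev = product_level[OF \<nu>(1,2)]
  let ?E = "val M (lev \<nu>)"
  interpret E: module R ?E by (rule M.val_module[OF lev])
  define J where "J w = (if w \<in> \<nu> then L w else K w)" for w
  have J: "\<And>w. w \<in> I \<Longrightarrow> subgroup (J w) (G w)" "lev \<nu> = Pi\<^sub>E I J" "J v = K v"
    using subgroup_L subgroup_factor \<nu>(3) by (auto simp: J_def lev_eq)
  define f where "f \<beta> = weight \<nu> (insert v \<mu>) \<beta> \<odot>\<^bsub>?E\<^esub> zeta (lev \<nu>) (rep (insert v \<mu>) \<beta>)" for \<beta>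
  have f: "f \<beta> \<in> carrier ?E" if "\<beta> \<in> choices (insert v \<mu>)" for \<beta>
    unfolding f_def using zeta_sum_summand_closed[OF \<nu>(1,2) \<mu>' that] by simp
  have upd: "\<alpha>(v := i) \<in> choices (insert v \<mu>)" if "\<alpha> \<in> choices \<mu>" "i \<in> {1..r v}" for \<alpha> i
    using that by (auto simp: PiE_iff extensional_def)
  have summand: "weight \<nu> \<mu> \<alpha> \<odot>\<^bsub>?E\<^esub> place_operator I G K M S c (lev \<nu>) v (zeta (lev \<nu>) (rep \<mu> \<alpha>)) =
      (\<Oplus>\<^bsub>?E\<^esub>\<beta>\<in>(\<lambda>i. \<alpha>(v := i)) ` {1..r v}. f \<beta>)" if \<alpha>: "\<alpha> \<in> choices \<mu>" for \<alpha>
  proof -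
    note rep = rep_closed[OF \<mu>(1,2) \<alpha>]
    have rep_v: "rep \<mu> \<alpha> v = \<one>\<^bsub>G v\<^esub>" using v by (simp add: rep_def)
    have rep_upd: "emb v (g v i) \<otimes>\<^bsub>A\<^esub> rep \<mu> \<alpha> = rep (insert v \<mu>) (\<alpha>(v := i))" if i: "i \<in> {1..r v}" for i
    proof
      fix w
      show "(emb v (g v i) \<otimes>\<^bsub>A\<^esub> rep \<mu> \<alpha>) w = rep (insert v \<mu>) (\<alpha>(v := i)) w"
      proof (cases "w \<in> I")
        case w: True
        interpret group "G w" by (rule group_factor[OF w])
        show ?thesis using w v g_closed[OF v(1) i] component_closed[OF rep w] rep_v
            monoid.r_one[OF group.is_monoid[OF group_factor[OF v(1)]]]
          by (cases "w = v") (auto simp: mult_A emb_apply, auto simp: rep_def)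
      qed (simp add: mult_A rep_def)
    qed
    have weight_upd: "weight \<nu> (insert v \<mu>) (\<alpha>(v := i)) = weight \<nu> \<mu> \<alpha> \<otimes>\<^bsub>R\<^esub> hecke_deg v i" if i: "i \<in> {1..r v}" for i
    proof -
      have "weight \<nu> (insert v \<mu>) (\<alpha>(v := i)) = hecke_deg v i \<otimes>\<^bsub>R\<^esub>
          (\<Otimes>\<^bsub>R\<^esub>w\<in>\<mu>. if w \<in> \<nu> then z w ((\<alpha>(v := i)) w) else hecke_deg w ((\<alpha>(v := i)) w))"
        unfolding weight_def
        using E.R.finprod_insert[OF \<mu>(1) v(2), of "\<lambda>w. if w \<in> \<nu> then z w ((\<alpha>(v := i)) w) else hecke_deg w ((\<alpha>(v := i)) w)"]
          weight_factor_closed[OF \<mu>'(2) upd[OF \<alpha> i], of \<nu>] \<nu>(3) hecke_deg_closed[OF v(1) i] by simp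
      also have "(\<Otimes>\<^bsub>R\<^esub>w\<in>\<mu>. if w \<in> \<nu> then z w ((\<alpha>(v := i)) w) else hecke_deg w ((\<alpha>(v := i)) w)) = weight \<nu> \<mu> \<alpha>"
        unfolding weight_def
        by (rule E.R.finprod_cong'[OF refl weight_factor_closed[OF \<mu>(2) \<alpha>]]) (use v in auto)
      also have "hecke_deg v i \<otimes>\<^bsub>R\<^esub> weight \<nu> \<mu> \<alpha> = weight \<nu> \<mu> \<alpha> \<otimes>\<^bsub>R\<^esub> hecke_deg v i"
        by (rule E.R.m_comm[OF hecke_deg_closed[OF v(1) i] weight_closed[OF \<mu>(2) \<alpha>]])
      finally show ?thesis .
    qed
    have zeta_cl: "zeta (lev \<nu>) (rep (insert v \<mu>) (\<alpha>(v := i))) \<in> carrier ?E" if "i \<in> {1..r v}" for i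
      using zeta_sum_summand_closed(1)[OF \<nu>(1,2) \<mu>' upd[OF \<alpha> that]] .
    have "place_operator I G K M S c (lev \<nu>) v (zeta (lev \<nu>) (rep \<mu> \<alpha>)) =
        (\<Oplus>\<^bsub>?E\<^esub>i\<in>{1..r v}. hecke_deg v i \<odot>\<^bsub>?E\<^esub> zeta (lev \<nu>) (emb v (g v i) \<otimes>\<^bsub>A\<^esub> rep \<mu> \<alpha>))"
      unfolding J(2) by (rule place_operator_zeta[OF J(1) lev[unfolded J(2)] J(3) v(1) rep rep_v])
    also have "\<dots> = (\<Oplus>\<^bsub>?E\<^esub>i\<in>{1..r v}. hecke_deg v i \<odot>\<^bsub>?E\<^esub> zeta (lev \<nu>) (rep (insert v \<mu>) (\<alpha>(v := i))))"
      by (intro E.M.finsum_eq refl Pi_I) (simp_all only: rep_upd E.smult_closed hecke_deg_closed[OF v(1)] zeta_cl)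
    finally have "weight \<nu> \<mu> \<alpha> \<odot>\<^bsub>?E\<^esub> place_operator I G K M S c (lev \<nu>) v (zeta (lev \<nu>) (rep \<mu> \<alpha>)) =
        weight \<nu> \<mu> \<alpha> \<odot>\<^bsub>?E\<^esub> (\<Oplus>\<^bsub>?E\<^esub>i\<in>{1..r v}. hecke_deg v i \<odot>\<^bsub>?E\<^esub> zeta (lev \<nu>) (rep (insert v \<mu>) (\<alpha>(v := i))))"
      by (rule arg_cong)
    also have "\<dots> = (\<Oplus>\<^bsub>?E\<^esub>i\<in>{1..r v}. weight \<nu> \<mu> \<alpha> \<odot>\<^bsub>?E\<^esub>
        (hecke_deg v i \<odot>\<^bsub>?E\<^esub> zeta (lev \<nu>) (rep (insert v \<mu>) (\<alpha>(v := i)))))"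
      by (intro E.finsum_smult_ldistr weight_closed[OF \<mu>(2) \<alpha>] finite_atLeastAtMost Pi_I)
        (simp only: E.smult_closed hecke_deg_closed[OF v(1)] zeta_cl)
    also have "\<dots> = (\<Oplus>\<^bsub>?E\<^esub>i\<in>{1..r v}. f (\<alpha>(v := i)))"
    proof (rule E.M.finsum_eq[OF refl])
      show "(\<lambda>i. f (\<alpha>(v := i))) \<in> {1..r v} \<rightarrow> carrier ?E" by (rule Pi_I) (rule f[OF upd[OF \<alpha>]])
      fix i assume i: "i \<in> {1..r v}"
      show "weight \<nu> \<mu> \<alpha> \<odot>\<^bsub>?E\<^esub> (hecke_deg v i \<odot>\<^bsub>?E\<^esub> zeta (lev \<nu>) (rep (insert v \<mu>) (\<alpha>(v := i)))) = f (\<alpha>(v := i))"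
        using E.smult_assoc1[OF weight_closed[OF \<mu>(2) \<alpha>, of \<nu>] hecke_deg_closed[OF v(1) i] zeta_cl[OF i]]
        by (simp only: f_def weight_upd[OF i])
    qed
    also have "\<dots> = (\<Oplus>\<^bsub>?E\<^esub>\<beta>\<in>(\<lambda>i. \<alpha>(v := i)) ` {1..r v}. f \<beta>)"
    proof (rule E.M.add.finprod_reindex[symmetric])
      show "f \<in> (\<lambda>i. \<alpha>(v := i)) ` {1..r v} \<rightarrow> carrier ?E" using f[OF upd[OF \<alpha>]] by blast
      show "inj_on (\<lambda>i. \<alpha>(v := i)) {1..r v}" by (rule inj_onI) (metis fun_upd_same)
    qed
    finally show ?thesis .
  qed
  have "place_operator I G K M S c (lev \<nu>) v (zeta_sum \<nu> \<mu>) =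
      (\<Oplus>\<^bsub>?E\<^esub>\<alpha>\<in>choices \<mu>. place_operator I G K M S c (lev \<nu>) v (weight \<nu> \<mu> \<alpha> \<odot>\<^bsub>?E\<^esub> zeta (lev \<nu>) (rep \<mu> \<alpha>)))"
    unfolding zeta_sum_def using zeta_sum_summand_closed(2)[OF \<nu>(1,2) \<mu>(1,2)]
    by (intro linear_maps_finsum[OF E.module_axioms E.module_axioms place_operator_linear[OF lev v(1)]]) blast
  also have "\<dots> = (\<Oplus>\<^bsub>?E\<^esub>\<alpha>\<in>choices \<mu>. \<Oplus>\<^bsub>?E\<^esub>\<beta>\<in>(\<lambda>i. \<alpha>(v := i)) ` {1..r v}. f \<beta>)"
  proof (rule E.M.finsum_eq[OF refl])
    show "(\<lambda>\<alpha>. \<Oplus>\<^bsub>?E\<^esub>\<beta>\<in>(\<lambda>i. \<alpha>(v := i)) ` {1..r v}. f \<beta>) \<in> choices \<mu> \<rightarrow> carrier ?E"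
      using f upd by (intro Pi_I E.M.finsum_closed) blast
    fix \<alpha> assume \<alpha>: "\<alpha> \<in> choices \<mu>"
    show "place_operator I G K M S c (lev \<nu>) v (weight \<nu> \<mu> \<alpha> \<odot>\<^bsub>?E\<^esub> zeta (lev \<nu>) (rep \<mu> \<alpha>)) =
        (\<Oplus>\<^bsub>?E\<^esub>\<beta>\<in>(\<lambda>i. \<alpha>(v := i)) ` {1..r v}. f \<beta>)"
      using linear_maps_smult[OF place_operator_linear[OF lev v(1)] weight_closed[OF \<mu>(2) \<alpha>]
        zeta_sum_summand_closed(1)[OF \<nu>(1,2) \<mu>(1,2) \<alpha>]] summand[OF \<alpha>] by simp
  qed
  also have "\<dots> = (\<Oplus>\<^bsub>?E\<^esub>\<beta>\<in>(\<Union>\<alpha>\<in>choices \<mu>. (\<lambda>i. \<alpha>(v := i)) ` {1..r v}). f \<beta>)"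
  proof (rule E.M.finsum_UN_disjoint[symmetric])
    show "pairwise (\<lambda>\<alpha> \<alpha>'. disjnt ((\<lambda>i. \<alpha>(v := i)) ` {1..r v}) ((\<lambda>i. \<alpha>'(v := i)) ` {1..r v})) (choices \<mu>)"
    proof (intro pairwiseI)
      fix \<alpha> \<alpha>' assume *: "\<alpha> \<in> choices \<mu>" "\<alpha>' \<in> choices \<mu>" "\<alpha> \<noteq> \<alpha>'"
      \<comment> \<open>Choice functions on \<mu> are \<open>undefined\<close> at v, so overwriting
        that value loses no information.\<close>
      have "\<alpha> = \<alpha>'" if "\<alpha>(v := i) = \<alpha>'(v := i')" for i i'
      proof
        fix w show "\<alpha> w = \<alpha>' w"
          using fun_cong[OF that, of w] * v(2) by (cases "w = v") (auto simp: PiE_iff extensional_def)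
      qed
      then show "disjnt ((\<lambda>i. \<alpha>(v := i)) ` {1..r v}) ((\<lambda>i. \<alpha>'(v := i)) ` {1..r v})"
        using *(3) by (auto simp: disjnt_def)
    qed
  qed (use f upd finite_choices[OF \<mu>(1)] in auto)
  also have "(\<Union>\<alpha>\<in>choices \<mu>. (\<lambda>i. \<alpha>(v := i)) ` {1..r v}) = choices (insert v \<mu>)"
    by (auto simp: PiE_insert_eq)
  finally show ?thesis unfolding f_def zeta_sum_def .
qed

text \<open>Each operator adjoins its place to the second argument of \<open>zeta_sum\<close>. The
  outcome depends only on the set of places, so on these classes every order of composition gives
  the same result.\<close>

lemma places_operator_zeta_sum:
  assumes "finite \<nu>" "\<nu> \<subseteq> I" "distinct vs" "set vs \<subseteq> I" "set vs \<inter> \<nu> = {}"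
  shows "places_operator I G K M S c (lev \<nu>) vs (zeta_sum \<nu> \<nu>) = zeta_sum \<nu> (set vs \<union> \<nu>)"
  using assms(3-5)
proof (induction vs)
  case (Cons v vs)
  then have "places_operator I G K M S c (lev \<nu>) (v # vs) (zeta_sum \<nu> \<nu>) =
      place_operator I G K M S c (lev \<nu>) v (zeta_sum \<nu> (set vs \<union> \<nu>))"
    by (simp add: places_operator_def)
  also have "\<dots> = zeta_sum \<nu> (insert v (set vs \<union> \<nu>))"
    using Cons.prems assms(1,2) by (intro place_operator_zeta_sum) auto
  finally show ?case by simp
qed (simp add: places_operator_def)

text \<open>The trace leaves the representative unchanged and multiplies by an index that factors
  over \<mu>. At a place w of \<mu> outside \<nu> the factor is d for the index chosen by \<alpha>,
  and z d is the degree; this turns \<open>weight \<mu> \<mu> \<alpha>\<close> into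
  \<open>weight \<nu> \<mu> \<alpha>\<close>.\<close>

lemma push_zeta_sum:
  assumes \<mu>: "finite \<mu>" "\<mu> \<subseteq> I" and "\<nu> \<subseteq> \<mu>"
  shows "push M (lev \<mu>) (lev \<nu>) \<one>\<^bsub>A\<^esub> (zeta_sum \<mu> \<mu>) = zeta_sum \<nu> \<mu>"
proof -
  have \<nu>: "finite \<nu>" "\<nu> \<subseteq> I" using assms finite_subset by blast+
  note lev = product_level[OF \<nu>] and lev' = product_level[OF \<mu>] and sub = lev_mono[OF assms(3)]
  let ?E = "val M (lev \<nu>)"
  interpret E: module R ?E by (rule M.val_module[OF lev])
  have lin: "push M (lev \<mu>) (lev \<nu>) \<one>\<^bsub>A\<^esub> \<in> linear_maps R (val M (lev \<mu>)) ?E"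
    using M.push_linear[OF lev' lev level_hom_one[OF lev' sub]] .
  have summand: "push M (lev \<mu>) (lev \<nu>) \<one>\<^bsub>A\<^esub> (weight \<mu> \<mu> \<alpha> \<odot>\<^bsub>val M (lev \<mu>)\<^esub> zeta (lev \<mu>) (rep \<mu> \<alpha>)) =
      weight \<nu> \<mu> \<alpha> \<odot>\<^bsub>?E\<^esub> zeta (lev \<nu>) (rep \<mu> \<alpha>)" if \<alpha>: "\<alpha> \<in> choices \<mu>" for \<alpha>
  proof -
    note rep = rep_closed[OF \<mu> \<alpha>]
    define P where "P w X = conjugate (G w) (rep \<mu> \<alpha> w) X \<inter> H w" for w X
    \<comment> \<open>At places of \<nu> both levels have component L, whence the value 1.\<close>
    define d where "d w = (if w \<in> \<nu> then 1 else index (G w) (P w (K w)) (P w (L w)))" for w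
    have \<alpha>r: "\<alpha> w \<in> {1..r w}" if "w \<in> \<mu>" for w using \<alpha> that by auto
    have P_sub: "subgroup (P w X) (G w)" if "w \<in> I" "subgroup X (G w)" for w X
      unfolding P_def
      using group.subgroups_Inter_pair[OF group_factor group.subgroup_conjugate[OF group_factor component_closed[OF rep]] subgroup_H]
        that by blast
    have lev_sub: "subgroup (if w \<in> \<kappa> then L w else K w) (G w)" if "w \<in> I" for w \<kappa>
      using subgroup_L[OF that] subgroup_factor[OF that] by simp
    have conj: "conjugate A (rep \<mu> \<alpha>) (lev \<kappa>) \<inter> B = (\<Pi>\<^sub>E w\<in>I. P w (if w \<in> \<kappa> then L w else K w))"
      if "finite \<kappa>" "\<kappa> \<subseteq> I" for \<kappa>
      using conjugate_PiE_Int_B[OF rep, of "\<lambda>w. if w \<in> \<kappa> then L w else K w"] product_level[OF that]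
        subgroup.subset[OF lev_sub] by (simp add: lev_eq P_def)
    have "index A (conjugate A (rep \<mu> \<alpha>) (lev \<nu>) \<inter> B) (conjugate A (rep \<mu> \<alpha>) (lev \<mu>) \<inter> B) =
        (\<Prod>w\<in>\<mu>. index (G w) (P w (if w \<in> \<nu> then L w else K w)) (P w (if w \<in> \<mu> then L w else K w)))"
      unfolding conj[OF \<nu>] conj[OF \<mu>]
      using P_sub lev_sub \<mu> assms(3) by (intro index_PiE) auto
    also have "\<dots> = (\<Prod>w\<in>\<mu>. d w)"
    proof (rule prod.cong[OF refl])
      fix w assume w: "w \<in> \<mu>"
      then have "w \<in> I" using \<mu> by blast
      then show "index (G w) (P w (if w \<in> \<nu> then L w else K w)) (P w (if w \<in> \<mu> then L w else K w)) = d w"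
        using w index_self[OF P_sub[OF _ subgroup_L] group_factor] by (simp add: d_def)
    qed
    finally have idx: "index A (conjugate A (rep \<mu> \<alpha>) (lev \<nu>) \<inter> B) (conjugate A (rep \<mu> \<alpha>) (lev \<mu>) \<inter> B) = (\<Prod>w\<in>\<mu>. d w)" .
    have weights: "weight \<mu> \<mu> \<alpha> \<otimes>\<^bsub>R\<^esub> [(\<Prod>w\<in>\<mu>. d w)] \<cdot>\<^bsub>R\<^esub> \<one>\<^bsub>R\<^esub> = weight \<nu> \<mu> \<alpha>"
    proof -
      have zR: "z w (\<alpha> w) \<in> carrier R" if "w \<in> \<mu>" for w using z \<alpha>r[OF that] \<mu> that by blast
      have "weight \<mu> \<mu> \<alpha> = (\<Otimes>\<^bsub>R\<^esub>w\<in>\<mu>. z w (\<alpha> w))"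
        unfolding weight_def using zR by (intro E.R.finprod_cong') auto
      then have "weight \<mu> \<mu> \<alpha> \<otimes>\<^bsub>R\<^esub> [(\<Prod>w\<in>\<mu>. d w)] \<cdot>\<^bsub>R\<^esub> \<one>\<^bsub>R\<^esub> =
          (\<Otimes>\<^bsub>R\<^esub>w\<in>\<mu>. z w (\<alpha> w)) \<otimes>\<^bsub>R\<^esub> (\<Otimes>\<^bsub>R\<^esub>w\<in>\<mu>. [d w] \<cdot>\<^bsub>R\<^esub> \<one>\<^bsub>R\<^esub>)"
        by (simp add: E.R.finprod_nat)
      also have "\<dots> = (\<Otimes>\<^bsub>R\<^esub>w\<in>\<mu>. z w (\<alpha> w) \<otimes>\<^bsub>R\<^esub> [d w] \<cdot>\<^bsub>R\<^esub> \<one>\<^bsub>R\<^esub>)"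
        using zR nat_one_closed by (intro E.R.finprod_multf[symmetric]) auto
      also have "\<dots> = weight \<nu> \<mu> \<alpha>"
        unfolding weight_def
      proof (rule E.R.finprod_cong'[OF refl weight_factor_closed[OF \<mu>(2) \<alpha>]])
        fix w assume w: "w \<in> \<mu>"
        then have "rep \<mu> \<alpha> w = g w (\<alpha> w)" "w \<in> I" using \<mu> by (auto simp: rep_def)
        then show "z w (\<alpha> w) \<otimes>\<^bsub>R\<^esub> [d w] \<cdot>\<^bsub>R\<^esub> \<one>\<^bsub>R\<^esub> = (if w \<in> \<nu> then z w (\<alpha> w) else hecke_deg w (\<alpha> w))"
          using zR[OF w] hecke_deg_eq[OF _ \<alpha>r[OF w]]
          by (simp add: d_def P_def Int_commute E.R.add_pow_rdistr)
      qed
      finally show ?thesis .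
    qed
    have "push M (lev \<mu>) (lev \<nu>) \<one>\<^bsub>A\<^esub> (weight \<mu> \<mu> \<alpha> \<odot>\<^bsub>val M (lev \<mu>)\<^esub> zeta (lev \<mu>) (rep \<mu> \<alpha>)) =
        weight \<mu> \<mu> \<alpha> \<odot>\<^bsub>?E\<^esub> push M (lev \<mu>) (lev \<nu>) \<one>\<^bsub>A\<^esub> (zeta (lev \<mu>) (rep \<mu> \<alpha>))"
      using linear_maps_smult[OF lin weight_closed[OF \<mu>(2) \<alpha>] zeta_sum_summand_closed(1)[OF \<mu> \<mu> \<alpha>]] .
    also have "push M (lev \<mu>) (lev \<nu>) \<one>\<^bsub>A\<^esub> (zeta (lev \<mu>) (rep \<mu> \<alpha>)) =
        ([(\<Prod>w\<in>\<mu>. d w)] \<cdot>\<^bsub>R\<^esub> \<one>\<^bsub>R\<^esub>) \<odot>\<^bsub>?E\<^esub> zeta (lev \<nu>) (rep \<mu> \<alpha>)"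
      using push_zeta[OF lev lev' sub rep] idx by simp
    also have "weight \<mu> \<mu> \<alpha> \<odot>\<^bsub>?E\<^esub> \<dots> = weight \<nu> \<mu> \<alpha> \<odot>\<^bsub>?E\<^esub> zeta (lev \<nu>) (rep \<mu> \<alpha>)"
      unfolding weights[symmetric]
      using weight_closed[OF \<mu>(2) \<alpha>] nat_one_closed zeta_sum_summand_closed(1)[OF \<nu> \<mu> \<alpha>]
      by (intro E.smult_assoc1[symmetric]) auto
    finally show ?thesis .
  qed
  have "push M (lev \<mu>) (lev \<nu>) \<one>\<^bsub>A\<^esub> (zeta_sum \<mu> \<mu>) = (\<Oplus>\<^bsub>?E\<^esub>\<alpha>\<in>choices \<mu>.
      push M (lev \<mu>) (lev \<nu>) \<one>\<^bsub>A\<^esub> (weight \<mu> \<mu> \<alpha> \<odot>\<^bsub>val M (lev \<mu>)\<^esub> zeta (lev \<mu>) (rep \<mu> \<alpha>)))"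
    unfolding zeta_sum_def[of \<mu> \<mu>] using zeta_sum_summand_closed(2)[OF \<mu> \<mu>]
    by (intro linear_maps_finsum[OF M.val_module[OF lev'] E.module_axioms lin]) blast
  also have "\<dots> = zeta_sum \<nu> \<mu>"
    unfolding zeta_sum_def[of \<nu> \<mu>] using zeta_sum_summand_closed(2)[OF \<nu> \<mu>] summand
    by (intro E.M.finsum_eq) auto
  finally show ?thesis .
qed

text \<open>There is exactly one choice over the empty set, the function that is
  \<open>undefined\<close> everywhere. Its weight is an empty product and its representative is 1,
  so the zeta class is \<iota> followed by the push along an identity.\<close>

lemma zeta_sum_empty: "zeta_sum {} {} = \<iota> (\<Pi>\<^sub>E w\<in>I. H w \<inter> K w) (Pi\<^sub>E I K) \<one>\<^bsub>R\<^esub>"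
proof -
  have lev: "lev {} = Pi\<^sub>E I K" by (simp add: lev_eq)
  have K: "Pi\<^sub>E I K \<in> \<Upsilon>" using product_level[of "{}"] by (simp add: lev)
  let ?E = "val M (Pi\<^sub>E I K)"
  interpret E: module R ?E by (rule M.val_module[OF K])
  have rep: "rep {} \<alpha> = \<one>\<^bsub>A\<^esub>" for \<alpha> by (simp add: rep_def one_A)
  have "Pi\<^sub>E I K \<inter> B = Pi\<^sub>E I K \<inter> Pi\<^sub>E I H" using level_subset[OF K] by (auto simp: B_eq)
  also have "\<dots> = (\<Pi>\<^sub>E w\<in>I. H w \<inter> K w)" unfolding PiE_Int by (simp add: Int_commute)
  finally have int: "Pi\<^sub>E I K \<inter> B = (\<Pi>\<^sub>E w\<in>I. H w \<inter> K w)" .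
  have "zeta_sum {} {} = weight {} {} (\<lambda>_. undefined) \<odot>\<^bsub>?E\<^esub> zeta (Pi\<^sub>E I K) \<one>\<^bsub>A\<^esub>"
    using zeta_closed[OF K A.one_closed] by (simp add: zeta_sum_def lev rep weight_def)
  also have "\<dots> = zeta (Pi\<^sub>E I K) \<one>\<^bsub>A\<^esub>"
    using zeta_closed[OF K A.one_closed] by (simp add: weight_def)
  also have "\<dots> = \<iota> (\<Pi>\<^sub>E w\<in>I. H w \<inter> K w) (Pi\<^sub>E I K) \<one>\<^bsub>R\<^esub>"
    using M.push_id[OF K iota_one_closed[OF restrict_level[OF K] K Int_lower1]] A.conjugate_one[OF level_subset[OF K]]
    by (simp add: zeta_def int)
  finally show ?thesis .
qed

end

text \<open>The composite of the commuting operators is expressed through every duplicate-free list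
  of the places of \<mu> outside \<nu>, so no order has to be singled out.\<close>

theorem theorem2:
  fixes p :: nat
    and I :: "'i set"
    and G :: "'i \<Rightarrow> ('g, 'x) monoid_scheme" and T :: "'i \<Rightarrow> 'g topology"
    and H K L :: "'i \<Rightarrow> 'g set"
    and \<Upsilon>\<^sub>G \<Upsilon>\<^sub>H :: "('i \<Rightarrow> 'g) set set"
    and M :: "('i \<Rightarrow> 'g, nat \<Rightarrow> int, 'm) ric"
    and \<iota> :: "('i \<Rightarrow> 'g) set \<Rightarrow> ('i \<Rightarrow> 'g) set \<Rightarrow> (nat \<Rightarrow> int) \<Rightarrow> 'm"
    and S :: "'i \<Rightarrow> 'g set" and c :: "'i \<Rightarrow> 'g \<Rightarrow> nat \<Rightarrow> int"
    and r :: "'i \<Rightarrow> nat" and g :: "'i \<Rightarrow> nat \<Rightarrow> 'g"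
  defines "Zp \<equiv> padic_integers p"
    and "GA \<equiv> restricted_product I G K"
    and "TG \<equiv> restricted_topology I T K"
    and "Hv \<equiv> \<lambda>v. G v\<lparr>carrier := H v\<rparr>"
    and "U \<equiv> \<lambda>v. H v \<inter> K v"
    and "HA \<equiv> restricted_product I (\<lambda>v. G v\<lparr>carrier := H v\<rparr>) (\<lambda>v. H v \<inter> K v)"
    and "TH \<equiv> restricted_topology I (\<lambda>v. subtopology (T v) (H v)) (\<lambda>v. H v \<inter> K v)"
    and "lev \<equiv> product_level I K L"
    and "supp \<equiv> \<lambda>v. hecke_support (padic_integers p) (G v) (K v) (S v) (c v)"
    and "Hvi \<equiv> \<lambda>v i. H v \<inter> conjugate (G v) (g v i) (K v)"
    and "Vvi \<equiv> \<lambda>v i. H v \<inter> conjugate (G v) (g v i) (L v)"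
  assumes p: "prime p"
    and G: "\<And>v. v \<in> I \<Longrightarrow> locally_profinite (G v) (T v) \<and> unimodular (G v) (T v)"
    and H: "\<And>v. v \<in> I \<Longrightarrow> subgroup (H v) (G v) \<and> closedin (T v) (H v) \<and>
      locally_profinite (Hv v) (subtopology (T v) (H v)) \<and>
      unimodular (Hv v) (subtopology (T v) (H v))"
    and K: "\<And>v. v \<in> I \<Longrightarrow> compact_open_subgroup (G v) (T v) (K v)"
    and L: "\<And>v. v \<in> I \<Longrightarrow> compact_open_subgroup (G v) (T v) (L v) \<and>
      L v \<lhd> (G v\<lparr>carrier := K v\<rparr>)"
    and levels_G: "level_family GA TG \<Upsilon>\<^sub>G"
    and K_level: "Pi\<^sub>E I K \<in> \<Upsilon>\<^sub>G"
    and K_nu_level: "\<And>\<nu>. \<lbrakk>finite \<nu>; \<nu> \<subseteq> I\<rbrakk> \<Longrightarrow> lev \<nu> \<in> \<Upsilon>\<^sub>G"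
    and levels_H: "level_family HA TH \<Upsilon>\<^sub>H"
    and restrict_levels: "\<And>K'. K' \<in> \<Upsilon>\<^sub>G \<Longrightarrow> K' \<inter> carrier HA \<in> \<Upsilon>\<^sub>H"
    and M: "comack_functor Zp GA \<Upsilon>\<^sub>G M"
    and iota: "mackey_pushforward Zp HA \<Upsilon>\<^sub>H (trivial_functor Zp HA) GA \<Upsilon>\<^sub>G M \<iota>"
    and S: "\<And>v. v \<in> I \<Longrightarrow> finite (S v) \<and> S v \<subseteq> carrier (G v) \<and> c v \<in> S v \<rightarrow> carrier Zp"
    and g: "\<And>v. v \<in> I \<Longrightarrow> inj_on (g v) {1..r v} \<and>
      double_coset_reps (G v) (H v) (H v <#>\<^bsub>G v\<^esub> supp v) (K v) (g v ` {1..r v})"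
    and degree: "\<And>v i. \<lbrakk>v \<in> I; 1 \<le> i; i \<le> r v\<rbrakk> \<Longrightarrow>
      \<exists>z\<in>carrier Zp.
        hecke_degree Zp (Hv v) (U v) (Hvi v i)
          (\<lambda>h. hecke_function Zp (G v) (K v) (S v) (c v) (h \<otimes>\<^bsub>G v\<^esub> g v i)) =
        [index (G v) (Hvi v i) (Vvi v i)] \<cdot>\<^bsub>Zp\<^esub> z"
  shows "\<exists>y. (\<forall>\<nu>. finite \<nu> \<and> \<nu> \<subseteq> I \<longrightarrow> y \<nu> \<in> carrier (val M (lev \<nu>))) \<and>
    y {} = \<iota> (Pi\<^sub>E I U) (Pi\<^sub>E I K) \<one>\<^bsub>Zp\<^esub> \<and>
    (\<forall>\<nu> \<mu> vs. finite \<mu> \<and> \<mu> \<subseteq> I \<and> \<nu> \<subseteq> \<mu> \<and> distinct vs \<and> set vs = \<mu> - \<nu> \<longrightarrow>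
      places_operator I G K M S c (lev \<nu>) vs (y \<nu>) = push M (lev \<mu>) (lev \<nu>) \<one>\<^bsub>GA\<^esub> (y \<mu>))"
proof -
  interpret rf: restricted_family I G K
  proof (rule restricted_family.intro)
    show "Group.group (G v)" "subgroup (K v) (G v)" if "v \<in> I" for v
      using G[OF that] K[OF that] by (simp_all add: locally_profinite_def topological_group_def compact_open_subgroup_def)
  qed
  have cring: "cring Zp" unfolding Zp_def using p by (intro cring_padic_integers) (simp add: prime_gt_0_nat)
  have "Pi\<^sub>E I H \<subseteq> (\<Pi>\<^sub>E v\<in>I. carrier (G v))"
    by (rule PiE_mono) (use H subgroup.subset in blast)
  \<comment> \<open>Once all components lie in H_v, being outside U_v and being outside K_v are the
    same. Hence the two restricted-product conditions agree on H.\<close>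
  moreover have "{v \<in> I. x v \<notin> H v \<inter> K v} = {v \<in> I. x v \<notin> K v}" if "x \<in> Pi\<^sub>E I H" for x
    using that by auto
  moreover have "carrier HA = {x \<in> Pi\<^sub>E I H. finite {v \<in> I. x v \<notin> H v \<inter> K v}}"
    by (simp add: HA_def restricted_product_def)
  ultimately have carrier_HA: "carrier HA = carrier GA \<inter> Pi\<^sub>E I H"
    unfolding GA_def rf.carrier_A by auto
  \<comment> \<open>Multiplication and unit of a product group do not refer to the carriers of its
    factors, so restricting the factors changes only the carrier.\<close>
  have HA_eq: "HA = GA\<lparr>carrier := carrier HA\<rparr>"
    by (simp add: HA_def GA_def restricted_product_def product_group_def)
  have group_GA: "group GA" unfolding GA_def by (rule rf.group_A)
  have group_HA: "group HA" unfolding HA_def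
  proof (rule restricted_family.group_A, rule restricted_family.intro)
    fix v assume v: "v \<in> I"
    interpret group "G v" by (rule rf.group_factor[OF v])
    have sH: "subgroup (H v) (G v)" using H[OF v] by simp
    show "Group.group (G v\<lparr>carrier := H v\<rparr>)" by (rule subgroup_imp_group[OF sH])
    show "subgroup (H v \<inter> K v) (G v\<lparr>carrier := H v\<rparr>)"
      by (rule subgroup_incl[OF subgroups_Inter_pair[OF sH rf.subgroup_factor[OF v]] sH]) auto
  qed
  have sub_HA: "subgroup (carrier HA) GA"
  proof (rule group.group_incl_imp_subgroup[OF group_GA])
    show "carrier HA \<subseteq> carrier GA" by (simp add: carrier_HA)
    show "Group.group (GA\<lparr>carrier := carrier HA\<rparr>)" using group_HA by (subst (asm) HA_eq)
  qed
  \<comment> \<open>All quotients are chosen simultaneously, before any \<nu> is fixed.\<close>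
  have "\<exists>z. \<forall>v\<in>I. \<forall>i\<in>{1..r v}. z v i \<in> carrier Zp \<and>
      hecke_degree Zp (G v\<lparr>carrier := H v\<rparr>) (H v \<inter> K v) (H v \<inter> conjugate (G v) (g v i) (K v))
        (\<lambda>h. hecke_function Zp (G v) (K v) (S v) (c v) (h \<otimes>\<^bsub>G v\<^esub> g v i)) =
      [index (G v) (H v \<inter> conjugate (G v) (g v i) (K v)) (H v \<inter> conjugate (G v) (g v i) (L v))] \<cdot>\<^bsub>Zp\<^esub> z v i"
    (is "\<exists>z. \<forall>v\<in>I. \<forall>i\<in>{1..r v}. ?ok v i (z v i)")
  proof -
    have "\<forall>v i. \<exists>z. v \<in> I \<longrightarrow> i \<in> {1..r v} \<longrightarrow> ?ok v i z"
      using degree unfolding Hv_def U_def Hvi_def Vvi_def by (metis atLeastAtMost_iff)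
    then show ?thesis by metis
  qed
  then obtain z where z: "\<And>v i. \<lbrakk>v \<in> I; i \<in> {1..r v}\<rbrakk> \<Longrightarrow> ?ok v i (z v i)" by blast
  interpret zeta_data I G K Zp TG \<Upsilon>\<^sub>G "carrier HA" TH \<Upsilon>\<^sub>H M \<iota> T H L S c r g z
  proof (intro zeta_data.intro trivial_pushforward.intro zeta_data_axioms.intro trivial_pushforward_axioms.intro)
    show "restricted_family I G K" by (rule rf.restricted_family_axioms)
    show "Group.group rf.A" using group_GA by (simp add: GA_def)
    show "level_family rf.A TG \<Upsilon>\<^sub>G" using levels_G by (simp add: GA_def)
    show "level_family (rf.A\<lparr>carrier := carrier HA\<rparr>) TH \<Upsilon>\<^sub>H"
      using levels_H HA_eq by (simp add: GA_def)
    show "mackey_pushforward Zp (rf.A\<lparr>carrier := carrier HA\<rparr>) \<Upsilon>\<^sub>H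
        (trivial_functor Zp (rf.A\<lparr>carrier := carrier HA\<rparr>)) rf.A \<Upsilon>\<^sub>G M \<iota>"
      using iota HA_eq by (simp add: GA_def)
    show "subgroup (carrier HA) rf.A" using sub_HA by (simp add: GA_def)
    show "carrier HA = carrier rf.A \<inter> Pi\<^sub>E I H" using carrier_HA by (simp add: GA_def)
  next
    fix v assume v: "v \<in> I"
    show "topological_group (G v) (T v)" using G[OF v] by (simp add: locally_profinite_def)
    show "compact_open_subgroup (G v) (T v) (K v)" by (rule K[OF v])
    show "subgroup (H v) (G v)" using H[OF v] by simp
    show "subgroup (L v) (G v)" using L[OF v] by (simp add: compact_open_subgroup_def)
    show "L v \<subseteq> K v" using L[OF v] normal_imp_subgroup subgroup.subset by fastforce
    show "finite (S v)" "S v \<subseteq> carrier (G v)" "c v \<in> S v \<rightarrow> carrier Zp" using S[OF v] by auto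
    show "inj_on (g v) {1..r v}" using g[OF v] by simp
    show "double_coset_reps (G v) (H v) (H v <#>\<^bsub>G v\<^esub> hecke_support Zp (G v) (K v) (S v) (c v)) (K v) (g v ` {1..r v})"
      using g[OF v] by (simp add: supp_def Zp_def)
  qed (use restrict_levels K_nu_level z in \<open>auto simp: lev_def\<close>)
  show ?thesis
  \<comment> \<open>The witness is the diagonal of \<open>zeta_sum\<close>, where every weight is a
    product of quotients z. Both sides of the relation for \<nu> and \<mu> then equal
    \<open>zeta_sum \<nu> \<mu>\<close>.\<close>
  proof (intro exI[of _ "\<lambda>\<nu>. zeta_sum \<nu> \<nu>"] conjI allI impI)
    fix \<nu> assume "finite \<nu> \<and> \<nu> \<subseteq> I"
    then show "zeta_sum \<nu> \<nu> \<in> carrier (val M (lev \<nu>))" unfolding lev_def using zeta_sum_closed by blast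
  next
    show "zeta_sum {} {} = \<iota> (Pi\<^sub>E I U) (Pi\<^sub>E I K) \<one>\<^bsub>Zp\<^esub>" unfolding U_def by (rule zeta_sum_empty)
  next
    fix \<nu> \<mu> :: "'i set" and vs
    assume *: "finite \<mu> \<and> \<mu> \<subseteq> I \<and> \<nu> \<subseteq> \<mu> \<and> distinct vs \<and> set vs = \<mu> - \<nu>"
    then have "finite \<nu>" "\<nu> \<subseteq> I" "set vs \<subseteq> I" "set vs \<inter> \<nu> = {}" "set vs \<union> \<nu> = \<mu>"
      using finite_subset by auto
    then show "places_operator I G K M S c (lev \<nu>) vs (zeta_sum \<nu> \<nu>) =
        push M (lev \<mu>) (lev \<nu>) \<one>\<^bsub>GA\<^esub> (zeta_sum \<mu> \<mu>)"
      unfolding lev_def GA_def using * places_operator_zeta_sum[of \<nu> vs] push_zeta_sum[of \<mu> \<nu>] by simp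
  qed
qed

end
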